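(* Let $X$ be a separable Banach space with $\mathrm{Sz}(X)=\omega_0$, and let $p_X$ be the Szlenk power type of $X$. Then for any $q>p_X$ there is an equivalent norm $|\cdot|$ on $X$ and a constant $c>0$ such that, if $0<\tau\le1$ and $x^*,x_n^*\in X^*$ ($n\in\mathbb N$) satisfy $|x^*|=1$, $|x_n^*|=\tau$ for all $n$, and $x_n^*\to0$ weak$^*$ (where $|\cdot|$ on $X^*$ is the dual norm), then $$\liminf_{n\to\infty}|x^*+x_n^*|\ge 1+c\tau^q.$$
   Context: For a weak$^*$-compact $K\subset X^*$ and $\epsilon>0$, $\iota_\epsilon K$ is $K$ minus the union of all weak$^*$-open $V\subset X^*$ with norm-diameter of $V\cap K$ at most $\epsilon$. Put $\iota_\epsilon^0K=K$, $\iota_\epsilon^{\alpha+1}K=\iota_\epsilon\iota_\epsilon^\alpha K$, and $\iota_\epsilon^\alpha K=\bigcap_{\beta<\alpha}\iota_\epsilon^\beta K$ for limit ordinals $\alpha$. $\mathrm{Sz}(X,\epsilon)$ is the least countable ordinal $\alpha$ with $\iota_\epsilon^\alpha B_{X^*}=\emptyset$ ($\omega_1$ if none), where $B_{X^*}$ is the closed unit ball of $X^*$; $\mathrm{Sz}(X)=\sup_{\epsilon>0}\mathrm{Sz}(X,\epsilon)$. $\omega_0$ is the first infinite ordinal; $\mathrm{Sz}(X)=\omega_0$ implies that $\mathrm{Sz}(X,\epsilon)$ is a finite ordinal for every $\epsilon>0$. When $\mathrm{Sz}(X)=\omega_0$, the limit $p_X=\lim_{\epsilon\to0}\frac{\log\mathrm{Sz}(X,\epsilon)}{|\log\epsilon|}$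 exists with $1\le p_X<\infty$; it is called the Szlenk power type of $X$. Equivalently, $p_X$ is the infimum of all $q$ such that $\epsilon^q\,\mathrm{Sz}(X,\epsilon)$ is bounded for $0<\epsilon<1$. *)

theory Defs
  imports "HOL-Analysis.Analysis"
begin

section \<open>Ordinals\<close>

text \<open>
  An ordinal is represented as an order type of a well-ordering of a set of sets of natural numbers.
  All ordinals of cardinality at most that of the continuum occur, in particular all countable
  ordinals and the first uncountable ordinal. The order is embeddability of well-orderings,
  so that \<open>{..<\<alpha>}\<close> has order type \<open>\<alpha>\<close>.
\<close>

lemma ordIso_Well_order: "(r, s) \<in> ordIso \<Longrightarrow> Well_order r \<and> Well_order s"
  by (simp add: ordIso_def)

quotient_type ordinal = "nat set rel" / partial: "\<lambda>r s. (r, s) \<in> ordIso"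
proof (rule part_equivpI)
  have "Well_order ({} :: nat set rel)"
    by (simp add: well_order_on_def linear_order_on_def partial_order_on_def preorder_on_def
        refl_on_def trans_def antisym_def total_on_def)
  then show "\<exists>r :: nat set rel. (r, r) \<in> ordIso"
    using ordIso_reflexive by blast
  show "symp (\<lambda>r s :: nat set rel. (r, s) \<in> ordIso)"
    by (auto intro: sympI ordIso_symmetric)
  show "transp (\<lambda>r s :: nat set rel. (r, s) \<in> ordIso)"
    by (auto intro: transpI ordIso_transitive)
qed

instantiation ordinal :: linorder
begin

lift_definition less_eq_ordinal :: "ordinal \<Rightarrow> ordinal \<Rightarrow> bool" is "\<lambda>r s. (r, s) \<in> ordLeq"
  by (meson ordIso_ordLeq_trans ordIso_symmetric ordLeq_ordIso_trans)

lift_definition less_ordinal :: "ordinal \<Rightarrow> ordinal \<Rightarrow> bool" is "\<lambda>r s. (r, s) \<in> ordLess"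
  by (meson ordIso_ordLess_trans ordIso_symmetric ordLess_ordIso_trans)

instance
proof
  fix x y z :: ordinal
  show "x < y \<longleftrightarrow> x \<le> y \<and> \<not> y \<le> x"
    by transfer (metis not_ordLess_ordLeq ordIso_Well_order ordLess_imp_ordLeq not_ordLeq_iff_ordLess)
  show "x \<le> x"
    by transfer (meson ordIso_Well_order ordLeq_reflexive)
  show "x \<le> y \<Longrightarrow> y \<le> z \<Longrightarrow> x \<le> z"
    by transfer (rule ordLeq_transitive)
  show "x \<le> y \<Longrightarrow> y \<le> x \<Longrightarrow> x = y"
    by transfer (simp add: ordIso_iff_ordLeq)
  show "x \<le> y \<or> y \<le> x"
    by transfer (meson ordIso_Well_order ordLeq_total)
qed

end

instance ordinal :: wellorder
proof
  fix P :: "ordinal \<Rightarrow> bool" and a :: ordinal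
  assume step: "\<And>x. (\<And>y. y < x \<Longrightarrow> P y) \<Longrightarrow> P x"
  have "\<forall>x. x = abs_ordinal r \<longrightarrow> Well_order r \<longrightarrow> P x" for r
  proof (induction r rule: wf_induct[OF wf_ordLess])
    case (1 r)
    show ?case
    proof (intro allI impI)
      fix x assume x: "x = abs_ordinal r" and r: "Well_order r"
      show "P x"
      proof (rule step)
        fix y assume "y < x"
        obtain s where y: "y = abs_ordinal s" and s: "(s, s) \<in> ordIso"
          using Quotient_rep_abs[OF Quotient_ordinal] Quotient_abs_rep[OF Quotient_ordinal]
            Quotient_rep_reflp[OF Quotient_ordinal] by metis
        have "(s, r) \<in> ordLess"
          using \<open>y < x\<close> s r unfolding x y
          by (simp add: less_ordinal.abs_eq eq_onp_def ordIso_reflexive)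
        then show "P y"
          using 1 y s by (meson ordIso_Well_order)
      qed
    qed
  qed
  moreover have "\<exists>r. a = abs_ordinal r \<and> Well_order r"
    using Quotient_abs_rep[OF Quotient_ordinal]
      Quotient_rep_reflp[OF Quotient_ordinal] by (metis ordIso_Well_order)
  ultimately show "P a" by blast
qed

instantiation ordinal :: zero
begin
definition "0 = (LEAST \<alpha> :: ordinal. True)"
instance ..
end

definition succ_ordinal :: "ordinal \<Rightarrow> ordinal" where
  "succ_ordinal \<alpha> = (LEAST \<beta>. \<alpha> < \<beta>)"

definition omega0 :: ordinal where
  "omega0 = (LEAST \<alpha>. infinite {..<\<alpha>})"

definition omega1 :: ordinal where
  "omega1 = (LEAST \<alpha>. uncountable {..<\<alpha>})"

lemma zero_le_ordinal: "0 \<le> (\<alpha> :: ordinal)"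
  unfolding zero_ordinal_def by (rule Least_le) simp

lemma ordinal_cases_Well_order:
  obtains r where "\<alpha> = abs_ordinal r" and "Well_order r"
  using Quotient_abs_rep[OF Quotient_ordinal]
    Quotient_rep_reflp[OF Quotient_ordinal] by (metis ordIso_Well_order)

lemma less_abs_ordinal_iff:
  assumes "Well_order r" and "Well_order s"
  shows "abs_ordinal r < abs_ordinal s \<longleftrightarrow> (r, s) \<in> ordLess"
  using assms by (simp add: less_ordinal.abs_eq eq_onp_def ordIso_reflexive)

lemma bij_betw_Field_lessThan:
  fixes r :: "nat set rel"
  assumes r: "Well_order r"
  shows "bij_betw (\<lambda>a. abs_ordinal (Restr r (underS r a))) (Field r) {..<abs_ordinal r}"
proof (rule bij_betw_imageI)
  have wo: "Well_order (Restr r (underS r a))" for a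
    using r by (rule Well_order_Restr)
  have less: "abs_ordinal (Restr r (underS r a)) < abs_ordinal (Restr r (underS r b))"
    if "(a, b) \<in> r" "a \<noteq> b" "a \<in> Field r" "b \<in> Field r" for a b
  proof -
    have "underS r a \<subset> underS r b"
      using that r by (auto simp: underS_def order_on_defs dest: transD antisymD)
    then show ?thesis
      using r by (simp add: less_abs_ordinal_iff[OF wo wo] ofilter_subset_ordLess[symmetric]
          wo_rel.underS_ofilter wo_rel_def)
  qed
  show "inj_on (\<lambda>a. abs_ordinal (Restr r (underS r a))) (Field r)"
  proof (rule inj_onI, rule ccontr)
    fix a b assume ab: "a \<in> Field r" "b \<in> Field r" "a \<noteq> b"
      and eq: "abs_ordinal (Restr r (underS r a)) = abs_ordinal (Restr r (underS r b))"
    have "(a, b) \<in> r \<or> (b, a) \<in> r"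
      using r ab by (auto simp: order_on_defs total_on_def)
    then show False
      using less[of a b] less[of b a] ab eq by auto
  qed
  show "(\<lambda>a. abs_ordinal (Restr r (underS r a))) ` Field r = {..<abs_ordinal r}"
  proof (intro subset_antisym subsetI)
    fix \<beta> assume "\<beta> \<in> (\<lambda>a. abs_ordinal (Restr r (underS r a))) ` Field r"
    then obtain a where "a \<in> Field r" and \<beta>: "\<beta> = abs_ordinal (Restr r (underS r a))"
      by blast
    then have "(Restr r (underS r a), r) \<in> ordLess"
      using underS_Restr_ordLess[OF r] by blast
    then show "\<beta> \<in> {..<abs_ordinal r}"
      by (simp add: \<beta> less_abs_ordinal_iff[OF wo r])
  next
    fix \<beta> assume "\<beta> \<in> {..<abs_ordinal r}"
    moreover obtain s where s: "\<beta> = abs_ordinal s" "Well_order s"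
      by (rule ordinal_cases_Well_order)
    ultimately have "(s, r) \<in> ordLess"
      using less_abs_ordinal_iff[OF s(2) r] by simp
    then obtain a where "a \<in> Field r" "(s, Restr r (underS r a)) \<in> ordIso"
      using ordLess_iff_ordIso_Restr[OF r s(2)] by blast
    then show "\<beta> \<in> (\<lambda>a. abs_ordinal (Restr r (underS r a))) ` Field r"
      using s by (auto simp: Quotient_rel_abs[OF Quotient_ordinal])
  qed
qed

lemma ex_uncountable_lessThan_ordinal: "\<exists>\<alpha> :: ordinal. uncountable {..<\<alpha>}"
proof -
  obtain r :: "nat set rel" where r: "Well_order r" and "Field r = UNIV"
    using well_ordering[where 'a = "nat set"] by blast
  then have bij: "bij_betw (\<lambda>a. abs_ordinal (Restr r (underS r a))) UNIV {..<abs_ordinal r}"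
    using bij_betw_Field_lessThan[OF r] by simp
  have "countable {..<abs_ordinal r} \<longleftrightarrow> countable (UNIV :: nat set set)"
    using countable_image_inj_eq[OF bij_betw_imp_inj_on[OF bij]]
    unfolding bij_betw_imp_surj_on[OF bij] .
  moreover have "uncountable (UNIV :: nat set set)"
  proof
    assume "countable (UNIV :: nat set set)"
    then have "inj_on (to_nat_on UNIV) (UNIV :: nat set set)"
      by (rule inj_on_to_nat_on)
    then have "surj (inv (to_nat_on (UNIV :: nat set set)))"
      by (rule inj_imp_surj_inv)
    then show False
      using Cantors_theorem[of "UNIV :: nat set"] by (metis Pow_UNIV)
  qed
  ultimately have "uncountable {..<abs_ordinal r}"
    by simp
  then show ?thesis ..
qed

lemma uncountable_lessThan_omega1: "uncountable {..<omega1}"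
  unfolding omega1_def by (rule LeastI_ex) (rule ex_uncountable_lessThan_ordinal)

lemma infinite_lessThan_omega0: "infinite {..<omega0}"
proof -
  obtain \<alpha> :: ordinal where "uncountable {..<\<alpha>}"
    using ex_uncountable_lessThan_ordinal ..
  then have "infinite {..<\<alpha>}"
    by (rule contrapos_nn) (rule countable_finite)
  then show ?thesis
    unfolding omega0_def by (rule LeastI)
qed

lemma less_succ_ordinal: "\<alpha> < succ_ordinal \<alpha>"
proof -
  have "\<exists>\<beta>. \<alpha> < \<beta>"
  proof (rule ccontr)
    assume "\<nexists>\<beta>. \<alpha> < \<beta>"
    then have max: "\<beta> \<le> \<alpha>" for \<beta> by (meson not_le)
    obtain r :: "nat set rel" where \<alpha>: "\<alpha> = abs_ordinal r" and r: "Well_order r"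
      by (rule ordinal_cases_Well_order)
    define f :: "nat set \<Rightarrow> nat set" where "f A = Suc ` A" for A
    have f: "inj_on f (Field r)"
      by (auto simp: f_def inj_on_def inj_image_eq_iff)
    define s where "s = dir_image r f"
    have rs: "(r, s) \<in> ordIso"
      unfolding s_def using f r by (intro dir_image_ordIso) auto
    then have s: "Well_order s"
      by (simp add: ordIso_Well_order)
    have notin: "{0} \<notin> Field s"
      unfolding s_def dir_image_Field f_def by auto
    define t where "t = insert ({0}, {0}) (s \<union> Field s \<times> {{0}})"
    have t_Field: "Field t = insert {0} (Field s)"
      by (auto simp: t_def Field_def)
    have "wf (s - Id)" using s by (simp add: well_order_on_def)
    then have "wf (t - Id)"
    proof -
      have "t - Id = (s - Id) \<union> Field s \<times> {{0}}"
        using notin by (auto simp: t_def)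
      moreover have "wf (Field s \<times> {{0 :: nat}})"
        using notin by (intro wfI[where A = "Field s" and B = "{{0}}"]) auto
      moreover have "Domain (s - Id) \<inter> Range (Field s \<times> {{0}}) = {}"
        using notin by (auto simp: Field_def)
      ultimately show ?thesis
        using \<open>wf (s - Id)\<close> by (auto intro!: wf_Un)
    qed
    moreover have "refl_on (Field t) t"
      using s unfolding t_Field order_on_defs by (auto simp: t_def refl_on_def)
    moreover have "total_on (Field t) t"
      using s unfolding t_Field order_on_defs by (auto simp: t_def total_on_def)
    moreover have "trans t"
    proof (rule transI)
      fix x y z assume xyz: "(x, y) \<in> t" "(y, z) \<in> t"
      have st: "trans s" using s unfolding order_on_defs by blast
      show "(x, z) \<in> t"
        using xyz notin transD[OF st, of x y z] FieldI1[of x y s] FieldI2[of x y s] FieldI1[of y z s]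
        unfolding t_def by blast
    qed
    moreover have "antisym t"
      using s notin unfolding order_on_defs
      by (auto simp: t_def antisym_def intro: FieldI1 FieldI2)
    moreover have "t \<subseteq> Field t \<times> Field t"
      by (auto intro: FieldI1 FieldI2)
    ultimately have t: "Well_order t"
      by (simp add: order_on_defs)
    have "underS t {0} = Field s"
      using notin by (auto simp: underS_def t_def intro: FieldI1)
    moreover have "Restr t (Field s) = s"
      using notin by (auto simp: t_def intro: FieldI1 FieldI2)
    ultimately have "(s, t) \<in> ordLess"
      using underS_Restr_ordLess[OF t, of "{0}"] t_Field by auto
    then have "(r, t) \<in> ordLess"
      using rs ordIso_ordLess_trans by blast
    then have "\<alpha> < abs_ordinal t"
      unfolding \<alpha> using r t by (simp add: less_abs_ordinal_iff)
    then show False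
      using max by (simp add: leD)
  qed
  then show ?thesis
    unfolding succ_ordinal_def by (rule LeastI_ex)
qed

lemma succ_ordinal_inject: "succ_ordinal \<alpha> = succ_ordinal \<beta> \<longleftrightarrow> \<alpha> = \<beta>"
proof -
  have "\<not> \<alpha> < \<beta>" if "succ_ordinal \<alpha> = succ_ordinal \<beta>" for \<alpha> \<beta>
    using that less_succ_ordinal[of \<beta>] not_less_Least[of \<beta> "\<lambda>\<gamma>. \<alpha> < \<gamma>"]
    unfolding succ_ordinal_def by auto
  then show ?thesis
    by (metis linorder_neqE)
qed


section \<open>The Szlenk index\<close>

definition weak_star_topology :: "('a::real_normed_vector \<Rightarrow>\<^sub>L real) topology" where
  "weak_star_topology =
     pullback_topology UNIV blinfun_apply (product_topology (\<lambda>_. euclideanreal) UNIV)"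

text \<open>
  The boundedness condition only guards against the junk value of \<^const>\<open>diameter\<close> on
  unbounded sets; weak*-compact subsets of the dual of a Banach space are norm bounded.
\<close>
definition szlenk_derivation ::
    "real \<Rightarrow> ('a::real_normed_vector \<Rightarrow>\<^sub>L real) set \<Rightarrow> ('a \<Rightarrow>\<^sub>L real) set" where
  "szlenk_derivation \<epsilon> K =
     K - \<Union>{V. openin weak_star_topology V \<and> bounded (V \<inter> K) \<and> diameter (V \<inter> K) \<le> \<epsilon>}"

function szlenk_iter ::
    "real \<Rightarrow> ('a::real_normed_vector \<Rightarrow>\<^sub>L real) set \<Rightarrow> ordinal \<Rightarrow> ('a \<Rightarrow>\<^sub>L real) set" where
  "szlenk_iter \<epsilon> K \<alpha> =
     (if \<alpha> = 0 then K
      else if \<exists>\<beta>. \<alpha> = succ_ordinal \<beta>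
        then szlenk_derivation \<epsilon> (szlenk_iter \<epsilon> K (THE \<beta>. \<alpha> = succ_ordinal \<beta>))
      else (\<Inter>\<beta>\<in>{..<\<alpha>}. szlenk_iter \<epsilon> K \<beta>))"
  by pat_completeness auto
termination
  by (relation "inv_image {(\<alpha>, \<beta>). \<alpha> < \<beta>} (\<lambda>(\<epsilon>, K, \<alpha>). \<alpha>)")
    (auto simp: succ_ordinal_inject less_succ_ordinal intro: wf)

declare szlenk_iter.simps [simp del]

lemma szlenk_iter_zero: "szlenk_iter \<epsilon> K 0 = K"
  by (subst szlenk_iter.simps) simp

lemma szlenk_iter_succ:
  "szlenk_iter \<epsilon> K (succ_ordinal \<alpha>) = szlenk_derivation \<epsilon> (szlenk_iter \<epsilon> K \<alpha>)"
  using zero_le_ordinal[of \<alpha>] less_succ_ordinal[of \<alpha>]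
  by (subst szlenk_iter.simps) (auto simp: succ_ordinal_inject)

lemma szlenk_iter_limit:
  assumes "\<alpha> \<noteq> 0" and "\<nexists>\<beta>. \<alpha> = succ_ordinal \<beta>"
  shows "szlenk_iter \<epsilon> K \<alpha> = (\<Inter>\<beta>\<in>{..<\<alpha>}. szlenk_iter \<epsilon> K \<beta>)"
  using assms by (subst szlenk_iter.simps) simp

definition szlenk_index_at :: "'a::real_normed_vector itself \<Rightarrow> real \<Rightarrow> ordinal" where
  "szlenk_index_at _ \<epsilon> =
     (let S = {\<alpha>. countable {..<\<alpha>} \<and> szlenk_iter \<epsilon> (cball (0 :: 'a \<Rightarrow>\<^sub>L real) 1) \<alpha> = {}}
      in if S \<noteq> {} then (LEAST \<alpha>. \<alpha> \<in> S) else omega1)"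

text \<open>The least upper bound of the values; it exists since they are all at most \<^const>\<open>omega1\<close>.\<close>
definition szlenk_index :: "'a::real_normed_vector itself \<Rightarrow> ordinal" where
  "szlenk_index X = (LEAST \<alpha>. \<forall>\<epsilon>>0. szlenk_index_at X \<epsilon> \<le> \<alpha>)"

text \<open>
  Meaningful if the Szlenk index is \<^const>\<open>omega0\<close>: then all \<^term>\<open>szlenk_index_at X \<epsilon>\<close> are
  finite ordinals, and the cardinality of the set of predecessors is the ordinal as a number.
\<close>
definition szlenk_power_type :: "'a::real_normed_vector itself \<Rightarrow> real" where
  "szlenk_power_type X =
     Lim (at_right 0) (\<lambda>\<epsilon>. ln (real (card {..<szlenk_index_at X \<epsilon>})) / \<bar>ln \<epsilon>\<bar>)"


section \<open>Equivalent norms\<close>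

definition equivalent_norm :: "('a::real_normed_vector \<Rightarrow> real) \<Rightarrow> bool" where
  "equivalent_norm N \<longleftrightarrow>
     (\<forall>x. N x = 0 \<longleftrightarrow> x = 0) \<and>
     (\<forall>x y. N (x + y) \<le> N x + N y) \<and>
     (\<forall>a x. N (a *\<^sub>R x) = \<bar>a\<bar> * N x) \<and>
     (\<exists>A>0. \<exists>B>0. \<forall>x. A * norm x \<le> N x \<and> N x \<le> B * norm x)"

definition dual_norm :: "('a::real_normed_vector \<Rightarrow> real) \<Rightarrow> ('a \<Rightarrow>\<^sub>L real) \<Rightarrow> real" where
  "dual_norm N f = (SUP x\<in>{x. N x \<le> 1}. \<bar>blinfun_apply f x\<bar>)"

end

(*
Let B be the dual unit ball. For x in B let r_k(x) be the largest n such that x lies in the n-th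
derived set of B at scale 2^-k, and put F(x) = sum_k 2^(-kq) r_k(x). As q > p_X, this is bounded. If
z tends weak* to y and stays at distance t from y, then r_k(z) < r_k(y) for all k with 2^-k < t, so F
drops by at least a multiple of t^q.

This drop survives passing to the weak* upper semicontinuous concave envelope G of F: in a convex
combination of points z_i, each z_i is close to some y_i from a fixed finite set and F drops by at
least c |z_i - y_i|^q from y_i to z_i; since q >= p_X >= 1, the convexity of t^q bounds the average
drop from below by c |sum l_i (z_i - y_i)|^q.

Then phi(x) = |x| + G(0) - G(x) is convex, even, weak* lower semicontinuous, and grows by a multiple
of t^q along weak* null perturbations of norm t. The sublevel set {phi <= 1/2} is the dual unit ball
of the required norm: phi is Lipschitz along rays, so a gain in phi is a gain in the gauge.

The existence of the limit defining p_X follows from Sz(X, st) <= Sz(X, s) Sz(X, t) by Fekete's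
argument, and p_X >= 1 because Sz(X, t e) >= 1/t as soon as Sz(X, e) > 1.
*)
theory Submission
  imports Defs
begin

section \<open>The weak* topology of the dual\<close>

text \<open>The index controls single jumps only, while a dual ball must be convex and F need not be
  concave; hence the envelope. The delicate point is that the y_i come from a finite cover fixed
  beforehand: y = sum l_i y_i is weak* near the base point f but may be far from it in norm, so z -
  y has no evident relation to z - f. Two inequalities settle this. The points y stay in a norm
  compact set, on which weak* lower semicontinuity of the norm is uniform, so |z - y| >= |f - y| -
  t/2 for z weak* near f; and |z - f| <= |z - y| + |f - y|. Together they give |z - y| >= t/4 as
  soon as |z - f| >= t. Passing from the convex hull to its weak* closure costs another factor 2,
  whence the t/8 in the final drop. The level 1/2 leaves room: since phi dominates the norm, a point
  of the sublevel set can be doubled inside the ball on which phi is bounded, and convexity on that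
  longer segment is what controls phi along rays. Neighbourhoods hold drops only up to an error
  delta, which is fixed at the end as a fraction of the gain.\<close>

definition weak_star_nbhd ::
    "'a::real_normed_vector set \<Rightarrow> real \<Rightarrow> ('a \<Rightarrow>\<^sub>L real) \<Rightarrow> ('a \<Rightarrow>\<^sub>L real) set" where
  "weak_star_nbhd A e f = {h. \<forall>a\<in>A. \<bar>blinfun_apply h a - f a\<bar> < e}"

lemma topspace_weak_star [simp]: "topspace weak_star_topology = UNIV"
  by (auto simp: weak_star_topology_def topspace_pullback_topology)

lemma continuous_map_weak_star_apply:
  "continuous_map weak_star_topology euclideanreal (\<lambda>h. blinfun_apply h a)"
proof -
  have "continuous_map (product_topology (\<lambda>_. euclideanreal) UNIV) euclideanreal (\<lambda>h. h a)"
    by (rule continuous_map_product_projection) simp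
  then have "continuous_map weak_star_topology euclideanreal ((\<lambda>h. h a) \<circ> blinfun_apply)"
    unfolding weak_star_topology_def by (rule continuous_map_pullback)
  then show ?thesis by (simp add: o_def)
qed

lemma self_in_weak_star_nbhd: "0 < e \<Longrightarrow> f \<in> weak_star_nbhd A e f"
  by (simp add: weak_star_nbhd_def)

lemma openin_weak_star_nbhd:
  fixes f :: "'a::real_normed_vector \<Rightarrow>\<^sub>L real"
  assumes "finite A"
  shows "openin weak_star_topology (weak_star_nbhd A e f)"
proof -
  have "openin weak_star_topology {h. \<bar>blinfun_apply h a - f a\<bar> < e}" for a
  proof -
    have "{h. \<bar>blinfun_apply h a - f a\<bar> < e} =
        {h \<in> topspace weak_star_topology. blinfun_apply h a \<in> ball (f a) e}"
      by (auto simp: dist_real_def abs_minus_commute)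
    then show ?thesis
      using openin_continuous_map_preimage[OF continuous_map_weak_star_apply, of "ball (f a) e" a]
      by simp
  qed
  moreover have "weak_star_nbhd A e f = (\<Inter>a\<in>A. {h. \<bar>blinfun_apply h a - f a\<bar> < e})"
    by (auto simp: weak_star_nbhd_def)
  moreover have "openin weak_star_topology (UNIV :: ('a \<Rightarrow>\<^sub>L real) set)"
    using openin_topspace[of weak_star_topology] by simp
  ultimately show ?thesis
    using openin_INT2[OF assms, of weak_star_topology "\<lambda>a. {h. \<bar>blinfun_apply h a - f a\<bar> < e}"]
    by (cases "A = {}") simp_all
qed

lemma weak_star_nbhd_subset_open:
  assumes "openin weak_star_topology V" and "f \<in> V"
  obtains A e where "finite A" and "0 < e" and "weak_star_nbhd A e f \<subseteq> V"
proof -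
  obtain U where U: "openin (product_topology (\<lambda>_. euclideanreal) UNIV) U" "V = blinfun_apply -` U"
    using assms(1) by (auto simp: weak_star_topology_def openin_pullback_topology)
  then obtain X where X: "blinfun_apply f \<in> (\<Pi>\<^sub>E i\<in>UNIV. X i)" "\<And>i. open (X i)"
      "finite {i. X i \<noteq> UNIV}" "(\<Pi>\<^sub>E i\<in>UNIV. X i) \<subseteq> U"
    using product_topology_open_contains_basis[OF U(1), of "blinfun_apply f"] assms(2) by auto
  have "\<exists>e>0. ball (f i) e \<subseteq> X i" for i
    using X(1,2) by (meson PiE_mem UNIV_I openE)
  then obtain r where r: "\<And>i. r i > 0" "\<And>i. ball (f i) (r i) \<subseteq> X i" by metis
  define A where "A = {i. X i \<noteq> UNIV}"
  define e where "e = Min (insert 1 (r ` A))"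
  have A: "finite A" using X(3) by (simp add: A_def)
  have "weak_star_nbhd A e f \<subseteq> V"
  proof
    fix h assume h: "h \<in> weak_star_nbhd A e f"
    have "h i \<in> X i" for i
    proof (cases "i \<in> A")
      case True
      then have "\<bar>h i - f i\<bar> < r i"
        using h A unfolding weak_star_nbhd_def e_def by fastforce
      then show ?thesis using r(2)[of i] by (auto simp: dist_real_def abs_minus_commute)
    qed (simp add: A_def)
    then show "h \<in> V" using X(4) U(2) by auto
  qed
  moreover have "e > 0" using A r(1) by (simp add: e_def)
  ultimately show ?thesis using that A by blast
qed

lemma limitin_weak_star_nbhd:
  assumes "limitin weak_star_topology g f F" "finite A" "0 < e"
  shows "eventually (\<lambda>n. g n \<in> weak_star_nbhd A e f) F"
  using assms openin_weak_star_nbhd[OF assms(2)] self_in_weak_star_nbhd[OF assms(3)]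
  unfolding limitin_def by blast

text \<open>Banach-Alaoglu: as functions, the members of the ball are exactly the linear maps in the
  product of the intervals \<open>{- norm x..norm x}\<close>, a closed subset of a compact
  product.\<close>

lemma compactin_weak_star_cball:
  "compactin weak_star_topology (cball (0 :: 'a::real_normed_vector \<Rightarrow>\<^sub>L real) 1)"
proof -
  let ?I = "blinfun_apply ` cball (0 :: 'a \<Rightarrow>\<^sub>L real) 1"
  define L where "L = {h :: 'a \<Rightarrow> real. (\<forall>x y. h (x + y) = h x + h y) \<and> (\<forall>c x. h (c *\<^sub>R x) = c * h x)}"
  have "compactin (product_topology (\<lambda>_. euclideanreal) UNIV) (\<Pi>\<^sub>E x\<in>(UNIV :: 'a set). {- norm x..norm x})"
    by (simp add: compactin_PiE)
  then have P: "compact (\<Pi>\<^sub>E x\<in>(UNIV :: 'a set). {- norm x..norm x})"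
    by (simp add: euclidean_product_topology)
  have c: "continuous_on UNIV (\<lambda>h :: 'a \<Rightarrow> real. h x)" for x
    by (rule continuous_on_product_coordinates)
  have "L = (\<Inter>x. \<Inter>y. {h. h (x + y) = h x + h y}) \<inter> (\<Inter>c. \<Inter>x. {h. h (c *\<^sub>R x) = c * h x})"
    unfolding L_def by blast
  moreover have "closed {h :: 'a \<Rightarrow> real. h (x + y) = h x + h y}" for x y
    by (rule closed_Collect_eq[OF c continuous_on_add[OF c c]])
  moreover have "closed {h :: 'a \<Rightarrow> real. h (a *\<^sub>R x) = a * h x}" for a x
    by (rule closed_Collect_eq[OF c continuous_on_mult_left[OF c]])
  ultimately have L: "closed L" by (simp add: closed_Int closed_INT)
  have "?I = L \<inter> (\<Pi>\<^sub>E x\<in>(UNIV :: 'a set). {- norm x..norm x})"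
  proof (intro subset_antisym subsetI)
    fix h assume "h \<in> ?I"
    then obtain f :: "'a \<Rightarrow>\<^sub>L real" where f: "h = blinfun_apply f" "norm f \<le> 1" by auto
    have "\<bar>f x\<bar> \<le> norm x" for x
      using norm_blinfun[of f x] f(2) mult_right_mono[OF f(2), of "norm x"] by simp
    then have "- norm x \<le> f x \<and> f x \<le> norm x" for x
      by (simp add: abs_le_iff minus_le_iff)
    then show "h \<in> L \<inter> (\<Pi>\<^sub>E x\<in>(UNIV :: 'a set). {- norm x..norm x})"
      by (simp add: f(1) L_def blinfun.add_right blinfun.scaleR_right PiE_iff)
  next
    fix h assume h: "h \<in> L \<inter> (\<Pi>\<^sub>E x\<in>(UNIV :: 'a set). {- norm x..norm x})"
    have n: "\<bar>h x\<bar> \<le> norm x" for x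
    proof -
      have "h x \<in> {- norm x..norm x}" using h PiE_mem[of h UNIV _ x] by blast
      then show ?thesis by (simp add: abs_le_iff minus_le_iff)
    qed
    have "bounded_linear h"
      by (rule bounded_linear_intro[where K = 1]) (use h n in \<open>simp_all add: L_def\<close>)
    then have "blinfun_apply (Blinfun h) = h" by (rule bounded_linear_Blinfun_apply)
    moreover from this have "norm (Blinfun h) \<le> 1"
      using n by (intro norm_blinfun_bound) auto
    ultimately show "h \<in> ?I" by (metis image_eqI mem_cball_0)
  qed
  then have "compact ?I" using L P by (simp add: closed_Int_compact)
  then have I: "compactin (product_topology (\<lambda>_. euclideanreal) UNIV) ?I"
    by (simp add: euclidean_product_topology)
  \<comment> \<open>Open sets of the pullback topology are preimages, so a cover of the ball becomes
    a cover of its image, and a finite subcover of the image pulls back.\<close>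
  show ?thesis
    unfolding compactin_def
  proof (intro conjI allI impI)
    fix \<U> :: "('a \<Rightarrow>\<^sub>L real) set set"
    assume U: "(\<forall>U\<in>\<U>. openin weak_star_topology U) \<and> cball 0 1 \<subseteq> \<Union> \<U>"
    then have "\<forall>U\<in>\<U>. \<exists>U'. openin (product_topology (\<lambda>_. euclideanreal) UNIV) U' \<and> U = blinfun_apply -` U'"
      by (auto simp: weak_star_topology_def openin_pullback_topology)
    then obtain w where w: "\<And>U. U \<in> \<U> \<Longrightarrow> openin (product_topology (\<lambda>_. euclideanreal) UNIV) (w U)"
        "\<And>U. U \<in> \<U> \<Longrightarrow> U = blinfun_apply -` w U" by metis
    have "?I \<subseteq> \<Union> (w ` \<U>)" using U w(2) by blast
    then have "\<exists>\<F>. finite \<F> \<and> \<F> \<subseteq> w ` \<U> \<and> ?I \<subseteq> \<Union> \<F>"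
      using w(1) by (intro compactinD[OF I]) auto
    then obtain \<F> where F: "finite \<F>" "\<F> \<subseteq> w ` \<U>" "?I \<subseteq> \<Union> \<F>"
      by blast
    then obtain \<G> where G: "finite \<G>" "\<G> \<subseteq> \<U>" "\<F> = w ` \<G>"
      by (meson finite_subset_image)
    then have "cball 0 1 \<subseteq> \<Union> \<G>" using F(3) w(2) by blast
    then show "\<exists>\<F>. finite \<F> \<and> \<F> \<subseteq> \<U> \<and> cball 0 1 \<subseteq> \<Union> \<F>" using G by blast
  qed simp
qed

text \<open>Compactness in the form used later: a neighbourhood is chosen at every point of the
  ball, and finitely many centres suffice.\<close>

lemma cball_weak_star_finite_cover:
  fixes A :: "('a::real_normed_vector \<Rightarrow>\<^sub>L real) \<Rightarrow> 'a set"
  assumes "\<And>f. f \<in> cball 0 1 \<Longrightarrow> finite (A f)" and "\<And>f. f \<in> cball 0 1 \<Longrightarrow> 0 < e f"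
  obtains Y where "finite Y" "Y \<subseteq> cball 0 1" "cball 0 1 \<subseteq> (\<Union>f\<in>Y. weak_star_nbhd (A f) (e f) f)"
proof -
  have "\<forall>U\<in>(\<lambda>f. weak_star_nbhd (A f) (e f) f) ` cball 0 1. openin weak_star_topology U"
    using assms(1) openin_weak_star_nbhd by blast
  moreover have "cball 0 1 \<subseteq> \<Union> ((\<lambda>f. weak_star_nbhd (A f) (e f) f) ` cball 0 1)"
    using self_in_weak_star_nbhd assms(2) by blast
  ultimately have "\<exists>\<F>. finite \<F> \<and> \<F> \<subseteq> (\<lambda>f. weak_star_nbhd (A f) (e f) f) ` cball 0 1 \<and> cball 0 1 \<subseteq> \<Union> \<F>"
    using compactin_weak_star_cball[unfolded compactin_def, THEN conjunct2, rule_format,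
        of "(\<lambda>f. weak_star_nbhd (A f) (e f) f) ` cball 0 1"] by blast
  then obtain \<F> where F: "finite \<F>" "\<F> \<subseteq> (\<lambda>f. weak_star_nbhd (A f) (e f) f) ` cball 0 1"
      "cball 0 1 \<subseteq> \<Union> \<F>" by blast
  obtain Y where "Y \<subseteq> cball 0 1" "finite Y" "\<F> = (\<lambda>f. weak_star_nbhd (A f) (e f) f) ` Y"
    using finite_subset_image[OF F(1,2)] by blast
  then show ?thesis using that[of Y] F(3) by blast
qed

text \<open>A single vector \<open>a\<close> with \<open>r * norm a < \<bar>f a\<bar>\<close>
  already witnesses that the norm exceeds \<open>r\<close>, and the slack in this inequality serves
  as the tolerance.\<close>

lemma norm_weak_star_lsc:
  fixes f :: "'a::real_normed_vector \<Rightarrow>\<^sub>L real"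
  assumes "r < norm f"
  obtains a e where "0 < e" "\<And>h. h \<in> weak_star_nbhd {a} e f \<Longrightarrow> r < norm h"
proof (cases "r < 0")
  case True
  then show ?thesis
    using that[of 1 0] order_less_le_trans[OF True norm_ge_zero[where 'a = "'a \<Rightarrow>\<^sub>L real"]] by simp
next
  case False
  have "\<exists>a. r * norm a < norm (f a)"
    using assms norm_blinfun_bound[of r f] False by (meson not_le)
  then obtain a where a: "r * norm a < norm (f a)" ..
  show ?thesis
  proof (rule that)
    fix h assume "h \<in> weak_star_nbhd {a} (norm (f a) - r * norm a) f"
    then have "\<bar>h a - f a\<bar> < \<bar>f a\<bar> - r * norm a" by (simp add: weak_star_nbhd_def)
    then have "r * norm a < \<bar>h a\<bar>" by linarith
    also have "\<dots> \<le> norm h * norm a" using norm_blinfun[of h a] by simp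
    finally show "r < norm h" using mult_right_mono[of "norm h" r "norm a"] by (cases "r < norm h") auto
  qed (use a in simp)
qed

lemma weak_star_nbhd_inter:
  assumes "finite A1" "finite A2" "0 < e1" "0 < e2"
  shows "\<exists>A e. finite A \<and> 0 < e \<and> weak_star_nbhd A e f \<subseteq> weak_star_nbhd A1 e1 f \<inter> weak_star_nbhd A2 e2 f"
  using assms by (intro exI[of _ "A1 \<union> A2"] exI[of _ "min e1 e2"]) (auto simp: weak_star_nbhd_def)

section \<open>The derivation and finite Szlenk indices\<close>

text \<open>A pointwise form of \<open>szlenk_derivation\<close>, without \<open>diameter\<close>
  and its boundedness guard. Monotonicity in \<open>K\<close> and behaviour under affine maps can be
  read off, and it is meaningful for every set. The strict inequality matches the removal of slices
  of diameter at most \<open>\<epsilon>\<close>.\<close>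

definition separation_derivation ::
    "real \<Rightarrow> ('a::real_normed_vector \<Rightarrow>\<^sub>L real) set \<Rightarrow> ('a \<Rightarrow>\<^sub>L real) set" where
  "separation_derivation \<epsilon> K =
     {f \<in> K. \<forall>A e. finite A \<longrightarrow> 0 < e \<longrightarrow>
       (\<exists>u\<in>K \<inter> weak_star_nbhd A e f. \<exists>v\<in>K \<inter> weak_star_nbhd A e f. \<epsilon> < dist u v)}"

lemma szlenk_derivation_eq_separation_derivation:
  assumes "bounded K" "0 \<le> \<epsilon>"
  shows "szlenk_derivation \<epsilon> K = separation_derivation \<epsilon> K"
proof (intro subset_antisym subsetI)
  fix f assume f: "f \<in> szlenk_derivation \<epsilon> K"
  show "f \<in> separation_derivation \<epsilon> K"
    unfolding separation_derivation_def
  proof (intro CollectI conjI allI impI)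
    show "f \<in> K" using f by (simp add: szlenk_derivation_def)
    fix A :: "'a set" and e :: real assume A: "finite A" "0 < e"
    let ?V = "weak_star_nbhd A e f"
    have b: "bounded (?V \<inter> K)" using assms(1) by (meson bounded_subset inf_le2)
    have "\<not> diameter (?V \<inter> K) \<le> \<epsilon>"
      using f openin_weak_star_nbhd[OF A(1), of e f] self_in_weak_star_nbhd[OF A(2), of f A] b
      unfolding szlenk_derivation_def by blast
    then have "\<not> (\<forall>u v. u \<in> ?V \<inter> K \<longrightarrow> v \<in> ?V \<inter> K \<longrightarrow> dist u v \<le> \<epsilon>)"
      using diameter_le[of "?V \<inter> K" \<epsilon>] assms(2) by (auto simp: dist_norm)
    then show "\<exists>u\<in>K \<inter> ?V. \<exists>v\<in>K \<inter> ?V. \<epsilon> < dist u v" by force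
  qed
next
  fix f assume f: "f \<in> separation_derivation \<epsilon> K"
  have "\<not> diameter (V \<inter> K) \<le> \<epsilon>" if V: "openin weak_star_topology V" "f \<in> V" "bounded (V \<inter> K)" for V
  proof -
    obtain A e where A: "finite A" "0 < e" "weak_star_nbhd A e f \<subseteq> V"
      using weak_star_nbhd_subset_open[OF V(1,2)] .
    then obtain u v where uv: "u \<in> V \<inter> K" "v \<in> V \<inter> K" "\<epsilon> < dist u v"
      using f unfolding separation_derivation_def by blast
    show ?thesis using diameter_bounded_bound[OF V(3) uv(1,2)] uv(3) by simp
  qed
  then show "f \<in> szlenk_derivation \<epsilon> K"
    using f unfolding szlenk_derivation_def separation_derivation_def by blast
qed

lemma separation_derivation_subset: "separation_derivation \<epsilon> K \<subseteq> K"
  by (auto simp: separation_derivation_def)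

lemma separation_derivation_mono:
  assumes "K \<subseteq> L"
  shows "separation_derivation \<epsilon> K \<subseteq> separation_derivation \<epsilon> L"
  using assms unfolding separation_derivation_def by blast

lemma separation_derivation_affine_subset:
  fixes f :: "'a::real_normed_vector \<Rightarrow>\<^sub>L real"
  assumes "s \<noteq> 0"
  shows "(\<lambda>h. f + s *\<^sub>R h) ` separation_derivation \<epsilon> K \<subseteq>
    separation_derivation (\<bar>s\<bar> * \<epsilon>) ((\<lambda>h. f + s *\<^sub>R h) ` K)"
proof
  let ?T = "\<lambda>h. f + s *\<^sub>R h"
  fix z assume "z \<in> ?T ` separation_derivation \<epsilon> K"
  then obtain h where h: "z = ?T h" "h \<in> separation_derivation \<epsilon> K" by auto
  show "z \<in> separation_derivation (\<bar>s\<bar> * \<epsilon>) (?T ` K)"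
    unfolding separation_derivation_def
  proof (intro CollectI conjI allI impI)
    show "z \<in> ?T ` K" using h separation_derivation_subset by blast
    fix A :: "'a set" and e :: real assume A: "finite A" "0 < e"
    have "0 < e / \<bar>s\<bar>" using A assms by simp
    then obtain u v where uv: "u \<in> K" "v \<in> K" "u \<in> weak_star_nbhd A (e / \<bar>s\<bar>) h"
        "v \<in> weak_star_nbhd A (e / \<bar>s\<bar>) h" "\<epsilon> < dist u v"
      using h(2) A(1) unfolding separation_derivation_def by blast
    have T: "?T w \<in> weak_star_nbhd A e z" if "w \<in> weak_star_nbhd A (e / \<bar>s\<bar>) h" for w
      using that assms unfolding h(1) weak_star_nbhd_def
      by (auto simp: blinfun.add_left blinfun.scaleR_left right_diff_distrib[symmetric] abs_mult
          pos_less_divide_eq mult.commute)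
    have "dist (?T u) (?T v) = \<bar>s\<bar> * dist u v"
      by (simp add: dist_norm scaleR_diff_right[symmetric])
    then have "\<bar>s\<bar> * \<epsilon> < dist (?T u) (?T v)" using uv(5) assms by simp
    then show "\<exists>u\<in>?T ` K \<inter> weak_star_nbhd A e z. \<exists>v\<in>?T ` K \<inter> weak_star_nbhd A e z. \<bar>s\<bar> * \<epsilon> < dist u v"
      using T uv(1-4) by blast
  qed
qed

text \<open>The reverse inclusion is \<open>separation_derivation_affine_subset\<close> for the
  inverse affine map.\<close>

lemma separation_derivation_affine:
  fixes f :: "'a::real_normed_vector \<Rightarrow>\<^sub>L real"
  assumes s: "s \<noteq> 0"
  shows "separation_derivation (\<bar>s\<bar> * \<epsilon>) ((\<lambda>h. f + s *\<^sub>R h) ` K) =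
    (\<lambda>h. f + s *\<^sub>R h) ` separation_derivation \<epsilon> K"
proof (rule subset_antisym)
  let ?T = "\<lambda>h. f + s *\<^sub>R h" and ?R = "\<lambda>h. - (inverse s *\<^sub>R f) + inverse s *\<^sub>R h"
  have R: "?R (?T h) = h" "?T (?R h) = h" for h using s by (simp_all add: scaleR_add_right scaleR_diff_right)
  have "?R ` separation_derivation (\<bar>s\<bar> * \<epsilon>) (?T ` K) \<subseteq>
      separation_derivation (\<bar>inverse s\<bar> * (\<bar>s\<bar> * \<epsilon>)) (?R ` ?T ` K)"
    using s by (intro separation_derivation_affine_subset) simp
  also have "\<bar>inverse s\<bar> * (\<bar>s\<bar> * \<epsilon>) = \<epsilon>" using s by simp
  also have "?R ` ?T ` K = K" unfolding image_image R by simp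
  finally have "?T ` ?R ` separation_derivation (\<bar>s\<bar> * \<epsilon>) (?T ` K) \<subseteq> ?T ` separation_derivation \<epsilon> K"
    by (rule image_mono)
  then show "separation_derivation (\<bar>s\<bar> * \<epsilon>) (?T ` K) \<subseteq> ?T ` separation_derivation \<epsilon> K"
    unfolding image_image R by simp
qed (rule separation_derivation_affine_subset[OF s])

text \<open>One slice of small diameter gives both conclusions: it bounds distances to
  \<open>f\<close>, and every other point of its neighbourhood has a smaller neighbourhood inside
  it, so no such point survives the derivation.\<close>

lemma separation_derivation_complement:
  assumes "f \<in> K" "f \<notin> separation_derivation \<epsilon> K"
  obtains A e where "finite A" "0 < e"
    "\<And>h. h \<in> weak_star_nbhd A e f \<Longrightarrow> h \<notin> separation_derivation \<epsilon> K"
    "\<And>h. h \<in> weak_star_nbhd A e f \<Longrightarrow> h \<in> K \<Longrightarrow> dist h f \<le> \<epsilon>"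
proof -
  obtain A e where A: "finite A" "0 < e" and
      le: "\<And>u v. u \<in> K \<inter> weak_star_nbhd A e f \<Longrightarrow> v \<in> K \<inter> weak_star_nbhd A e f \<Longrightarrow> dist u v \<le> \<epsilon>"
    using assms unfolding separation_derivation_def by (auto simp: not_less)
  have "h \<notin> separation_derivation \<epsilon> K" if h: "h \<in> weak_star_nbhd A e f" for h
  proof
    assume d: "h \<in> separation_derivation \<epsilon> K"
    obtain A' e' where A': "finite A'" "0 < e'" "weak_star_nbhd A' e' h \<subseteq> weak_star_nbhd A e f"
      using weak_star_nbhd_subset_open[OF openin_weak_star_nbhd[OF A(1)] h] .
    then obtain u v where "u \<in> K \<inter> weak_star_nbhd A' e' h" "v \<in> K \<inter> weak_star_nbhd A' e' h" "\<epsilon> < dist u v"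
      using d unfolding separation_derivation_def by blast
    then show False using le[of u v] A'(3) by (meson IntD1 IntD2 IntI not_le subsetD)
  qed
  moreover have "dist h f \<le> \<epsilon>" if "h \<in> weak_star_nbhd A e f" "h \<in> K" for h
    using le[of h f] that assms(1) self_in_weak_star_nbhd[OF A(2), of f A] by blast
  ultimately show ?thesis using that A by blast
qed

definition ball_derivation :: "real \<Rightarrow> nat \<Rightarrow> ('a::real_normed_vector \<Rightarrow>\<^sub>L real) set" where
  "ball_derivation \<epsilon> n = (separation_derivation \<epsilon> ^^ n) (cball 0 1)"

lemma ball_derivation_0 [simp]: "ball_derivation \<epsilon> 0 = cball 0 1"
  and ball_derivation_Suc: "ball_derivation \<epsilon> (Suc n) = separation_derivation \<epsilon> (ball_derivation \<epsilon> n)"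
  by (simp_all add: ball_derivation_def)

lemma ball_derivation_decreasing: "m \<le> n \<Longrightarrow> ball_derivation \<epsilon> n \<subseteq> ball_derivation \<epsilon> m"
  by (rule lift_Suc_antimono_le[of "ball_derivation \<epsilon>"])
    (simp_all add: ball_derivation_Suc separation_derivation_subset)

lemma ball_derivation_subset: "ball_derivation \<epsilon> n \<subseteq> cball 0 1"
  using ball_derivation_decreasing[of 0 n] by simp

text \<open>Each point of the ball is lost at a successor stage, and a whole neighbourhood is lost
  with it. Finitely many such neighbourhoods cover the ball, and the largest of their stages is
  empty. This is what turns an index at most \<open>omega0\<close> into a finite one.\<close>

lemma ball_derivation_eventually_empty:
  assumes "(\<Inter>n. ball_derivation \<epsilon> n) = ({} :: ('a::real_normed_vector \<Rightarrow>\<^sub>L real) set)"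
  shows "\<exists>n. ball_derivation \<epsilon> n = ({} :: ('a \<Rightarrow>\<^sub>L real) set)"
proof -
  have "\<exists>n A e. finite A \<and> 0 < e \<and> weak_star_nbhd A e f \<inter> ball_derivation \<epsilon> n = {}"
    if f: "f \<in> cball 0 1" for f :: "'a \<Rightarrow>\<^sub>L real"
  proof -
    define n where "n = (LEAST n. f \<notin> ball_derivation \<epsilon> n)"
    have "\<exists>n. f \<notin> ball_derivation \<epsilon> n" using assms by blast
    then have n: "f \<notin> ball_derivation \<epsilon> n" unfolding n_def by (rule LeastI_ex)
    then obtain m where m: "n = Suc m" using f by (cases n) auto
    have "f \<in> ball_derivation \<epsilon> m" using not_less_Least[of m "\<lambda>n. f \<notin> ball_derivation \<epsilon> n"] m n_def by simp
    moreover have "f \<notin> separation_derivation \<epsilon> (ball_derivation \<epsilon> m)"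
      using n m by (simp add: ball_derivation_Suc)
    ultimately show ?thesis
      using separation_derivation_complement[of f "ball_derivation \<epsilon> m" \<epsilon>]
      by (metis ball_derivation_Suc disjoint_iff)
  qed
  then obtain k :: "('a \<Rightarrow>\<^sub>L real) \<Rightarrow> nat" and A :: "('a \<Rightarrow>\<^sub>L real) \<Rightarrow> 'a set"
      and e :: "('a \<Rightarrow>\<^sub>L real) \<Rightarrow> real" where w: "\<And>f :: 'a \<Rightarrow>\<^sub>L real. f \<in> cball 0 1 \<Longrightarrow>
      finite (A f) \<and> 0 < e f \<and> weak_star_nbhd (A f) (e f) f \<inter> ball_derivation \<epsilon> (k f) = {}"
    by metis
  obtain Y where Y: "finite Y" "Y \<subseteq> cball 0 1" "cball 0 1 \<subseteq> (\<Union>f\<in>Y. weak_star_nbhd (A f) (e f) f)"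
    using cball_weak_star_finite_cover[of A e] w by blast
  define n where "n = Max (insert 0 (k ` Y))"
  have "h \<notin> ball_derivation \<epsilon> n" for h :: "'a \<Rightarrow>\<^sub>L real"
  proof
    assume h: "h \<in> ball_derivation \<epsilon> n"
    then obtain f where f: "f \<in> Y" "h \<in> weak_star_nbhd (A f) (e f) f"
      using Y(3) ball_derivation_subset by blast
    have "k f \<le> n" unfolding n_def using Y(1) f(1) by simp
    then have "h \<in> ball_derivation \<epsilon> (k f)" using h ball_derivation_decreasing by blast
    then show False using f Y(2) w by blast
  qed
  then show ?thesis by blast
qed

section \<open>Finite ordinals and the identification of the Szlenk index at a fixed scale with a
  natural number\<close>

definition finite_ordinal :: "nat \<Rightarrow> ordinal" where
  "finite_ordinal n = (succ_ordinal ^^ n) 0"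

lemma less_succ_ordinal_iff: "\<beta> < succ_ordinal \<alpha> \<longleftrightarrow> \<beta> \<le> \<alpha>"
  using not_less_Least[of \<beta> "\<lambda>\<gamma>. \<alpha> < \<gamma>"] less_succ_ordinal[of \<alpha>]
  by (metis le_less_trans not_le succ_ordinal_def)

lemma not_less_zero_ordinal: "\<not> (\<alpha> :: ordinal) < 0"
  using zero_le_ordinal[of \<alpha>] by (simp add: not_less)

lemma finite_ordinal_Suc: "finite_ordinal (Suc n) = succ_ordinal (finite_ordinal n)"
  by (simp add: finite_ordinal_def)

lemma strict_mono_finite_ordinal: "strict_mono finite_ordinal"
  by (simp add: strict_mono_Suc_iff finite_ordinal_Suc less_succ_ordinal)

lemma lessThan_finite_ordinal: "{..<finite_ordinal n} = finite_ordinal ` {..<n}"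
proof (induction n)
  case 0
  then show ?case by (simp add: finite_ordinal_def not_less_zero_ordinal lessThan_def)
next
  case (Suc n)
  have "{..<finite_ordinal (Suc n)} = insert (finite_ordinal n) {..<finite_ordinal n}"
    by (auto simp: finite_ordinal_Suc less_succ_ordinal_iff)
  then show ?case by (simp add: Suc.IH lessThan_Suc)
qed

lemma card_lessThan_finite_ordinal: "card {..<finite_ordinal n} = n"
  using strict_mono_finite_ordinal
  by (simp add: lessThan_finite_ordinal card_image strict_mono_imp_inj_on)

text \<open>A nonempty finite set of predecessors has a largest element, and the ordinal is the
  successor of that element.\<close>

lemma finite_lessThan_imp_finite_ordinal: "finite {..<\<alpha>} \<Longrightarrow> \<exists>n. \<alpha> = finite_ordinal n"
proof (induction \<alpha> rule: less_induct)
  case (less \<alpha>)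
  show ?case
  proof (cases "{..<\<alpha>} = {}")
    case True
    then have "\<alpha> = 0" using zero_le_ordinal[of \<alpha>] by (auto simp: order_le_less)
    then show ?thesis by (intro exI[of _ 0]) (simp add: finite_ordinal_def)
  next
    case False
    define \<gamma> where "\<gamma> = Max {..<\<alpha>}"
    have "\<gamma> \<in> {..<\<alpha>}" unfolding \<gamma>_def using less.prems False by (rule Max_in)
    then have \<gamma>: "\<gamma> < \<alpha>" by simp
    have max: "\<beta> \<le> \<gamma>" if "\<beta> < \<alpha>" for \<beta> unfolding \<gamma>_def using that less.prems by simp
    have "finite {..<\<gamma>}" using less.prems \<gamma> by (meson finite_subset lessThan_subset_iff less_imp_le)
    then obtain n where n: "\<gamma> = finite_ordinal n" using less.IH[OF \<gamma>] by blast
    have "\<alpha> = succ_ordinal \<gamma>"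
      using \<gamma> max less_succ_ordinal_iff less_succ_ordinal[of \<gamma>] by (metis not_le order.antisym not_less)
    then show ?thesis using n by (intro exI[of _ "Suc n"]) (simp add: finite_ordinal_Suc)
  qed
qed

lemma lessThan_omega0: "{..<omega0} = range finite_ordinal"
proof (intro subset_antisym subsetI)
  fix \<beta> assume "\<beta> \<in> {..<omega0}"
  then have "finite {..<\<beta>}" using not_less_Least[of \<beta>] unfolding omega0_def by blast
  then show "\<beta> \<in> range finite_ordinal" using finite_lessThan_imp_finite_ordinal by blast
next
  fix \<beta> assume "\<beta> \<in> range finite_ordinal"
  then have "finite {..<\<beta>}" by (auto simp: lessThan_finite_ordinal)
  then have "\<not> omega0 \<le> \<beta>" using infinite_lessThan_omega0
    by (meson finite_subset lessThan_subset_iff)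
  then show "\<beta> \<in> {..<omega0}" by simp
qed

lemma szlenk_iter_finite_ordinal:
  assumes "0 \<le> \<epsilon>"
  shows "szlenk_iter \<epsilon> (cball 0 1) (finite_ordinal n) = ball_derivation \<epsilon> n"
proof (induction n)
  case 0
  then show ?case by (simp add: finite_ordinal_def szlenk_iter_zero)
next
  case (Suc n)
  have "bounded (ball_derivation \<epsilon> n)" 
    using bounded_subset[OF bounded_cball ball_derivation_subset] .
  then show ?case using Suc.IH szlenk_derivation_eq_separation_derivation assms
    by (simp add: finite_ordinal_Suc szlenk_iter_succ ball_derivation_Suc)
qed

text \<open>The limit clause of the iteration applies, because \<open>omega0\<close> would have only
  finitely many predecessors if it were zero or a successor.\<close>

lemma szlenk_iter_omega0:
  assumes "0 \<le> \<epsilon>"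
  shows "szlenk_iter \<epsilon> (cball 0 1) omega0 = (\<Inter>n. ball_derivation \<epsilon> n)"
proof -
  have "omega0 \<noteq> succ_ordinal \<beta>" for \<beta>
  proof
    assume o: "omega0 = succ_ordinal \<beta>"
    then obtain n where "\<beta> = finite_ordinal n" using less_succ_ordinal[of \<beta>] lessThan_omega0 by auto
    then have e: "omega0 = finite_ordinal (Suc n)" using o by (simp add: finite_ordinal_Suc)
    have "finite {..<omega0}" unfolding e lessThan_finite_ordinal by simp
    then show False using infinite_lessThan_omega0 by simp
  qed
  moreover have "omega0 \<noteq> 0"
  proof
    assume "omega0 = 0"
    then have "{..<omega0} = {}" by (simp add: not_less_zero_ordinal lessThan_def)
    then show False using infinite_lessThan_omega0 by simp
  qed
  ultimately have "szlenk_iter \<epsilon> (cball 0 1) omega0 = (\<Inter>\<beta>\<in>{..<omega0}. szlenk_iter \<epsilon> (cball 0 1) \<beta>)"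
    by (intro szlenk_iter_limit) auto
  then show ?thesis by (simp add: lessThan_omega0 szlenk_iter_finite_ordinal[OF assms])
qed

text \<open>The junk value of \<open>LEAST\<close> matters only if the derivations never vanish.\<close>
definition szlenk_number :: "'a::real_normed_vector itself \<Rightarrow> real \<Rightarrow> nat" where
  "szlenk_number _ \<epsilon> = (LEAST n. ball_derivation \<epsilon> n = ({} :: ('a \<Rightarrow>\<^sub>L real) set))"

text \<open>The \<open>LEAST\<close> in \<open>szlenk_index\<close> is an upper bound only if some
  upper bound exists; \<open>omega1\<close> is one, since every countable ordinal lies below
  it.\<close>

lemma szlenk_index_at_le:
  assumes "szlenk_index TYPE('a::real_normed_vector) = omega0" "0 < \<epsilon>"
  shows "szlenk_index_at TYPE('a) \<epsilon> \<le> omega0"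
proof -
  have le: "szlenk_index_at TYPE('a) \<epsilon> \<le> omega1" for \<epsilon>
  proof -
    define S where "S = {\<alpha>. countable {..<\<alpha>} \<and> szlenk_iter \<epsilon> (cball (0 :: 'a \<Rightarrow>\<^sub>L real) 1) \<alpha> = {}}"
    have "(LEAST \<alpha>. \<alpha> \<in> S) \<le> omega1" if \<alpha>: "\<alpha> \<in> S" for \<alpha>
    proof -
      have "countable {..<\<alpha>}" using \<alpha> by (simp add: S_def)
      then have "\<not> omega1 \<le> \<alpha>" using uncountable_lessThan_omega1
        by (meson countable_subset lessThan_subset_iff)
      then show ?thesis using Least_le[of "\<lambda>\<alpha>. \<alpha> \<in> S", OF \<alpha>] by simp
    qed
    then show ?thesis unfolding szlenk_index_at_def Let_def S_def[symmetric] by auto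
  qed
  have "\<forall>\<epsilon>>0. szlenk_index_at TYPE('a) \<epsilon> \<le> szlenk_index TYPE('a)"
    unfolding szlenk_index_def by (rule LeastI[of _ omega1]) (simp add: le)
  then show ?thesis using assms by simp
qed

text \<open>The default value \<open>omega1\<close> is excluded because the index is at most
  \<open>omega0\<close>. The value \<open>omega0\<close> itself is no obstacle either: the finite
  stages then have empty intersection, so by compactness one of them is empty.\<close>

lemma szlenk_index_at_eq:
  assumes "szlenk_index TYPE('a::real_normed_vector) = omega0" "0 < \<epsilon>"
  shows "szlenk_index_at TYPE('a) \<epsilon> = finite_ordinal (szlenk_number TYPE('a) \<epsilon>)"
    and "ball_derivation \<epsilon> (szlenk_number TYPE('a) \<epsilon>) = ({} :: ('a \<Rightarrow>\<^sub>L real) set)"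
proof -
  define S where "S = {\<alpha>. countable {..<\<alpha>} \<and> szlenk_iter \<epsilon> (cball (0 :: 'a \<Rightarrow>\<^sub>L real) 1) \<alpha> = {}}"
  have fin: "finite_ordinal n \<in> S \<longleftrightarrow> ball_derivation \<epsilon> n = ({} :: ('a \<Rightarrow>\<^sub>L real) set)" for n
    using assms(2) by (simp add: S_def szlenk_iter_finite_ordinal lessThan_finite_ordinal)
  have at: "szlenk_index_at TYPE('a) \<epsilon> = (if S \<noteq> {} then (LEAST \<alpha>. \<alpha> \<in> S) else omega1)"
    unfolding szlenk_index_at_def Let_def S_def ..
  have "countable {..<omega0}" by (simp add: lessThan_omega0)
  then have "\<not> omega1 \<le> omega0"
    using uncountable_lessThan_omega1 by (meson countable_subset lessThan_subset_iff)
  then have "S \<noteq> {}" using at szlenk_index_at_le[OF assms] by auto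
  then have least: "szlenk_index_at TYPE('a) \<epsilon> = (LEAST \<alpha>. \<alpha> \<in> S)" and "\<exists>\<alpha>. \<alpha> \<in> S"
    using at by auto
  then have in_S: "szlenk_index_at TYPE('a) \<epsilon> \<in> S" by (metis LeastI_ex)
  have ex: "\<exists>n. ball_derivation \<epsilon> n = ({} :: ('a \<Rightarrow>\<^sub>L real) set)"
  proof (cases "szlenk_index_at TYPE('a) \<epsilon> = omega0")
    case True
    then have "(\<Inter>n. ball_derivation \<epsilon> n) = ({} :: ('a \<Rightarrow>\<^sub>L real) set)"
      using in_S assms(2) by (simp add: S_def szlenk_iter_omega0)
    then show ?thesis by (rule ball_derivation_eventually_empty)
  next
    case False
    then have "szlenk_index_at TYPE('a) \<epsilon> \<in> {..<omega0}" using szlenk_index_at_le[OF assms] by simp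
    then obtain n where "szlenk_index_at TYPE('a) \<epsilon> = finite_ordinal n" unfolding lessThan_omega0 by blast
    then show ?thesis using in_S fin[of n] by auto
  qed
  show empty: "ball_derivation \<epsilon> (szlenk_number TYPE('a) \<epsilon>) = ({} :: ('a \<Rightarrow>\<^sub>L real) set)"
    unfolding szlenk_number_def using ex by (rule LeastI_ex)
  show "szlenk_index_at TYPE('a) \<epsilon> = finite_ordinal (szlenk_number TYPE('a) \<epsilon>)"
    unfolding least
  proof (rule Least_equality)
    show "finite_ordinal (szlenk_number TYPE('a) \<epsilon>) \<in> S" using empty fin by simp
    fix \<alpha> assume \<alpha>: "\<alpha> \<in> S"
    show "finite_ordinal (szlenk_number TYPE('a) \<epsilon>) \<le> \<alpha>"
    proof (rule ccontr)
      assume "\<not> ?thesis"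
      then have "\<alpha> \<in> {..<finite_ordinal (szlenk_number TYPE('a) \<epsilon>)}" by simp
      then obtain m where m: "m < szlenk_number TYPE('a) \<epsilon>" "\<alpha> = finite_ordinal m"
        unfolding lessThan_finite_ordinal by auto
      then show False using \<alpha> fin not_less_Least[of m] unfolding szlenk_number_def by blast
    qed
  qed
qed

lemma szlenk_number_le_iff:
  assumes "szlenk_index TYPE('a::real_normed_vector) = omega0" "0 < \<epsilon>"
  shows "szlenk_number TYPE('a) \<epsilon> \<le> n \<longleftrightarrow> ball_derivation \<epsilon> n = ({} :: ('a \<Rightarrow>\<^sub>L real) set)"
  using szlenk_index_at_eq(2)[OF assms] ball_derivation_decreasing Least_le
  unfolding szlenk_number_def by (metis (mono_tags, lifting) subset_empty)

text \<open>Otherwise one derivation would empty the ball at every scale and the Szlenk index would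
  be at most 1. Some scale therefore has arbitrarily weak* close pairs that stay apart in
  norm.\<close>

lemma ex_separation_derivation_nonempty:
  assumes "szlenk_index TYPE('a::real_normed_vector) = omega0"
  shows "\<exists>\<epsilon>>0. separation_derivation \<epsilon> (cball (0 :: 'a \<Rightarrow>\<^sub>L real) 1) \<noteq> {}"
proof (rule ccontr)
  assume "\<not> ?thesis"
  then have "ball_derivation \<epsilon> (Suc 0) = ({} :: ('a \<Rightarrow>\<^sub>L real) set)" if "0 < \<epsilon>" for \<epsilon>
    using that by (simp add: ball_derivation_Suc)
  then have "szlenk_number TYPE('a) \<epsilon> \<le> Suc 0" if "0 < \<epsilon>" for \<epsilon>
    using szlenk_number_le_iff[OF assms] that by blast
  then have "\<forall>\<epsilon>>0. szlenk_index_at TYPE('a) \<epsilon> \<le> finite_ordinal (Suc 0)"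
    using szlenk_index_at_eq(1)[OF assms] strict_mono_finite_ordinal by (simp add: strict_mono_less_eq)
  then have "szlenk_index TYPE('a) \<le> finite_ordinal (Suc 0)"
    unfolding szlenk_index_def by (rule Least_le)
  moreover have "finite_ordinal (Suc 0) < omega0" using lessThan_omega0 by blast
  ultimately show False using assms by simp
qed

section \<open>The Szlenk power type\<close>

lemma mono_separation_derivation: "mono (separation_derivation \<epsilon>)"
  by (rule monoI) (rule separation_derivation_mono)

lemma separation_derivation_antimono:
  assumes "\<epsilon> \<le> \<delta>"
  shows "separation_derivation \<delta> K \<subseteq> separation_derivation \<epsilon> K"
  unfolding separation_derivation_def using assms order.strict_trans1 by fast

lemma ball_derivation_antimono:
  assumes "\<epsilon> \<le> \<delta>"
  shows "ball_derivation \<delta> n \<subseteq> ball_derivation \<epsilon> n"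
proof (induction n)
  case (Suc n)
  then show ?case
    using separation_derivation_antimono[OF assms] separation_derivation_mono
    unfolding ball_derivation_Suc by blast
qed simp

lemma separation_derivation_funpow_affine:
  fixes f :: "'a::real_normed_vector \<Rightarrow>\<^sub>L real"
  assumes "s \<noteq> 0"
  shows "(separation_derivation (\<bar>s\<bar> * \<epsilon>) ^^ n) ((\<lambda>h. f + s *\<^sub>R h) ` K) =
    (\<lambda>h. f + s *\<^sub>R h) ` (separation_derivation \<epsilon> ^^ n) K"
  by (induction n) (simp_all add: separation_derivation_affine[OF assms])

lemma uminus_in_ball_derivation:
  "- h \<in> ball_derivation \<epsilon> n \<longleftrightarrow> h \<in> ball_derivation \<epsilon> n"
    for h :: "'a::real_normed_vector \<Rightarrow>\<^sub>L real"
proof -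
  have "h \<in> uminus ` cball 0 1" if "h \<in> cball 0 1" for h :: "'a \<Rightarrow>\<^sub>L real"
    using that by (intro image_eqI[of h uminus "- h"]) simp_all
  then have "(\<lambda>h. 0 + - 1 *\<^sub>R h) ` cball (0 :: 'a \<Rightarrow>\<^sub>L real) 1 = cball 0 1"
    by auto
  then have "(\<lambda>h. 0 + - 1 *\<^sub>R h) ` ball_derivation \<epsilon> n = (ball_derivation \<epsilon> n :: ('a \<Rightarrow>\<^sub>L real) set)"
    using separation_derivation_funpow_affine[of "- 1" n \<epsilon> 0 "cball (0 :: 'a \<Rightarrow>\<^sub>L real) 1"]
    unfolding ball_derivation_def by simp
  then have "uminus ` ball_derivation \<epsilon> n = (ball_derivation \<epsilon> n :: ('a \<Rightarrow>\<^sub>L real) set)" by simp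
  then show ?thesis by (metis image_eqI minus_minus)
qed

text \<open>Being in the derived set is a local property: the neighbourhoods of a point of
  \<open>V\<close> may be shrunk into \<open>V\<close>, and the separated pairs then lie in
  \<open>V\<close>.\<close>

lemma separation_derivation_local:
  assumes "openin weak_star_topology V"
  shows "separation_derivation \<epsilon> K \<inter> V \<subseteq> separation_derivation \<epsilon> (K \<inter> V)"
proof
  fix h assume h: "h \<in> separation_derivation \<epsilon> K \<inter> V"
  show "h \<in> separation_derivation \<epsilon> (K \<inter> V)"
    unfolding separation_derivation_def
  proof (intro CollectI conjI allI impI)
    show "h \<in> K \<inter> V" using h separation_derivation_subset by blast
    fix A :: "'a set" and e :: real assume A: "finite A" "0 < e"
    have "openin weak_star_topology (weak_star_nbhd A e h \<inter> V)"
      using openin_weak_star_nbhd[OF A(1)] assms by blast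
    moreover have "h \<in> weak_star_nbhd A e h \<inter> V" using h self_in_weak_star_nbhd[OF A(2)] by blast
    ultimately obtain A' e' where A': "finite A'" "0 < e'" "weak_star_nbhd A' e' h \<subseteq> weak_star_nbhd A e h \<inter> V"
      by (rule weak_star_nbhd_subset_open)
    then obtain u v where "u \<in> K \<inter> weak_star_nbhd A' e' h" "v \<in> K \<inter> weak_star_nbhd A' e' h" "\<epsilon> < dist u v"
      using h unfolding separation_derivation_def by blast
    then show "\<exists>u\<in>K \<inter> V \<inter> weak_star_nbhd A e h. \<exists>v\<in>K \<inter> V \<inter> weak_star_nbhd A e h. \<epsilon> < dist u v"
      using A'(3) by blast
  qed
qed

lemma separation_derivation_funpow_local:
  assumes "openin weak_star_topology V"
  shows "(separation_derivation \<epsilon> ^^ n) K \<inter> V \<subseteq> (separation_derivation \<epsilon> ^^ n) (K \<inter> V)"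
proof (induction n)
  case (Suc n)
  then show ?case
    using separation_derivation_local[OF assms, of \<epsilon> "(separation_derivation \<epsilon> ^^ n) K"]
      separation_derivation_mono[OF Suc.IH, of \<epsilon>] by auto
qed simp

lemma separation_derivation_funpow_subset: "(separation_derivation \<epsilon> ^^ n) K \<subseteq> K"
  by (induction n) (use separation_derivation_subset in \<open>auto\<close>)

text \<open>A slice of diameter at most \<open>\<sigma>\<close> lies in a translate of \<open>\<sigma>\<close> times the unit ball.\<close>
lemma separation_derivation_funpow_mult_subset:
  fixes K :: "('a::real_normed_vector \<Rightarrow>\<^sub>L real) set"
  assumes "0 < \<sigma>" and empty: "ball_derivation \<tau> n = ({} :: ('a \<Rightarrow>\<^sub>L real) set)"
  shows "(separation_derivation (\<sigma> * \<tau>) ^^ n) K \<subseteq> separation_derivation \<sigma> K"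
proof
  fix z assume z: "z \<in> (separation_derivation (\<sigma> * \<tau>) ^^ n) K"
  show "z \<in> separation_derivation \<sigma> K"
  proof (rule ccontr)
    assume "z \<notin> separation_derivation \<sigma> K"
    moreover have "z \<in> K" using z separation_derivation_funpow_subset by blast
    ultimately obtain A e where A: "finite A" "0 < e"
        "\<And>h. h \<in> weak_star_nbhd A e z \<Longrightarrow> h \<in> K \<Longrightarrow> dist h z \<le> \<sigma>"
      using separation_derivation_complement[of z K \<sigma>] by metis
    let ?V = "weak_star_nbhd A e z" and ?T = "\<lambda>h. z + \<sigma> *\<^sub>R h"
    have "K \<inter> ?V \<subseteq> ?T ` cball 0 1"
    proof
      fix h assume "h \<in> K \<inter> ?V"
      then have "norm (h - z) \<le> \<sigma>" using A(3) by (auto simp: dist_norm)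
      then have "norm ((h - z) /\<^sub>R \<sigma>) \<le> 1" using assms(1) by (simp add: divide_simps)
      moreover have "h = ?T ((h - z) /\<^sub>R \<sigma>)" using assms(1) by simp
      ultimately show "h \<in> ?T ` cball 0 1" 
        using image_eqI[of h ?T "(h - z) /\<^sub>R \<sigma>"] mem_cball_0 by blast
    qed
    then have "(separation_derivation (\<sigma> * \<tau>) ^^ n) (K \<inter> ?V) \<subseteq>
        (separation_derivation (\<sigma> * \<tau>) ^^ n) (?T ` cball 0 1)"
      by (rule funpow_mono[OF mono_separation_derivation])
    moreover have "(separation_derivation (\<sigma> * \<tau>) ^^ n) (?T ` cball 0 1) = {}"
      using separation_derivation_funpow_affine[of \<sigma> n \<tau> z "cball 0 1"] assms
      by (simp add: ball_derivation_def)
    \<comment> \<open>By locality \<open>z\<close> survives \<open>n\<close> derivations of the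
      slice alone, while the slice sits in an affine copy of the ball that \<open>n\<close>
      derivations empty.\<close>
    moreover have "z \<in> (separation_derivation (\<sigma> * \<tau>) ^^ n) (K \<inter> ?V)"
      using separation_derivation_funpow_local[OF openin_weak_star_nbhd[OF A(1)], of n "\<sigma> * \<tau>" K e z]
        z self_in_weak_star_nbhd[OF A(2), of z A] by blast
    ultimately show False by blast
  qed
qed

text \<open>A block of \<open>?n\<close> derivations at scale \<open>\<sigma> * \<tau>\<close>
  removes at least as much as one derivation at scale \<open>\<sigma>\<close>; the blocks are then
  stacked.\<close>

lemma szlenk_number_mult_le:
  assumes "szlenk_index TYPE('a::real_normed_vector) = omega0" "0 < \<sigma>" "0 < \<tau>"
  shows "szlenk_number TYPE('a) (\<sigma> * \<tau>) \<le> szlenk_number TYPE('a) \<sigma> * szlenk_number TYPE('a) \<tau>"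
proof -
  let ?n = "szlenk_number TYPE('a) \<tau>"
  have "ball_derivation (\<sigma> * \<tau>) (j * ?n) \<subseteq> (ball_derivation \<sigma> j :: ('a \<Rightarrow>\<^sub>L real) set)" for j
  proof (induction j)
    case (Suc j)
    have "ball_derivation (\<sigma> * \<tau>) (Suc j * ?n) =
        (separation_derivation (\<sigma> * \<tau>) ^^ ?n) (ball_derivation (\<sigma> * \<tau>) (j * ?n) :: ('a \<Rightarrow>\<^sub>L real) set)"
      by (simp add: ball_derivation_def funpow_add)
    also have "\<dots> \<subseteq> (separation_derivation (\<sigma> * \<tau>) ^^ ?n) (ball_derivation \<sigma> j)"
      by (rule funpow_mono[OF mono_separation_derivation Suc.IH])
    also have "\<dots> \<subseteq> ball_derivation \<sigma> (Suc j)"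
      unfolding ball_derivation_Suc
      by (rule separation_derivation_funpow_mult_subset[OF assms(2) szlenk_index_at_eq(2)[OF assms(1,3)]])
    finally show ?case .
  qed simp
  then have "ball_derivation (\<sigma> * \<tau>) (szlenk_number TYPE('a) \<sigma> * ?n) = ({} :: ('a \<Rightarrow>\<^sub>L real) set)"
    using szlenk_index_at_eq(2)[OF assms(1,2)] by blast
  then show ?thesis using szlenk_number_le_iff[OF assms(1)] assms(2,3) by simp
qed

lemma szlenk_number_antimono:
  assumes "szlenk_index TYPE('a::real_normed_vector) = omega0" "0 < \<epsilon>" "\<epsilon> \<le> \<delta>"
  shows "szlenk_number TYPE('a) \<delta> \<le> szlenk_number TYPE('a) \<epsilon>"
proof -
  have "ball_derivation \<delta> (szlenk_number TYPE('a) \<epsilon>) = ({} :: ('a \<Rightarrow>\<^sub>L real) set)"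
    using ball_derivation_antimono[OF assms(3)] szlenk_index_at_eq(2)[OF assms(1,2)] by blast
  then show ?thesis using szlenk_number_le_iff[OF assms(1), of \<delta>] assms(2,3) by simp
qed

lemma szlenk_number_pos:
  assumes "szlenk_index TYPE('a::real_normed_vector) = omega0" "0 < \<epsilon>"
  shows "0 < szlenk_number TYPE('a) \<epsilon>"
proof (rule ccontr)
  assume "\<not> ?thesis"
  then have "cball (0 :: 'a \<Rightarrow>\<^sub>L real) 1 = {}"
    using szlenk_index_at_eq(2)[OF assms] by simp
  then show False by simp
qed

text \<open>Fekete's lemma for a real variable. Monotonicity allows \<open>t\<close> to be rounded
  up to a multiple of a fixed \<open>s\<close> whose quotient is nearly minimal.\<close>

lemma mono_subadditive_tendsto_Inf:
  fixes h :: "real \<Rightarrow> real"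
  assumes mono: "\<And>s t. 0 < s \<Longrightarrow> s \<le> t \<Longrightarrow> h s \<le> h t"
    and subadd: "\<And>s t. 0 < s \<Longrightarrow> 0 < t \<Longrightarrow> h (s + t) \<le> h s + h t"
    and nonneg: "\<And>t. 0 < t \<Longrightarrow> 0 \<le> h t"
  shows "((\<lambda>t. h t / t) \<longlongrightarrow> (INF t\<in>{0<..}. h t / t)) at_top"
proof -
  have bdd: "bdd_below ((\<lambda>t. h t / t) ` {0<..})"
    by (rule bdd_belowI2[of _ 0]) (simp add: nonneg)
  show ?thesis
  proof (rule order_tendstoI)
    define p where "p = (INF t\<in>{0<..}. h t / t)"
    fix a assume "a < p"
    have "a < h t / t" if "0 < t" for t
      using cINF_lower[OF bdd, of t] that \<open>a < p\<close> p_def by simp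
    then show "\<forall>\<^sub>F t in at_top. a < h t / t"
      by (rule eventually_mono[OF eventually_gt_at_top[of 0]])
  next
    fix a assume "(INF t\<in>{0<..}. h t / t) < a"
    then have "\<exists>s\<in>{0<..}. h s / s < a"
      unfolding cINF_less_iff[OF greaterThan_non_empty bdd] .
    then obtain s where s: "0 < s" "h s / s < a" by blast
    have mult: "h (real (Suc n) * s) \<le> real (Suc n) * h s" for n
    proof (induction n)
      case (Suc n)
      have "h (real (Suc n) * s + s) \<le> h (real (Suc n) * s) + h s"
        using s by (intro subadd) auto
      then show ?case using Suc.IH by (simp add: algebra_simps)
    qed simp
    have "((\<lambda>t. h s / s + h s / t) \<longlongrightarrow> h s / s + 0) at_top"
      by (intro tendsto_add tendsto_const tendsto_divide_0[OF tendsto_const] filterlim_at_top_imp_at_infinity filterlim_ident)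
    then have "\<forall>\<^sub>F t in at_top. h s / s + h s / t < a"
      using s(2) by (intro order_tendstoD(2)) auto
    then show "\<forall>\<^sub>F t in at_top. h t / t < a"
      using eventually_gt_at_top[of 0]
    proof eventually_elim
      case (elim t)
      \<comment> \<open>\<open>Suc n\<close> steps of length \<open>s\<close> reach past
        \<open>t\<close>; the overshoot of at most one step adds only \<open>h s / t\<close>, which
        vanishes as \<open>t\<close> grows.\<close>
      define n where "n = nat \<lfloor>t / s\<rfloor>"
      have n: "real n \<le> t / s" "t / s \<le> real (Suc n)"
        using elim(2) s(1) unfolding n_def by (simp_all add: of_nat_nat) linarith
      have "h t \<le> h (real (Suc n) * s)"
        using n(2) s(1) elim(2) by (intro mono) (simp_all add: pos_divide_le_eq)
      also have "\<dots> \<le> real (Suc n) * h s" by (rule mult)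
      also have "\<dots> \<le> (t / s + 1) * h s"
        using n(1) nonneg[OF s(1)] by (intro mult_right_mono) auto
      finally have "h t / t \<le> (t / s + 1) * h s / t"
        using elim(2) by (intro divide_right_mono) auto
      also have "\<dots> = h s / s + h s / t" using elim(2) s(1) by (simp add: field_simps)
      finally show ?case using elim(1) by simp
    qed
qed
qed

text \<open>The substitution \<open>exp (- t)\<close> for the scale turns submultiplicativity into
  subadditivity. Convergence is needed to know that the \<open>Lim\<close> in
  \<open>szlenk_power_type\<close> is a genuine limit.\<close>

lemma szlenk_power_type_tendsto:
  assumes "szlenk_index TYPE('a::real_normed_vector) = omega0"
  shows "((\<lambda>t. ln (real (szlenk_number TYPE('a) (exp (- t)))) / t) \<longlongrightarrow> szlenk_power_type TYPE('a)) at_top"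
proof -
  define h where "h t = ln (real (szlenk_number TYPE('a) (exp (- t))))" for t
  have pos: "0 < real (szlenk_number TYPE('a) (exp (- t)))" for t
    using szlenk_number_pos[OF assms] by simp
  have "h s \<le> h t" if "s \<le> t" for s t
    using szlenk_number_antimono[OF assms, of "exp (- t)" "exp (- s)"] that pos
    by (simp add: h_def)
  moreover have "h (s + t) \<le> h s + h t" for s t
  proof -
    have "real (szlenk_number TYPE('a) (exp (- (s + t)))) \<le>
        real (szlenk_number TYPE('a) (exp (- s))) * real (szlenk_number TYPE('a) (exp (- t)))"
      using szlenk_number_mult_le[OF assms, of "exp (- s)" "exp (- t)"]
      by (simp add: exp_add[symmetric] add.commute flip: of_nat_mult)
    then have "h (s + t) \<le> ln (real (szlenk_number TYPE('a) (exp (- s))) * real (szlenk_number TYPE('a) (exp (- t))))"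
      unfolding h_def using pos by (subst ln_le_cancel_iff) (blast intro: mult_pos_pos)+
    then show ?thesis using pos by (simp add: h_def ln_mult)
  qed
  moreover have "0 \<le> h t" for t
    using szlenk_number_pos[OF assms, of "exp (- t)"] by (simp add: h_def)
  ultimately obtain p where p: "((\<lambda>t. h t / t) \<longlongrightarrow> p) at_top"
    using mono_subadditive_tendsto_Inf[of h] by blast
  have "filterlim (\<lambda>\<epsilon>. - ln \<epsilon> :: real) at_top (at_right 0)"
    using ln_at_0 by (simp add: filterlim_uminus_at_top)
  then have "((\<lambda>\<epsilon>. h (- ln \<epsilon>) / - ln \<epsilon>) \<longlongrightarrow> p) (at_right 0)"
    by (rule filterlim_compose[OF p])
  moreover have "\<forall>\<^sub>F \<epsilon> in at_right 0. h (- ln \<epsilon>) / - ln \<epsilon> =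
      ln (real (card {..<szlenk_index_at TYPE('a) \<epsilon>})) / \<bar>ln \<epsilon>\<bar>"
  proof -
    have "\<forall>\<^sub>F \<epsilon> in at_right 0. \<epsilon> \<in> {0<..<1::real}" by (rule eventually_at_right_real) simp
    then show ?thesis
    proof eventually_elim
      case (elim \<epsilon>)
      then show ?case
        using szlenk_index_at_eq(1)[OF assms, of \<epsilon>]
        by (simp add: h_def card_lessThan_finite_ordinal abs_if ln_less_zero)
    qed
  qed
  ultimately have "((\<lambda>\<epsilon>. ln (real (card {..<szlenk_index_at TYPE('a) \<epsilon>})) / \<bar>ln \<epsilon>\<bar>) \<longlongrightarrow> p) (at_right 0)"
    by (rule Lim_transform_eventually)
  then have "szlenk_power_type TYPE('a) = p"
    unfolding szlenk_power_type_def by (intro tendsto_Lim) simp_all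
  then show ?thesis using p by (simp add: h_def)
qed

text \<open>For \<open>r\<close> strictly between the power type and \<open>q\<close>, the number at
  scale 2^-k is eventually at most 2^(k r), so the terms are dominated by a geometric series of
  ratio 2^(r - q).\<close>

lemma summable_szlenk_number:
  assumes "szlenk_index TYPE('a::real_normed_vector) = omega0" "szlenk_power_type TYPE('a) < q"
  shows "summable (\<lambda>k. real (szlenk_number TYPE('a) ((1/2) ^ k)) * (1/2) powr (real k * q))"
proof -
  obtain r where r: "szlenk_power_type TYPE('a) < r" "r < q" using assms(2) dense by blast
  have "\<forall>\<^sub>F t in at_top. ln (real (szlenk_number TYPE('a) (exp (- t)))) / t < r"
    using order_tendstoD(2)[OF szlenk_power_type_tendsto[OF assms(1)] r(1)] .
  moreover have "filterlim (\<lambda>k. real k * ln 2) at_top sequentially"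
    by (intro filterlim_at_top_mult_tendsto_pos[OF tendsto_const] filterlim_real_sequentially) simp
  ultimately have "\<forall>\<^sub>F k in sequentially.
      ln (real (szlenk_number TYPE('a) (exp (- (real k * ln 2))))) / (real k * ln 2) < r"
    unfolding filterlim_iff by blast
  then have "\<forall>\<^sub>F k in sequentially. norm (real (szlenk_number TYPE('a) ((1/2) ^ k)) * (1/2) powr (real k * q))
      \<le> ((1/2) powr (q - r)) ^ k"
    using eventually_gt_at_top[of 0]
  proof eventually_elim
    case (elim k)
    have e: "exp (- (real k * ln 2)) = (1/2 :: real) ^ k"
      by (simp add: exp_minus exp_of_nat_mult power_one_over inverse_eq_divide)
    have "0 < real (szlenk_number TYPE('a) ((1/2) ^ k))"
      using szlenk_number_pos[OF assms(1), of "(1/2) ^ k"] by simp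
    moreover have "ln (real (szlenk_number TYPE('a) ((1/2) ^ k))) < r * (real k * ln 2)"
      using elim unfolding e by (simp add: divide_less_eq)
    ultimately have "real (szlenk_number TYPE('a) ((1/2) ^ k)) \<le> exp (r * (real k * ln 2))"
      by (metis exp_le_cancel_iff exp_ln less_imp_le)
    also have "\<dots> = (1/2) powr (- (real k * r))"
      by (simp add: powr_def ln_div mult_ac)
    finally have "real (szlenk_number TYPE('a) ((1/2) ^ k)) * (1/2) powr (real k * q)
        \<le> (1/2) powr (- (real k * r)) * (1/2) powr (real k * q)"
      by (rule mult_right_mono) simp
    also have "\<dots> = (1/2) powr ((q - r) * real k)"
      by (simp add: powr_add[symmetric] algebra_simps)
    also have "\<dots> = ((1/2) powr (q - r)) ^ k"
      by (simp add: powr_powr[symmetric] powr_realpow)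
    finally show ?case by simp
  qed
  moreover have "summable (\<lambda>k. ((1/2 :: real) powr (q - r)) ^ k)"
    using r(2) by (intro summable_geometric) (simp add: powr_def ln_div)
  ultimately show ?thesis by (rule summable_comparison_test_ev)
qed

text \<open>One derivation at scale \<open>t * \<epsilon>\<close> shortens the radius of a ball by
  at most \<open>t\<close>, so about \<open>1 / t\<close> of them are needed to empty the unit
  ball.\<close>

lemma szlenk_power_type_ge_1:
  assumes "szlenk_index TYPE('a::real_normed_vector) = omega0"
  shows "1 \<le> szlenk_power_type TYPE('a)"
proof -
  obtain \<epsilon> and f :: "'a \<Rightarrow>\<^sub>L real" where \<epsilon>: "0 < \<epsilon>" and f: "f \<in> separation_derivation \<epsilon> (cball 0 1)"
    using ex_separation_derivation_nonempty[OF assms] by blast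
  \<comment> \<open>Half the difference of a separated pair near \<open>f\<close> is a weak* small
    vector of the unit ball whose norm exceeds \<open>\<epsilon> / 2\<close>.\<close>
  have d: "\<exists>d :: 'a \<Rightarrow>\<^sub>L real. norm d \<le> 1 \<and> d \<in> weak_star_nbhd A e 0 \<and> \<epsilon> / 2 < norm d"
    if A: "finite A" "0 < e" for A e
  proof -
    obtain u v where uv: "u \<in> cball 0 1" "v \<in> cball 0 1" "u \<in> weak_star_nbhd A e f"
        "v \<in> weak_star_nbhd A e f" "\<epsilon> < dist u v"
      using f A unfolding separation_derivation_def by blast
    let ?d = "(1/2) *\<^sub>R (u - v)"
    have "\<bar>?d a\<bar> < e" if "a \<in> A" for a
    proof -
      have "\<bar>u a - f a\<bar> < e" "\<bar>v a - f a\<bar> < e" using uv that by (auto simp: weak_star_nbhd_def)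
      then show ?thesis by (simp add: blinfun.scaleR_left blinfun.diff_left)
    qed
    moreover have "norm ?d \<le> 1" using norm_triangle_ineq4[of u v] uv(1,2) by simp
    ultimately show ?thesis
      using uv(5) by (intro exI[of _ ?d]) (simp add: dist_norm weak_star_nbhd_def)
  qed
  \<comment> \<open>If \<open>y\<close> lies \<open>t\<close> deeper than the previous radius, then
    \<open>y + t *\<^sub>R d\<close> and \<open>y - t *\<^sub>R d\<close> are still in the previous
    ball and more than \<open>t * \<epsilon>\<close> apart.\<close>
  have sub: "cball (0 :: 'a \<Rightarrow>\<^sub>L real) (1 - real n * t) \<subseteq> ball_derivation (t * \<epsilon>) n" if t: "0 < t" for n t
  proof (induction n)
    case (Suc n)
    show ?case
    proof
      fix y :: "'a \<Rightarrow>\<^sub>L real" assume "y \<in> cball 0 (1 - real (Suc n) * t)"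
      then have y: "norm y \<le> 1 - real n * t - t" by (simp add: algebra_simps)
      show "y \<in> ball_derivation (t * \<epsilon>) (Suc n)"
        unfolding ball_derivation_Suc separation_derivation_def
      proof (intro CollectI conjI allI impI)
        show "y \<in> ball_derivation (t * \<epsilon>) n" using Suc.IH y t by auto
        fix A :: "'a set" and e :: real assume A: "finite A" "0 < e"
        obtain d :: "'a \<Rightarrow>\<^sub>L real" where d: "norm d \<le> 1" "d \<in> weak_star_nbhd A (e / t) 0" "\<epsilon> / 2 < norm d"
          using d[OF A(1), of "e / t"] A(2) t by auto
        have n: "norm (s *\<^sub>R d) \<le> t" if "\<bar>s\<bar> = t" for s
          using that d(1) t by (simp add: mult_left_le)
        have "y + s *\<^sub>R d \<in> ball_derivation (t * \<epsilon>) n \<inter> weak_star_nbhd A e y" if "\<bar>s\<bar> = t" for s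
        proof -
          have "norm (y + s *\<^sub>R d) \<le> 1 - real n * t"
            using norm_triangle_ineq[of y "s *\<^sub>R d"] n[OF that] y by linarith
          moreover have "y + s *\<^sub>R d \<in> weak_star_nbhd A e y"
            using d(2) t that by (auto simp: weak_star_nbhd_def blinfun.add_left blinfun.scaleR_left
                abs_mult pos_less_divide_eq mult.commute)
          ultimately show ?thesis using Suc.IH by auto
        qed
        from this[of t] this[of "- t"] have
          "y + t *\<^sub>R d \<in> ball_derivation (t * \<epsilon>) n \<inter> weak_star_nbhd A e y"
          "y + - t *\<^sub>R d \<in> ball_derivation (t * \<epsilon>) n \<inter> weak_star_nbhd A e y"
          using t by auto
        moreover have "t * \<epsilon> < dist (y + t *\<^sub>R d) (y + - t *\<^sub>R d)"
        proof -
          have "dist (y + t *\<^sub>R d) (y + - t *\<^sub>R d) = norm ((2 * t) *\<^sub>R d)"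
            unfolding dist_norm mult_2 scaleR_add_left by simp
          also have "\<dots> = t * (2 * norm d)" using t by simp
          finally show ?thesis using d(3) t by simp
        qed
        ultimately show "\<exists>u\<in>ball_derivation (t * \<epsilon>) n \<inter> weak_star_nbhd A e y.
            \<exists>v\<in>ball_derivation (t * \<epsilon>) n \<inter> weak_star_nbhd A e y. t * \<epsilon> < dist u v" by blast
      qed
    qed
  qed simp
  have ge: "1 / t \<le> real (szlenk_number TYPE('a) (t * \<epsilon>))" if t: "0 < t" for t
  proof -
    \<comment> \<open>Stage \<open>n\<close> still contains 0, so the Szlenk number is at least
      \<open>n + 1\<close>, and this exceeds or equals \<open>1 / t\<close> despite the
      rounding.\<close>
    define n where "n = nat \<lfloor>1 / t\<rfloor>"
    have n: "real n \<le> 1 / t" "1 / t \<le> real n + 1"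
      using t unfolding n_def by (simp_all add: of_nat_nat)
    then have "0 \<le> 1 - real n * t" using t by (simp add: pos_le_divide_eq)
    then have "ball_derivation (t * \<epsilon>) n \<noteq> ({} :: ('a \<Rightarrow>\<^sub>L real) set)"
      using sub[OF t, of n] by fastforce
    then have "\<not> szlenk_number TYPE('a) (t * \<epsilon>) \<le> n"
      using szlenk_number_le_iff[OF assms, of "t * \<epsilon>"] t \<epsilon> by simp
    then show ?thesis using n(2) by linarith
  qed
  have "((\<lambda>t. 1 + ln \<epsilon> / t) \<longlongrightarrow> 1 + 0) at_top"
    by (intro tendsto_add tendsto_const tendsto_divide_0[OF tendsto_const] filterlim_at_top_imp_at_infinity filterlim_ident)
  moreover have "\<forall>\<^sub>F t in at_top. 1 + ln \<epsilon> / t \<le> ln (real (szlenk_number TYPE('a) (exp (- t)))) / t"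
    using eventually_gt_at_top[of 0]
  proof eventually_elim
    case (elim t)
    have "\<epsilon> * exp t \<le> real (szlenk_number TYPE('a) (exp (- t)))"
      using ge[of "exp (- t) / \<epsilon>"] \<epsilon> by (simp add: exp_minus field_simps)
    then have "ln (\<epsilon> * exp t) \<le> ln (real (szlenk_number TYPE('a) (exp (- t))))"
      using \<epsilon> szlenk_number_pos[OF assms, of "exp (- t)"] by (subst ln_le_cancel_iff) simp_all
    then have "ln \<epsilon> + t \<le> ln (real (szlenk_number TYPE('a) (exp (- t))))"
      using \<epsilon> by (simp add: ln_mult)
    then have "(ln \<epsilon> + t) / t \<le> ln (real (szlenk_number TYPE('a) (exp (- t)))) / t"
      using elim by (intro divide_right_mono) auto
    then show ?case using elim by (simp add: add_divide_distrib add.commute)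
  qed
  ultimately show ?thesis
    using tendsto_le[OF _ szlenk_power_type_tendsto[OF assms]] by force
qed

section \<open>A rank function and its concave envelope\<close>

text \<open>On the unit ball this is the last stage containing \<open>f\<close>. Testing stage
  \<open>Suc n\<close> gives rank 0 to the points lost at the first derivation.\<close>

definition szlenk_rank :: "real \<Rightarrow> ('a::real_normed_vector \<Rightarrow>\<^sub>L real) \<Rightarrow> nat" where
  "szlenk_rank \<epsilon> f = (LEAST n. f \<notin> ball_derivation \<epsilon> (Suc n))"

lemma
  fixes f :: "'a::real_normed_vector \<Rightarrow>\<^sub>L real"
  assumes "szlenk_index TYPE('a) = omega0" "0 < \<epsilon>" "f \<in> cball 0 1"
  shows in_ball_derivation_iff: "f \<in> ball_derivation \<epsilon> n \<longleftrightarrow> n \<le> szlenk_rank \<epsilon> f"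
    and szlenk_rank_le: "szlenk_rank \<epsilon> f \<le> szlenk_number TYPE('a) \<epsilon>"
proof -
  have "f \<notin> ball_derivation \<epsilon> (Suc (szlenk_number TYPE('a) \<epsilon>))"
    using szlenk_index_at_eq(2)[OF assms(1,2)] ball_derivation_decreasing[of "szlenk_number TYPE('a) \<epsilon>"]
    by (metis empty_iff le_SucI order_refl subsetD)
  then have notin: "f \<notin> ball_derivation \<epsilon> (Suc (szlenk_rank \<epsilon> f))"
    and "szlenk_rank \<epsilon> f \<le> szlenk_number TYPE('a) \<epsilon>"
    unfolding szlenk_rank_def by (rule LeastI, rule Least_le)
  then show "szlenk_rank \<epsilon> f \<le> szlenk_number TYPE('a) \<epsilon>" by simp
  have r: "f \<in> ball_derivation \<epsilon> (szlenk_rank \<epsilon> f)"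
  proof (cases "szlenk_rank \<epsilon> f")
    case 0
    then show ?thesis using assms(3) by simp
  next
    case (Suc m)
    then show ?thesis using not_less_Least[of m "\<lambda>n. f \<notin> ball_derivation \<epsilon> (Suc n)"]
      by (simp add: szlenk_rank_def)
  qed
  show "f \<in> ball_derivation \<epsilon> n \<longleftrightarrow> n \<le> szlenk_rank \<epsilon> f"
  proof
    assume "f \<in> ball_derivation \<epsilon> n"
    then show "n \<le> szlenk_rank \<epsilon> f"
      using notin ball_derivation_decreasing[of "Suc (szlenk_rank \<epsilon> f)" n \<epsilon>] by (meson not_less_eq_eq subsetD)
  next
    assume "n \<le> szlenk_rank \<epsilon> f"
    then show "f \<in> ball_derivation \<epsilon> n" using r ball_derivation_decreasing by blast
  qed
qed

lemma szlenk_rank_uminus: "szlenk_rank \<epsilon> (- f) = szlenk_rank \<epsilon> f"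
  by (simp add: szlenk_rank_def uminus_in_ball_derivation)

text \<open>Applied to the last stage containing \<open>f\<close>: near \<open>f\<close> nothing
  survives to the next stage, so ranks do not rise, and points farther than
  \<open>\<epsilon>\<close> from \<open>f\<close> are not even in this stage, so their rank is
  strictly smaller. The \<open>of_bool\<close> term carries both statements at once.\<close>

lemma szlenk_rank_near:
  fixes f :: "'a::real_normed_vector \<Rightarrow>\<^sub>L real"
  assumes "szlenk_index TYPE('a) = omega0" "0 < \<epsilon>" "f \<in> cball 0 1"
  obtains A e where "finite A" "0 < e"
    "\<And>h. h \<in> cball 0 1 \<Longrightarrow> h \<in> weak_star_nbhd A e f \<Longrightarrow>
      szlenk_rank \<epsilon> h + of_bool (\<epsilon> < dist h f) \<le> szlenk_rank \<epsilon> f"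
proof -
  note iff = in_ball_derivation_iff[OF assms(1,2)]
  let ?K = "ball_derivation \<epsilon> (szlenk_rank \<epsilon> f)"
  have "f \<in> ?K" "f \<notin> separation_derivation \<epsilon> ?K"
    using iff[OF assms(3)] by (simp_all flip: ball_derivation_Suc)
  then obtain A e where A: "finite A" "0 < e"
      "\<And>h. h \<in> weak_star_nbhd A e f \<Longrightarrow> h \<notin> separation_derivation \<epsilon> ?K"
      "\<And>h. h \<in> weak_star_nbhd A e f \<Longrightarrow> h \<in> ?K \<Longrightarrow> dist h f \<le> \<epsilon>"
    by (rule separation_derivation_complement) blast
  have "szlenk_rank \<epsilon> h + of_bool (\<epsilon> < dist h f) \<le> szlenk_rank \<epsilon> f"
    if h: "h \<in> cball 0 1" "h \<in> weak_star_nbhd A e f" for h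
  proof -
    have "szlenk_rank \<epsilon> h \<le> szlenk_rank \<epsilon> f"
      using A(3)[OF h(2)] iff[OF h(1), of "Suc (szlenk_rank \<epsilon> f)"] by (simp add: ball_derivation_Suc)
    moreover have "\<epsilon> < dist h f \<Longrightarrow> szlenk_rank \<epsilon> h \<noteq> szlenk_rank \<epsilon> f"
      using A(4)[OF h(2)] iff[OF h(1), of "szlenk_rank \<epsilon> f"] by auto
    ultimately show ?thesis by auto
  qed
  then show ?thesis using that A(1,2) by blast
qed

lemma weak_star_nbhd_INT:
  assumes "finite I" "\<And>i. i \<in> I \<Longrightarrow> finite (A i)" "\<And>i. i \<in> I \<Longrightarrow> 0 < e i"
  obtains B d where "finite B" "0 < d" "\<And>i. i \<in> I \<Longrightarrow> weak_star_nbhd B d f \<subseteq> weak_star_nbhd (A i) (e i) f"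
proof (rule that)
  show "finite (\<Union>i\<in>I. A i)" using assms by blast
  show "0 < Min (insert 1 (e ` I))" using assms by simp
  fix i assume i: "i \<in> I"
  then have "Min (insert 1 (e ` I)) \<le> e i" using assms(1) by simp
  then show "weak_star_nbhd (\<Union>i\<in>I. A i) (Min (insert 1 (e ` I))) f \<subseteq> weak_star_nbhd (A i) (e i) f"
    using i unfolding weak_star_nbhd_def by fastforce
qed

text \<open>The ranks at all scales \<open>2\<^sup>-\<^sup>k\<close> are added with weights \<open>2\<^sup>-\<^sup>k\<^sup>q\<close>; a jump of size \<open>t\<close> lowers
  the rank at the largest scale below \<open>t\<close>.\<close>
lemma ex_rank_function:
  assumes "szlenk_index TYPE('a::real_normed_vector) = omega0" "szlenk_power_type TYPE('a) < q"
  obtains F :: "('a::real_normed_vector \<Rightarrow>\<^sub>L real) \<Rightarrow> real" and M c where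
    "0 < c" "\<And>f. f \<in> cball 0 1 \<Longrightarrow> 0 \<le> F f \<and> F f \<le> M" "\<And>f. F (- f) = F f"
    "\<And>f \<delta>. f \<in> cball 0 1 \<Longrightarrow> 0 < \<delta> \<Longrightarrow> \<exists>A e. finite A \<and> 0 < e \<and>
      (\<forall>h\<in>cball 0 1 \<inter> weak_star_nbhd A e f. F h + c * norm (h - f) powr q \<le> F f + \<delta>)"
proof -
  have q: "1 < q" using szlenk_power_type_ge_1[OF assms(1)] assms(2) by linarith
  define w where "w k = (1/2) powr (real k * q)" for k
  define r where "r k f = real (szlenk_rank ((1/2) ^ k) f)" for k and f :: "'a \<Rightarrow>\<^sub>L real"
  define S where "S k = real (szlenk_number TYPE('a) ((1/2) ^ k)) * w k" for k
  define F where "F f = (\<Sum>k. r k f * w k)" for f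
  have w: "0 < w k" for k by (simp add: w_def)
  have S: "summable S" unfolding S_def w_def by (rule summable_szlenk_number[OF assms])
  \<comment> \<open>The tail of \<open>S\<close> therefore bounds single weights as well, which is
    how displacements below the finest controlled scale are absorbed.\<close>
  have wS: "w k \<le> S k" for k
  proof -
    have "1 \<le> real (szlenk_number TYPE('a) ((1/2) ^ k))"
      using szlenk_number_pos[OF assms(1), of "(1/2) ^ k"] by simp
    then show ?thesis using mult_right_mono[of 1 _ "w k"] w[of k] by (simp add: S_def)
  qed
  have r: "0 \<le> r k f * w k" "r k f * w k \<le> S k" if "f \<in> cball 0 1" for f k
    using szlenk_rank_le[OF assms(1) _ that, of "(1/2) ^ k"] w[of k]
    by (simp_all add: r_def S_def less_imp_le)
  have sum: "summable (\<lambda>k. r k f * w k)" if "f \<in> cball 0 1" for f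
    using r[OF that] by (intro summable_comparison_test'[OF S, of 0]) simp
  show ?thesis
  proof (rule that)
    \<comment> \<open>The largest scale 2^-m below the displacement t satisfies t <= 2 * 2^-m, so
      (t/2)^q is at most the weight \<open>w m\<close>.\<close>
    show "0 < (1/2) powr q" by simp
    show "0 \<le> F f \<and> F f \<le> suminf S" if "f \<in> cball 0 1" for f
      unfolding F_def using r[OF that] sum[OF that] S by (intro conjI suminf_nonneg suminf_le) auto
    show "F (- f) = F f" for f by (simp add: F_def r_def szlenk_rank_uminus)
  next
    fix f :: "'a \<Rightarrow>\<^sub>L real" and \<delta> :: real assume f: "f \<in> cball 0 1" and \<delta>: "0 < \<delta>"
    \<comment> \<open>One neighbourhood can control only finitely many scales; those from
      \<open>K\<close> on are charged to \<open>\<delta>\<close>.\<close>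
    obtain K where K: "norm (\<Sum>i. S (i + K)) < \<delta> / 2"
      using suminf_exist_split[OF half_gt_zero[OF \<delta>] S] by blast
    have tail_nonneg: "0 \<le> S k" for k using w[of k] wS[of k] by linarith
    have tail: "(\<Sum>i. S (i + K)) < \<delta> / 2" using K by simp
    have "\<exists>A e. finite A \<and> 0 < e \<and> (\<forall>h\<in>cball 0 1 \<inter> weak_star_nbhd A e f.
        szlenk_rank ((1/2) ^ k) h + of_bool ((1/2) ^ k < dist h f) \<le> szlenk_rank ((1/2) ^ k) f)" for k
      using szlenk_rank_near[OF assms(1) _ f, of "(1/2) ^ k"] by (metis IntD1 IntD2 half_gt_zero_iff zero_less_one zero_less_power)
    then obtain A e where A: "\<And>k. finite (A k)" "\<And>k. 0 < e k"
      "\<And>k h. h \<in> cball 0 1 \<Longrightarrow> h \<in> weak_star_nbhd (A k) (e k) f \<Longrightarrow>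
        szlenk_rank ((1/2) ^ k) h + of_bool ((1/2) ^ k < dist h f) \<le> szlenk_rank ((1/2) ^ k) f"
      by (metis IntI)
    obtain B d where B: "finite B" "0 < d" "\<And>k. k \<in> {..K} \<Longrightarrow> weak_star_nbhd B d f \<subseteq> weak_star_nbhd (A k) (e k) f"
      using weak_star_nbhd_INT[of "{..K}" A e f] A(1,2) by auto
    have "F h + (1/2) powr q * norm (h - f) powr q \<le> F f + \<delta>"
      if h: "h \<in> cball 0 1" "h \<in> weak_star_nbhd B d f" for h
    proof -
      have jump: "r k h + of_bool ((1/2) ^ k < dist h f) \<le> r k f" if "k \<le> K" for k
      proof -
        have "szlenk_rank ((1/2) ^ k) h + of_bool ((1/2) ^ k < dist h f) \<le> szlenk_rank ((1/2) ^ k) f"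
          using A(3)[OF h(1), of k] B(3)[of k] that h(2) by auto
        then have "real (szlenk_rank ((1/2) ^ k) h + of_bool ((1/2) ^ k < dist h f)) \<le> real (szlenk_rank ((1/2) ^ k) f)"
          by (rule of_nat_mono)
        then show ?thesis by (simp add: r_def)
      qed
      have head: "(\<Sum>k<K. r k f * w k) \<le> F f" 
        unfolding F_def using sum[OF f] r(1)[OF f] by (intro sum_le_suminf) auto
      have head': "(\<Sum>k<Suc K. r k f * w k) \<le> F f" 
        unfolding F_def using sum[OF f] r(1)[OF f] by (intro sum_le_suminf) auto
      have split: "F h = (\<Sum>i. r (i + n) h * w (i + n)) + (\<Sum>k<n. r k h * w k)" for n
        unfolding F_def by (rule suminf_split_initial_segment[OF sum[OF h(1)]])
      have tail_h: "(\<Sum>i. r (i + n) h * w (i + n)) \<le> (\<Sum>i. S (i + n))" for n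
        using r(2)[OF h(1)] S summable_ignore_initial_segment[OF sum[OF h(1)]]
        by (intro suminf_le) (simp_all add: summable_iff_shift)
      have tail_Suc: "S K + (\<Sum>i. S (i + Suc K)) = (\<Sum>i. S (i + K))"
        using suminf_split_head[of "\<lambda>i. S (i + K)"] S by (simp add: summable_iff_shift)
      have tail_n: "0 \<le> (\<Sum>i. S (i + Suc K))"
        using S tail_nonneg by (intro suminf_nonneg) (simp_all only: summable_iff_shift)
      let ?t = "norm (h - f)"
      show ?thesis
      \<comment> \<open>A displacement of at most 2^-K need not cause a jump at any controlled
        scale, but its q-th power is at most \<open>w K\<close> and hence at most
        \<open>\<delta> / 2\<close>. A larger one forces a jump at some scale
        \<open>m \<le> K\<close>.\<close>
      proof (cases "?t \<le> (1/2) ^ K")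
        case True
        have "r k h \<le> r k f" if "k < K" for k
          using jump[of k] that by (simp add: of_bool_def split: if_splits)
        then have "(\<Sum>k<K. r k h * w k) \<le> (\<Sum>k<K. r k f * w k)"
          using w by (intro sum_mono mult_right_mono) (auto simp: less_imp_le)
        then have "F h \<le> F f + \<delta> / 2" using split[of K] tail_h[of K] head tail by linarith
        moreover have "(1/2) powr q * ?t powr q \<le> \<delta> / 2"
        proof -
          have "?t powr q \<le> ((1/2) ^ K) powr q" using True q by (intro powr_mono2) auto
          also have "\<dots> = w K" by (simp add: w_def powr_realpow[symmetric] powr_powr)
          also have "\<dots> \<le> S K" by (rule wS)
          also have "\<dots> \<le> \<delta> / 2" using tail_Suc tail_n tail by linarith
          finally have "?t powr q \<le> \<delta> / 2" .
          moreover have "(1/2 :: real) powr q \<le> 1" using q by (intro powr_le1) auto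
          ultimately show ?thesis using mult_left_le_one_le[of "?t powr q" "(1/2) powr q"] by simp
        qed
        ultimately show ?thesis by linarith
      next
        case False
        define m where "m = (LEAST k. (1/2) ^ k < ?t)"
        have m: "(1/2) ^ m < ?t" unfolding m_def by (rule LeastI[of _ K]) (use False in simp)
        have mK: "m \<le> K" unfolding m_def by (rule Least_le) (use False in simp)
        have t: "?t \<le> 2 * (1/2) ^ m"
        proof (cases m)
          case 0
          \<comment> \<open>For \<open>m = 0\<close> there is no coarser scale to compare with; both
            points lie in the unit ball, so their distance is at most 2.\<close>
          have "?t \<le> norm h + norm f" by (rule norm_triangle_ineq4)
          then show ?thesis using 0 h(1) f by simp
        next
          case (Suc j)
          then have "\<not> (1/2) ^ j < ?t" using not_less_Least[of j "\<lambda>k. (1/2) ^ k < ?t"] m_def by simp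
          then show ?thesis using Suc by simp
        qed
        have "(1/2) powr q * ?t powr q = ((1/2) * ?t) powr q" by (subst powr_mult) auto
        also have "\<dots> \<le> ((1/2) ^ m) powr q" using t q by (intro powr_mono2) auto
        also have "\<dots> = w m" by (simp add: w_def powr_realpow[symmetric] powr_powr)
        finally have wm: "(1/2) powr q * ?t powr q \<le> w m" .
        have "r k h * w k + (if k = m then w m else 0) \<le> r k f * w k" if "k < Suc K" for k
        proof -
          have "(r k h + of_bool (k = m)) * w k \<le> r k f * w k"
            using jump[of k] that m w[of k] by (intro mult_right_mono) (auto simp: of_bool_def dist_norm split: if_splits)
          then show ?thesis by (simp add: of_bool_def distrib_right split: if_splits)
        qed
        then have "(\<Sum>k<Suc K. r k h * w k + (if k = m then w m else 0)) \<le> (\<Sum>k<Suc K. r k f * w k)"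
          by (intro sum_mono) simp
        moreover have "(\<Sum>k<Suc K. if k = m then w m else 0) = w m"
          using mK by (subst sum.delta) auto
        ultimately have "(\<Sum>k<Suc K. r k h * w k) + w m \<le> (\<Sum>k<Suc K. r k f * w k)"
          by (simp only: sum.distrib)
        moreover have "(\<Sum>i. S (i + Suc K)) \<le> \<delta>" using tail_Suc tail tail_nonneg[of K] \<delta> by linarith
        ultimately show ?thesis using split[of "Suc K"] tail_h[of "Suc K"] head' wm by linarith
      qed
    qed
    then show "\<exists>A e. finite A \<and> 0 < e \<and>
        (\<forall>h\<in>cball 0 1 \<inter> weak_star_nbhd A e f. F h + (1/2) powr q * norm (h - f) powr q \<le> F f + \<delta>)"
      using B(1,2) by blast
  qed
qed

text \<open>Displacements may vanish, so the endpoint 0 is included; there the claim reduces to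
  \<open>u powr q \<le> u\<close> for \<open>u\<close> in the unit interval.\<close>

lemma powr_convex_nonneg:
  fixes q x y :: real
  assumes "1 \<le> q" "0 \<le> x" "0 \<le> y" "0 \<le> u" "0 \<le> v" "u + v = 1"
  shows "(u * x + v * y) powr q \<le> u * x powr q + v * y powr q"
proof -
  have le: "(u * x) powr q \<le> u * x powr q" if "0 \<le> u" "u \<le> 1" for u x :: real
  proof (cases "u = 0")
    case False
    then have "u powr q \<le> u" using that assms(1) powr_mono'[of 1 q u] by simp
    then show ?thesis by (simp add: powr_mult mult_right_mono)
  qed simp
  show ?thesis
  proof (cases "x = 0 \<or> y = 0")
    case True
    then show ?thesis using le[of u x] le[of v y] assms by auto
  next
    case False
    then show ?thesis
      using powr_convex[OF assms(1)] assms unfolding convex_on_def by simp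
  qed
qed

lemma openin_weak_star_norm_greater:
  "openin weak_star_topology {h :: 'a::real_normed_vector \<Rightarrow>\<^sub>L real. r < norm (h - f)}"
proof (subst openin_subopen, intro ballI)
  fix z :: "'a \<Rightarrow>\<^sub>L real" assume "z \<in> {h. r < norm (h - f)}"
  then have "r < norm (z - f)" by simp
  then obtain a e where a: "0 < e" "\<And>h. h \<in> weak_star_nbhd {a} e (z - f) \<Longrightarrow> r < norm h"
    by (rule norm_weak_star_lsc) blast
  have "weak_star_nbhd {a} e z \<subseteq> {h. r < norm (h - f)}"
    using a(2) by (auto simp: weak_star_nbhd_def blinfun.diff_left)
  then show "\<exists>T. openin weak_star_topology T \<and> z \<in> T \<and> T \<subseteq> {h. r < norm (h - f)}"
    using openin_weak_star_nbhd[of "{a}" e z] self_in_weak_star_nbhd[OF a(1), of z "{a}"] by blast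
qed

text \<open>Total boundedness reduces uniformity over \<open>P\<close> to finitely many centres:
  \<open>\<eta> / 2\<close> is lost by semicontinuity at a centre and \<open>\<eta> / 4\<close>
  twice in moving between a point and its centre.\<close>

lemma norm_diff_compact_lsc:
  fixes P :: "('a::real_normed_vector \<Rightarrow>\<^sub>L real) set"
  assumes "compact P" "0 < \<eta>"
  obtains V where "openin weak_star_topology V" "f \<in> V"
    "\<And>h p. h \<in> V \<Longrightarrow> p \<in> P \<Longrightarrow> norm (f - p) - \<eta> \<le> norm (h - p)"
proof -
  have "\<exists>k. finite k \<and> P \<subseteq> (\<Union>p\<in>k. ball p (\<eta> / 4))"
    using compact_eq_totally_bounded[of P] assms by simp
  then obtain k where k: "finite k" "P \<subseteq> (\<Union>p\<in>k. ball p (\<eta> / 4))" by blast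
  define V where "V = (\<Inter>p\<in>k. {h. norm (f - p) - \<eta> / 2 < norm (h - p)})"
  show ?thesis
  proof (rule that)
    show "openin weak_star_topology V"
    proof (cases "k = {}")
      case True
      then show ?thesis using openin_topspace[of weak_star_topology] by (simp add: V_def)
    next
      case False
      then show ?thesis unfolding V_def by (rule openin_INT2[OF k(1) _ openin_weak_star_norm_greater])
    qed
    show "f \<in> V" using assms(2) by (simp add: V_def)
    fix h p assume hp: "h \<in> V" "p \<in> P"
    then obtain p' where p': "p' \<in> k" "dist p' p < \<eta> / 4" using k(2) by auto
    have "norm (f - p') - \<eta> / 2 < norm (h - p')" using hp(1) p'(1) by (simp add: V_def)
    moreover have "norm (f - p) \<le> norm (f - p') + norm (p' - p)"
      using norm_triangle_ineq[of "f - p'" "p' - p"] by simp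
    moreover have "norm (h - p') \<le> norm (h - p) + norm (p' - p)"
      using norm_triangle_ineq4[of "h - p" "p' - p"] by simp
    ultimately show "norm (f - p) - \<eta> \<le> norm (h - p)" using p'(2) by (simp add: dist_norm)
  qed
qed

text \<open>Every point \<open>z\<^sub>i\<close> of a convex combination is replaced by the centre \<open>y\<^sub>i\<close> of its member in a
  finite cover. The new combination lies in the hull of a finite set, which is norm compact, so the
  norm of the displacement is controlled from below near \<open>f\<close>.\<close>
lemma convex_hull_graph_near:
  fixes F :: "('a::real_normed_vector \<Rightarrow>\<^sub>L real) \<Rightarrow> real"
  assumes q: "1 \<le> q" and c: "0 < c" and \<tau>: "0 < \<tau>" and \<delta>: "0 < \<delta>"
    and near: "\<And>f \<delta>. f \<in> cball 0 1 \<Longrightarrow> 0 < \<delta> \<Longrightarrow> \<exists>A e. finite A \<and> 0 < e \<and>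
      (\<forall>h\<in>cball 0 1 \<inter> weak_star_nbhd A e f. F h + c * norm (h - f) powr q \<le> F f + \<delta>)"
    and A: "finite A" "0 < e"
    and r: "\<And>z s. (z, s) \<in> convex hull ((\<lambda>f. (f, F f)) ` cball 0 1) \<Longrightarrow> z \<in> weak_star_nbhd A e f \<Longrightarrow> s < r"
  obtains V where "openin weak_star_topology V" "f \<in> V"
    "\<And>z s. (z, s) \<in> convex hull ((\<lambda>f. (f, F f)) ` cball 0 1) \<Longrightarrow> z \<in> V \<Longrightarrow> \<tau> \<le> norm (z - f) \<Longrightarrow>
       s + c * (\<tau> / 4) powr q \<le> r + \<delta>"
proof -
  let ?\<Gamma> = "\<lambda>f. (f, F f)"
  \<comment> \<open>Besides the drop of \<open>F\<close>, moving to the centre must change the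
    evaluations on \<open>A\<close> by less than \<open>e / 2\<close>, so that the hypothesis on
    \<open>r\<close> still applies after the replacement.\<close>
  have "\<exists>A' e'. finite A' \<and> 0 < e' \<and> (\<forall>h\<in>cball 0 1 \<inter> weak_star_nbhd A' e' y.
      F h + c * norm (h - y) powr q \<le> F y + \<delta> \<and> h \<in> weak_star_nbhd A (e / 2) y)"
    if y: "y \<in> cball 0 1" for y
  proof -
    obtain A1 e1 where 1: "finite A1" "0 < e1" "\<forall>h\<in>cball 0 1 \<inter> weak_star_nbhd A1 e1 y.
        F h + c * norm (h - y) powr q \<le> F y + \<delta>" using near[OF y \<delta>] by blast
    obtain A2 e2 where "finite A2" "0 < e2"
        "weak_star_nbhd A2 e2 y \<subseteq> weak_star_nbhd A1 e1 y \<inter> weak_star_nbhd A (e / 2) y"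
      using weak_star_nbhd_inter[OF 1(1) A(1) 1(2) half_gt_zero[OF A(2)]] by blast
    then show ?thesis using 1(3) by blast
  qed
  then obtain A' :: "('a \<Rightarrow>\<^sub>L real) \<Rightarrow> 'a set" and e' :: "('a \<Rightarrow>\<^sub>L real) \<Rightarrow> real" where
    A': "\<And>y. y \<in> cball 0 1 \<Longrightarrow> finite (A' y)" "\<And>y. y \<in> cball 0 1 \<Longrightarrow> 0 < e' y"
      "\<And>y h. y \<in> cball 0 1 \<Longrightarrow> h \<in> cball 0 1 \<inter> weak_star_nbhd (A' y) (e' y) y \<Longrightarrow>
        F h + c * norm (h - y) powr q \<le> F y + \<delta> \<and> h \<in> weak_star_nbhd A (e / 2) y"
    by metis
  obtain Y where Y: "finite Y" "Y \<subseteq> cball 0 1" "cball 0 1 \<subseteq> (\<Union>y\<in>Y. weak_star_nbhd (A' y) (e' y) y)"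
    using cball_weak_star_finite_cover[of A' e'] A'(1,2) by blast
  define HY where "HY = convex hull (?\<Gamma> ` Y)"
  \<comment> \<open>\<open>T\<close> collects the pairs that admit a replacement from the hull of
    the centres. Convexity of \<open>T\<close> is where convexity of the q-th power enters; since
    \<open>T\<close> contains the graph, it contains the hull, and no explicit convex combination is
    handled.\<close>
  define T where "T = {(z, s). \<exists>(z', s')\<in>HY. (\<forall>a\<in>A. \<bar>blinfun_apply z a - blinfun_apply z' a\<bar> < e / 2) \<and>
      s + c * norm (z - z') powr q \<le> s' + \<delta>}"
  have HY: "convex HY" "HY \<subseteq> convex hull (?\<Gamma> ` cball 0 1)" "compact (fst ` HY)"
    unfolding HY_def using Y(1,2)
    by (auto intro!: hull_mono compact_continuous_image finite_imp_compact_convex_hull continuous_on_fst continuous_on_id)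
  have "convex T"
  proof (rule convexI)
    fix a b and u v :: real assume ab: "a \<in> T" "b \<in> T" and uv: "0 \<le> u" "0 \<le> v" "u + v = 1"
    obtain z1 s1 z1' s1' where 1: "a = (z1, s1)" "(z1', s1') \<in> HY" "\<forall>a\<in>A. \<bar>z1 a - z1' a\<bar> < e / 2"
        "s1 + c * norm (z1 - z1') powr q \<le> s1' + \<delta>" using ab(1) unfolding T_def by auto
    obtain z2 s2 z2' s2' where 2: "b = (z2, s2)" "(z2', s2') \<in> HY" "\<forall>a\<in>A. \<bar>z2 a - z2' a\<bar> < e / 2"
        "s2 + c * norm (z2 - z2') powr q \<le> s2' + \<delta>" using ab(2) unfolding T_def by auto
    have "u *\<^sub>R (z1', s1') + v *\<^sub>R (z2', s2') \<in> HY"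
      using convexD[OF HY(1) 1(2) 2(2) uv] .
    then have in_HY: "(u *\<^sub>R z1' + v *\<^sub>R z2', u * s1' + v * s2') \<in> HY" by simp
    have "\<bar>(u *\<^sub>R z1 + v *\<^sub>R z2) a - (u *\<^sub>R z1' + v *\<^sub>R z2') a\<bar> < e / 2" if "a \<in> A" for a
    proof -
      have "\<bar>(u *\<^sub>R z1 + v *\<^sub>R z2) a - (u *\<^sub>R z1' + v *\<^sub>R z2') a\<bar> = \<bar>u * (z1 a - z1' a) + v * (z2 a - z2' a)\<bar>"
        by (simp add: blinfun.add_left blinfun.scaleR_left algebra_simps)
      also have "\<dots> \<le> u * \<bar>z1 a - z1' a\<bar> + v * \<bar>z2 a - z2' a\<bar>"
        using uv by (intro order_trans[OF abs_triangle_ineq]) (simp add: abs_mult)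
      also have "\<dots> < e / 2" using 1(3) 2(3) that uv by (intro convex_bound_lt) auto
      finally show ?thesis .
    qed
    moreover have "(u * s1 + v * s2) + c * norm ((u *\<^sub>R z1 + v *\<^sub>R z2) - (u *\<^sub>R z1' + v *\<^sub>R z2')) powr q
        \<le> (u * s1' + v * s2') + \<delta>"
    proof -
      have "(u *\<^sub>R z1 + v *\<^sub>R z2) - (u *\<^sub>R z1' + v *\<^sub>R z2') = u *\<^sub>R (z1 - z1') + v *\<^sub>R (z2 - z2')"
        by (simp add: algebra_simps)
      then have "norm ((u *\<^sub>R z1 + v *\<^sub>R z2) - (u *\<^sub>R z1' + v *\<^sub>R z2')) \<le> u * norm (z1 - z1') + v * norm (z2 - z2')"
        using norm_triangle_ineq[of "u *\<^sub>R (z1 - z1')" "v *\<^sub>R (z2 - z2')"] uv by simp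
      then have "norm ((u *\<^sub>R z1 + v *\<^sub>R z2) - (u *\<^sub>R z1' + v *\<^sub>R z2')) powr q \<le> (u * norm (z1 - z1') + v * norm (z2 - z2')) powr q"
        using q by (intro powr_mono2) auto
      also have "\<dots> \<le> u * norm (z1 - z1') powr q + v * norm (z2 - z2') powr q"
        using q uv by (intro powr_convex_nonneg) auto
      finally have "c * norm ((u *\<^sub>R z1 + v *\<^sub>R z2) - (u *\<^sub>R z1' + v *\<^sub>R z2')) powr q \<le>
          c * (u * norm (z1 - z1') powr q + v * norm (z2 - z2') powr q)"
        using c by (intro mult_left_mono) auto
      moreover have "u * (s1 + c * norm (z1 - z1') powr q) + v * (s2 + c * norm (z2 - z2') powr q)
          \<le> u * (s1' + \<delta>) + v * (s2' + \<delta>)"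
        by (intro add_mono mult_left_mono 1(4) 2(4) uv(1,2))
      moreover have "u * (s1' + \<delta>) + v * (s2' + \<delta>) = u * s1' + v * s2' + \<delta>"
        using uv(3) by (simp add: distrib_left flip: distrib_right)
      ultimately show ?thesis by (simp add: algebra_simps)
    qed
    ultimately show "u *\<^sub>R a + v *\<^sub>R b \<in> T"
      using in_HY unfolding T_def 1(1) 2(1) by (force simp del: blinfun.add_left)
  qed
  moreover have "?\<Gamma> ` cball 0 1 \<subseteq> T"
  proof (rule image_subsetI)
    fix h :: "'a \<Rightarrow>\<^sub>L real" assume h: "h \<in> cball 0 1"
    then obtain y where y: "y \<in> Y" "h \<in> weak_star_nbhd (A' y) (e' y) y" using Y(3) by blast
    then have "F h + c * norm (h - y) powr q \<le> F y + \<delta> \<and> h \<in> weak_star_nbhd A (e / 2) y"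
      using A'(3) Y(2) h by blast
    moreover have "(y, F y) \<in> HY" unfolding HY_def using y(1) by (intro hull_inc) blast
    ultimately show "(h, F h) \<in> T" unfolding T_def weak_star_nbhd_def by blast
  qed
  ultimately have hull_T: "convex hull (?\<Gamma> ` cball 0 1) \<subseteq> T" by (simp add: hull_minimal)
  obtain V where V: "openin weak_star_topology V" "f \<in> V"
      "\<And>h p. h \<in> V \<Longrightarrow> p \<in> fst ` HY \<Longrightarrow> norm (f - p) - \<tau> / 2 \<le> norm (h - p)"
    using norm_diff_compact_lsc[OF HY(3), of "\<tau> / 2" f] \<tau> by auto
  show ?thesis
  proof (rule that)
    show "openin weak_star_topology (V \<inter> weak_star_nbhd A (e / 2) f)"
      using V(1) openin_weak_star_nbhd[OF A(1)] by blast
    show "f \<in> V \<inter> weak_star_nbhd A (e / 2) f"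
      using V(2) self_in_weak_star_nbhd A(2) by (metis IntI half_gt_zero)
    fix z s assume zs: "(z, s) \<in> convex hull (?\<Gamma> ` cball 0 1)"
      and z: "z \<in> V \<inter> weak_star_nbhd A (e / 2) f" and "\<tau> \<le> norm (z - f)"
    obtain z' s' where z': "(z', s') \<in> HY" "\<forall>a\<in>A. \<bar>z a - z' a\<bar> < e / 2"
        "s + c * norm (z - z') powr q \<le> s' + \<delta>"
      using zs hull_T unfolding T_def by blast
    have "\<bar>z' a - f a\<bar> < e" if "a \<in> A" for a
    proof -
      have "\<bar>z a - z' a\<bar> < e / 2" "\<bar>z a - f a\<bar> < e / 2"
        using z'(2) z that by (auto simp: weak_star_nbhd_def)
      then show ?thesis by linarith
    qed
    then have "z' \<in> weak_star_nbhd A e f" by (simp add: weak_star_nbhd_def)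
    moreover have "(z', s') \<in> convex hull (?\<Gamma> ` cball 0 1)" using z'(1) HY(2) by blast
    ultimately have "s' < r" using r by blast
    have "z' \<in> fst ` HY" using z'(1) by force
    then have "norm (f - z') - \<tau> / 2 \<le> norm (z - z')" using V(3) z by blast
    moreover have "norm (z - f) \<le> norm (z - z') + norm (f - z')"
      using norm_triangle_ineq4[of "z - z'" "f - z'"] by simp
    \<comment> \<open>The two inequalities give
      \<open>\<tau> \<le> 2 * norm (z - z') + \<tau> / 2\<close>.\<close>
    ultimately have "\<tau> / 4 \<le> norm (z - z')" using \<open>\<tau> \<le> norm (z - f)\<close> by linarith
    then have "c * (\<tau> / 4) powr q \<le> c * norm (z - z') powr q"
      using c q \<tau> by (intro mult_left_mono powr_mono2) auto
    then show "s + c * (\<tau> / 4) powr q \<le> r + \<delta>" using z'(3) \<open>s' < r\<close> by linarith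
  qed
qed

text \<open>\<open>G\<close> is the upper boundary of the weak* closure of the convex hull of the
  graph of \<open>F\<close>. Semicontinuity comes from the closure, concavity and evenness from the
  hull, and the drop from \<open>convex_hull_graph_near\<close>.\<close>

lemma ex_concave_envelope:
  fixes F :: "('a::real_normed_vector \<Rightarrow>\<^sub>L real) \<Rightarrow> real"
  assumes q: "1 \<le> q" and c: "0 < c"
    and bounds: "\<And>f. f \<in> cball 0 1 \<Longrightarrow> 0 \<le> F f \<and> F f \<le> M"
    and even: "\<And>f. F (- f) = F f"
    and near: "\<And>f \<delta>. f \<in> cball 0 1 \<Longrightarrow> 0 < \<delta> \<Longrightarrow> \<exists>A e. finite A \<and> 0 < e \<and>
      (\<forall>h\<in>cball 0 1 \<inter> weak_star_nbhd A e f. F h + c * norm (h - f) powr q \<le> F f + \<delta>)"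
  obtains G :: "('a \<Rightarrow>\<^sub>L real) \<Rightarrow> real" where
    "\<And>f. f \<in> cball 0 1 \<Longrightarrow> 0 \<le> G f \<and> G f \<le> M"
    "\<And>f. f \<in> cball 0 1 \<Longrightarrow> G (- f) = G f"
    "\<And>f h u v. f \<in> cball 0 1 \<Longrightarrow> h \<in> cball 0 1 \<Longrightarrow> 0 \<le> u \<Longrightarrow> 0 \<le> v \<Longrightarrow> u + v = 1 \<Longrightarrow>
      u * G f + v * G h \<le> G (u *\<^sub>R f + v *\<^sub>R h)"
    "\<And>f s. f \<in> cball 0 1 \<Longrightarrow> G f < s \<Longrightarrow>
      \<exists>V. openin weak_star_topology V \<and> f \<in> V \<and> (\<forall>h\<in>cball 0 1 \<inter> V. G h < s)"
    "\<And>f \<tau> \<delta>. f \<in> cball 0 1 \<Longrightarrow> 0 < \<tau> \<Longrightarrow> 0 < \<delta> \<Longrightarrow>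
      \<exists>V. openin weak_star_topology V \<and> f \<in> V \<and>
        (\<forall>h\<in>cball 0 1 \<inter> V. \<tau> \<le> norm (h - f) \<longrightarrow> G h + c * (\<tau> / 8) powr q \<le> G f + \<delta>)"
proof -
  define C where "C = convex hull ((\<lambda>f. (f, F f)) ` cball 0 1)"
  \<comment> \<open>\<open>H f s\<close> says that hull points over weak* neighbours of
    \<open>f\<close> reach height \<open>s\<close> up to any error. Only heights from below are
    tested, so the hull of the graph suffices in place of that of the hypograph.\<close>
  define H where "H f s \<longleftrightarrow> (\<forall>A e. finite A \<longrightarrow> 0 < e \<longrightarrow> (\<exists>(z, t)\<in>C. z \<in> weak_star_nbhd A e f \<and> s - e < t))" for f s
  define G where "G f = Sup {s. H f s}" for f
  have "convex C" by (simp add: C_def)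
  have C_sub: "C \<subseteq> cball 0 1 \<times> {0..M}"
    unfolding C_def using bounds
    by (intro hull_minimal convex_Times convex_cball convex_closed_interval) (auto simp del: mem_cball_0)
  have H_ex: "\<exists>z t. (z, t) \<in> C \<and> z \<in> weak_star_nbhd A e f \<and> s - e < t"
    if "H f s" "finite A" "0 < e" for f s A e
    using that unfolding H_def by blast
  have H_le: "s \<le> M" if H: "H f s" for f s
  proof (rule ccontr)
    assume "\<not> s \<le> M"
    then obtain z t where "(z, t) \<in> C" "s - (s - M) < t"
      using H_ex[OF H, of "{}" "s - M"] by auto
    then show False using C_sub by auto
  qed
  have C_H: "H z s" if "(z, s) \<in> C" for z s
    unfolding H_def using that self_in_weak_star_nbhd by force
  have F_H: "H f (F f)" if "f \<in> cball 0 1" for f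
    using that by (intro C_H) (auto simp: C_def intro!: hull_inc)
  have bdd: "bdd_above {s. H f s}" for f using H_le by (auto simp: bdd_above_def)
  \<comment> \<open>The supremum is itself admissible: half of the tolerance is spent on approaching
    \<open>G f\<close> and half on the hull point.\<close>
  have H_G: "H f (G f)" if f: "f \<in> cball 0 1" for f
    unfolding H_def
  proof (intro allI impI)
    fix A :: "'a set" and e :: real assume A: "finite A" "0 < e"
    have "G f - e / 2 < G f" using A(2) by simp
    then obtain s where s: "H f s" "G f - e / 2 < s"
      using less_cSup_iff[OF _ bdd, of f] F_H[OF f] unfolding G_def by blast
    obtain z t where z: "(z, t) \<in> C" "z \<in> weak_star_nbhd A (e / 2) f" "s - e / 2 < t"
      using H_ex[OF s(1) A(1) half_gt_zero[OF A(2)]] by blast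
    have "z \<in> weak_star_nbhd A e f" using z(2) A(2) by (force simp: weak_star_nbhd_def)
    moreover have "G f - e < t" using z(3) s(2) by simp
    ultimately show "\<exists>(z, t)\<in>C. z \<in> weak_star_nbhd A e f \<and> G f - e < t" using z(1) by blast
  qed
  have G_ge: "s \<le> G f" if "H f s" for f s
    unfolding G_def using that bdd by (intro cSup_upper) auto
  \<comment> \<open>Conversely to \<open>G_less\<close>, a bound for the hull over an open set
    passes to \<open>G\<close> on that set; all local estimates of \<open>G\<close> are obtained by
    this pair.\<close>
  have G_le: "G h \<le> r" if O: "openin weak_star_topology V" "h \<in> V" "h \<in> cball 0 1"
      "\<And>z t. (z, t) \<in> C \<Longrightarrow> z \<in> V \<Longrightarrow> t \<le> r" for V h r
  proof (rule ccontr)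
    assume "\<not> G h \<le> r"
    then have pos: "0 < G h - r" by simp
    obtain A e where A: "finite A" "0 < e" "weak_star_nbhd A e h \<subseteq> V"
      using weak_star_nbhd_subset_open[OF O(1,2)] .
    obtain z t where z: "(z, t) \<in> C" "z \<in> weak_star_nbhd A (min e (G h - r)) h" "G h - min e (G h - r) < t"
      using H_ex[OF H_G[OF O(3)] A(1), of "min e (G h - r)"] A(2) pos by auto
    have "z \<in> weak_star_nbhd A e h" using z(2) by (simp add: weak_star_nbhd_def)
    then have "t \<le> r" using O(4) z(1) A(3) by blast
    then show False using z(3) by linarith
  qed
  have G_less: "\<exists>A e. finite A \<and> 0 < e \<and> (\<forall>z t. (z, t) \<in> C \<longrightarrow> z \<in> weak_star_nbhd A e f \<longrightarrow> t < s)"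
    if f: "f \<in> cball 0 1" "G f < s" for f s
  proof -
    define r where "r = (G f + s) / 2"
    have r: "G f < r" "r < s" using f(2) by (simp_all add: r_def)
    have "\<not> H f r" using G_ge r(1) by (meson not_le)
    then obtain A e where A: "finite A" "0 < e" "\<And>z t. (z, t) \<in> C \<Longrightarrow> z \<in> weak_star_nbhd A e f \<Longrightarrow> t \<le> r - e"
      unfolding H_def by (force simp: not_less)
    then show ?thesis using r(2) by (intro exI[of _ A] exI[of _ e]) fastforce
  qed
  show ?thesis
  proof (rule that)
    fix f :: "'a \<Rightarrow>\<^sub>L real" assume f: "f \<in> cball 0 1"
    show "0 \<le> G f \<and> G f \<le> M"
      using bounds[OF f] G_ge[OF F_H[OF f]] H_le[OF H_G[OF f]] by linarith
  next
    \<comment> \<open>The reflection in the first coordinate is linear and preserves the graph of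
      the even function \<open>F\<close>, hence also its hull.\<close>
    have "C \<subseteq> {(z, s). (- z, s) \<in> C}"
      unfolding C_def
    proof (rule hull_minimal)
      show "(\<lambda>f. (f, F f)) ` cball 0 1 \<subseteq> {(z, s). (- z, s) \<in> convex hull ((\<lambda>f. (f, F f)) ` cball 0 1)}"
      proof clarify
        fix f :: "'a \<Rightarrow>\<^sub>L real" assume "f \<in> cball 0 1"
        then have "(- f, F (- f)) \<in> (\<lambda>f. (f, F f)) ` cball 0 1" by (intro imageI) simp
        then show "(- f, F f) \<in> convex hull ((\<lambda>f. (f, F f)) ` cball 0 1)" unfolding even by (rule hull_inc)
      qed
      have "linear (\<lambda>(z, s). (- z, s) :: ('a \<Rightarrow>\<^sub>L real) \<times> real)"
        by (intro linearI) auto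
      then have "convex ((\<lambda>(z, s). (- z, s)) -` (convex hull ((\<lambda>f. (f, F f)) ` cball 0 1)))"
        by (intro convex_linear_vimage) simp_all
      then show "convex {(z, s). (- z, s) \<in> convex hull ((\<lambda>f. (f, F f)) ` cball 0 1)}"
        by (simp add: vimage_def case_prod_unfold)
    qed
    then have neg: "(- z, s) \<in> C" if "(z, s) \<in> C" for z s using that by auto
    have H_neg: "H (- f) s" if H: "H f s" for f s
      unfolding H_def
    proof (intro allI impI)
      fix A :: "'a set" and e :: real assume A: "finite A" "0 < e"
      then obtain z t where z: "(z, t) \<in> C" "z \<in> weak_star_nbhd A e f" "s - e < t"
        using H_ex[OF H] by blast
      have "- z \<in> weak_star_nbhd A e (- f)"
        using z(2) by (simp add: weak_star_nbhd_def blinfun.minus_left abs_minus_commute)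
      then show "\<exists>(z, t)\<in>C. z \<in> weak_star_nbhd A e (- f) \<and> s - e < t" using neg[OF z(1)] z(3) by blast
    qed
    fix f :: "'a \<Rightarrow>\<^sub>L real" assume f: "f \<in> cball 0 1"
    show "G (- f) = G f"
      using G_ge[OF H_neg[OF H_G[OF f]]] G_ge[OF H_neg[OF H_G[of "- f"]]] f by simp
  next
    fix f h :: "'a \<Rightarrow>\<^sub>L real" and u v :: real
    assume f: "f \<in> cball 0 1" and h: "h \<in> cball 0 1" and uv: "0 \<le> u" "0 \<le> v" "u + v = 1"
    have "H (u *\<^sub>R f + v *\<^sub>R h) (u * G f + v * G h)"
      unfolding H_def
    proof (intro allI impI)
      fix A :: "'a set" and e :: real assume A: "finite A" "0 < e"
      then obtain z1 t1 where 1: "(z1, t1) \<in> C" "z1 \<in> weak_star_nbhd A e f" "G f - e < t1"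
        using H_ex[OF H_G[OF f]] by blast
      obtain z2 t2 where 2: "(z2, t2) \<in> C" "z2 \<in> weak_star_nbhd A e h" "G h - e < t2"
        using A H_ex[OF H_G[OF h]] by blast
      have "u *\<^sub>R (z1, t1) + v *\<^sub>R (z2, t2) \<in> C"
        using convexD[OF \<open>convex C\<close> 1(1) 2(1) uv] .
      then have "(u *\<^sub>R z1 + v *\<^sub>R z2, u * t1 + v * t2) \<in> C" by simp
      moreover have "u *\<^sub>R z1 + v *\<^sub>R z2 \<in> weak_star_nbhd A e (u *\<^sub>R f + v *\<^sub>R h)"
        unfolding weak_star_nbhd_def
      proof (intro CollectI ballI)
        fix a assume a: "a \<in> A"
        have "\<bar>(u *\<^sub>R z1 + v *\<^sub>R z2) a - (u *\<^sub>R f + v *\<^sub>R h) a\<bar> = \<bar>u * (z1 a - f a) + v * (z2 a - h a)\<bar>"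
          by (simp add: blinfun.add_left blinfun.scaleR_left algebra_simps)
        also have "\<dots> \<le> u * \<bar>z1 a - f a\<bar> + v * \<bar>z2 a - h a\<bar>"
          using uv by (intro order_trans[OF abs_triangle_ineq]) (simp add: abs_mult)
        also have "\<dots> < e" using 1(2) 2(2) a uv by (intro convex_bound_lt) (auto simp: weak_star_nbhd_def)
        finally show "\<bar>(u *\<^sub>R z1 + v *\<^sub>R z2) a - (u *\<^sub>R f + v *\<^sub>R h) a\<bar> < e" .
      qed
      moreover have "u * G f + v * G h - e < u * t1 + v * t2"
      proof -
        have "u * (G f - t1) + v * (G h - t2) < e"
          using 1(3) 2(3) uv by (intro convex_bound_lt) auto
        then show ?thesis by (simp add: algebra_simps)
      qed
      ultimately show "\<exists>(z, t)\<in>C. z \<in> weak_star_nbhd A e (u *\<^sub>R f + v *\<^sub>R h) \<and> u * G f + v * G h - e < t"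
        by blast
    qed
    then show "u * G f + v * G h \<le> G (u *\<^sub>R f + v *\<^sub>R h)" by (rule G_ge)
  next
    fix f :: "'a \<Rightarrow>\<^sub>L real" and s assume f: "f \<in> cball 0 1" "G f < s"
    obtain r where r: "G f < r" "r < s" using dense[OF f(2)] by blast
    obtain A e where A: "finite A" "0 < e" "\<And>z t. (z, t) \<in> C \<Longrightarrow> z \<in> weak_star_nbhd A e f \<Longrightarrow> t < r"
      using G_less[OF f(1) r(1)] by blast
    have "G h < s" if h: "h \<in> cball 0 1 \<inter> weak_star_nbhd A e f" for h
    proof -
      have "G h \<le> r"
        using h A(3) by (intro G_le[OF openin_weak_star_nbhd[OF A(1), of e f]]) (auto intro: less_imp_le)
      then show ?thesis using r(2) by simp
    qed
    then show "\<exists>V. openin weak_star_topology V \<and> f \<in> V \<and> (\<forall>h\<in>cball 0 1 \<inter> V. G h < s)"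
      using openin_weak_star_nbhd[OF A(1)] self_in_weak_star_nbhd[OF A(2)]
      by (intro exI[of _ "weak_star_nbhd A e f"]) simp
  next
    fix f :: "'a \<Rightarrow>\<^sub>L real" and \<tau> \<delta> :: real
    assume f: "f \<in> cball 0 1" and \<tau>: "0 < \<tau>" and \<delta>: "0 < \<delta>"
    have "G f < G f + \<delta> / 2" using \<delta> by simp
    then obtain A e where A: "finite A" "0 < e"
        "\<And>z t. (z, t) \<in> C \<Longrightarrow> z \<in> weak_star_nbhd A e f \<Longrightarrow> t < G f + \<delta> / 2"
      using G_less[OF f] by blast
    obtain V where V: "openin weak_star_topology V" "f \<in> V"
        "\<And>z t. (z, t) \<in> C \<Longrightarrow> z \<in> V \<Longrightarrow> \<tau> / 2 \<le> norm (z - f) \<Longrightarrow>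
          t + c * (\<tau> / 2 / 4) powr q \<le> (G f + \<delta> / 2) + \<delta> / 2"
      using convex_hull_graph_near[OF q c half_gt_zero[OF \<tau>] half_gt_zero[OF \<delta>] near A(1,2), of f "G f + \<delta> / 2"]
        A(3) unfolding C_def by blast
    have "G h + c * (\<tau> / 8) powr q \<le> G f + \<delta>"
      if h: "h \<in> cball 0 1 \<inter> V" "\<tau> \<le> norm (h - f)" for h
    proof -
      have "G h \<le> G f + \<delta> - c * (\<tau> / 8) powr q"
      proof (rule G_le)
        \<comment> \<open>Hull points approximate \<open>h\<close> only weak*, so norm distance
          \<open>\<tau>\<close> from \<open>f\<close> is not inherited, but distance greater than
          \<open>\<tau> / 2\<close> is a weak* open condition.\<close>
        show "openin weak_star_topology (V \<inter> {h. \<tau> / 2 < norm (h - f)})"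
          using V(1) openin_weak_star_norm_greater by blast
        show "h \<in> V \<inter> {h. \<tau> / 2 < norm (h - f)}" "h \<in> cball 0 1" using h \<tau> by auto
        fix z t assume "(z, t) \<in> C" "z \<in> V \<inter> {h. \<tau> / 2 < norm (h - f)}"
        then show "t \<le> G f + \<delta> - c * (\<tau> / 8) powr q" using V(3)[of z t] by simp
      qed
      then show ?thesis by simp
    qed
    then show "\<exists>V. openin weak_star_topology V \<and> f \<in> V \<and>
        (\<forall>h\<in>cball 0 1 \<inter> V. \<tau> \<le> norm (h - f) \<longrightarrow> G h + c * (\<tau> / 8) powr q \<le> G f + \<delta>)"
      using V(1,2) by blast
  qed
qed

section \<open>The Hahn-Banach theorem and polarity\<close>

definition sublinear :: "('a::real_vector \<Rightarrow> real) \<Rightarrow> bool" where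
  "sublinear p \<longleftrightarrow> p 0 = 0 \<and> (\<forall>x y. p (x + y) \<le> p x + p y) \<and> (\<forall>c>0. \<forall>x. p (c *\<^sub>R x) \<le> c * p x)"

lemma sublinear_minus_le: "sublinear p \<Longrightarrow> - p (- x) \<le> p x"
  unfolding sublinear_def by (metis add.right_inverse add.commute neg_le_iff_le add_le_cancel_right add_uminus_conv_diff diff_0 diff_le_eq)

lemma sublinear_scale:
  assumes "sublinear p" "0 < c"
  shows "p (c *\<^sub>R x) = c * p x"
proof (rule antisym)
  have "p (inverse c *\<^sub>R (c *\<^sub>R x)) \<le> inverse c * p (c *\<^sub>R x)"
    using assms unfolding sublinear_def by (meson inverse_positive_iff_positive)
  then show "c * p x \<le> p (c *\<^sub>R x)" using assms(2) by (simp add: field_simps)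
qed (use assms in \<open>simp add: sublinear_def\<close>)

text \<open>The candidate is the infimum over \<open>t \<ge> 0\<close> of
  \<open>p (x + t *\<^sub>R v) - t * p v\<close>: \<open>t = 0\<close> keeps it below
  \<open>p\<close>, and \<open>t = 1\<close> gives the value at \<open>- v\<close>. The same device
  yields linearity of minimal functionals and norming functionals.\<close>

lemma sublinear_lower_along:
  assumes p: "sublinear p"
  obtains p' where "sublinear p'" "\<And>x. p' x \<le> p x" "p' (- v) \<le> - p v"
proof -
  define p' where "p' x = (INF t\<in>{0..}. p (x + t *\<^sub>R v) - t * p v)" for x
  have tv: "p (t *\<^sub>R v) = t * p v" if "0 \<le> t" for t
    using that sublinear_scale[OF p, of t v] p by (cases "t = 0") (auto simp: sublinear_def)
  have lower: "- p (- x) \<le> p (x + t *\<^sub>R v) - t * p v" if "0 \<le> t" for x t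
  proof -
    have "p ((x + t *\<^sub>R v) + - x) \<le> p (x + t *\<^sub>R v) + p (- x)"
      using p unfolding sublinear_def by blast
    then show ?thesis using tv[OF that] by simp
  qed
  have le: "p' x \<le> p (x + t *\<^sub>R v) - t * p v" if "0 \<le> t" for x t
    unfolding p'_def using that lower by (intro cINF_lower bdd_belowI2[of _ "- p (- x)"]) auto
  have ge: "r \<le> p' x" if "\<And>t. 0 \<le> t \<Longrightarrow> r \<le> p (x + t *\<^sub>R v) - t * p v" for r x
    unfolding p'_def using that by (intro cINF_greatest) auto
  show ?thesis
  proof (rule that)
    show "p' x \<le> p x" for x using le[of 0 x] by simp
    show "p' (- v) \<le> - p v" using le[of 1 "- v"] p by (simp add: sublinear_def)
    show "sublinear p'"
      unfolding sublinear_def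
    proof (intro conjI allI impI)
      show "p' 0 = 0"
        using le[of 0 0] ge[of 0 0] lower[of _ 0] p by (simp add: sublinear_def)
      fix x y
      have "p' (x + y) - (p (x + s *\<^sub>R v) - s * p v) \<le> p' y" if s: "0 \<le> s" for s
      proof (rule ge)
        fix t :: real assume t: "0 \<le> t"
        have "p' (x + y) \<le> p ((x + y) + (s + t) *\<^sub>R v) - (s + t) * p v" using s t by (intro le) simp
        also have "(x + y) + (s + t) *\<^sub>R v = (x + s *\<^sub>R v) + (y + t *\<^sub>R v)" by (simp add: algebra_simps)
        finally show "p' (x + y) - (p (x + s *\<^sub>R v) - s * p v) \<le> p (y + t *\<^sub>R v) - t * p v"
          using p unfolding sublinear_def by (smt (verit) distrib_right)
      qed
      then have "p' (x + y) - p' y \<le> p' x" by (intro ge) (simp add: algebra_simps)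
      then show "p' (x + y) \<le> p' x + p' y" by simp
    next
      fix c :: real and x assume c: "0 < c"
      have "p' (c *\<^sub>R x) / c \<le> p' x"
      proof (rule ge)
        fix t :: real assume t: "0 \<le> t"
        have "p' (c *\<^sub>R x) \<le> p (c *\<^sub>R x + (c * t) *\<^sub>R v) - c * t * p v" using c t by (intro le) simp
        also have "c *\<^sub>R x + (c * t) *\<^sub>R v = c *\<^sub>R (x + t *\<^sub>R v)" by (simp add: scaleR_add_right)
        also have "p (c *\<^sub>R (x + t *\<^sub>R v)) = c * p (x + t *\<^sub>R v)" by (rule sublinear_scale[OF p c])
        finally show "p' (c *\<^sub>R x) / c \<le> p (x + t *\<^sub>R v) - t * p v" using c by (simp add: field_simps)
      qed
      then show "p' (c *\<^sub>R x) \<le> c * p' x" using c by (simp add: field_simps)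
    qed
  qed
qed

text \<open>A minimal sublinear functional is linear, so that the Hahn-Banach theorem is Zorn's lemma
  for the pointwise order on sublinear functionals.\<close>
lemma ex_linear_below_sublinear:
  assumes p: "sublinear p"
  obtains f where "linear f" "\<And>x. f x \<le> p x"
proof -
  define S where "S = {m. sublinear m \<and> (\<forall>x. m x \<le> p x)}"
  \<comment> \<open>The order is reversed, so that a maximal element in Zorn's lemma is a minimal
    functional.\<close>
  define P where "P = (\<lambda>m m' :: 'a \<Rightarrow> real. \<forall>x. m' x \<le> m x)"
  have "\<exists>m\<in>S. \<forall>a\<in>S. P m a \<longrightarrow> a = m"
  proof (rule predicate_Zorn)
    show "partial_order_on S (relation_of P S)"
      by (rule partial_order_on_relation_ofI) (auto simp: P_def fun_eq_iff intro: order_trans antisym)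
    fix C assume C: "C \<in> Chains (relation_of P S)"
    have CS: "C \<subseteq> S" and chain: "\<And>a b. a \<in> C \<Longrightarrow> b \<in> C \<Longrightarrow> P a b \<or> P b a"
      using C unfolding Chains_def relation_of_def by auto
    show "\<exists>u\<in>S. \<forall>a\<in>C. P a u"
    proof (cases "C = {}")
      case True
      then show ?thesis using p by (auto simp: S_def)
    next
      case False
      define u where "u x = (INF m\<in>C. m x)" for x
      \<comment> \<open>A lower bound common to all members, from
        \<open>- p (- x) \<le> - m (- x) \<le> m x\<close>; it keeps the infimum over the chain
        finite.\<close>
      have lower: "- p (- x) \<le> m x" if "m \<in> C" for m x
        using that CS sublinear_minus_le[of m x] unfolding S_def by (smt (verit) mem_Collect_eq subsetD)
      have le: "u x \<le> m x" if "m \<in> C" for m x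
        unfolding u_def using that lower by (intro cINF_lower bdd_belowI2[of _ "- p (- x)"]) auto
      have ge: "r \<le> u x" if "\<And>m. m \<in> C \<Longrightarrow> r \<le> m x" for r x
        unfolding u_def using that False by (intro cINF_greatest) auto
      have sub: "sublinear m" if "m \<in> C" for m using that CS by (auto simp: S_def)
      obtain m0 where m0: "m0 \<in> C" using False by blast
      have "sublinear u"
        unfolding sublinear_def
      proof (intro conjI allI impI)
        show "u 0 = 0" using le[OF m0, of 0] ge[of 0 0] sub m0 by (force simp: sublinear_def intro: antisym)
        fix x y
        \<comment> \<open>The two terms of the sum may be estimated by different members of the
          chain; the smaller of the two members serves for both.\<close>
        have "u (x + y) - m x \<le> u y" if m: "m \<in> C" for m
        proof (rule ge)
          fix m' assume m': "m' \<in> C"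
          obtain n where n: "n \<in> C" "\<forall>x. n x \<le> m x" "\<forall>x. n x \<le> m' x"
            using chain[OF m m'] m m' unfolding P_def by blast
          have "u (x + y) \<le> n x + n y" using le[OF n(1), of "x + y"] sub[OF n(1)] unfolding sublinear_def by (meson order_trans)
          then show "u (x + y) - m x \<le> m' y" using n(2)[rule_format, of x] n(3)[rule_format, of y] by linarith
        qed
        then have "u (x + y) - u y \<le> u x" by (intro ge) (simp add: algebra_simps)
        then show "u (x + y) \<le> u x + u y" by simp
      next
        fix c :: real and x assume c: "0 < c"
        have "u (c *\<^sub>R x) / c \<le> u x"
          using le[of _ "c *\<^sub>R x"] sublinear_scale[OF sub c] c by (intro ge) (force simp: field_simps)
        then show "u (c *\<^sub>R x) \<le> c * u x" using c by (simp add: field_simps)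
      qed
      moreover have "u x \<le> p x" for x using le[OF m0, of x] m0 CS unfolding S_def by (force intro: order_trans)
      ultimately show ?thesis using le by (intro bexI[of _ u]) (auto simp: S_def P_def)
    qed
  qed
  then obtain m where m: "m \<in> S" "\<And>a. a \<in> S \<Longrightarrow> \<forall>x. a x \<le> m x \<Longrightarrow> a = m"
    unfolding P_def by blast
  have sub: "sublinear m" and mp: "m x \<le> p x" for x using m(1) by (auto simp: S_def)
  \<comment> \<open>Lowering \<open>m\<close> along \<open>v\<close> gives nothing new by
    minimality, which forces oddness; a sublinear odd functional is linear.\<close>
  have neg: "m (- v) = - m v" for v
  proof (rule antisym)
    obtain p' where p': "sublinear p'" "\<And>x. p' x \<le> m x" "p' (- v) \<le> - m v"
      using sublinear_lower_along[OF sub, of v] by blast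
    have "p' \<in> S" using p'(1,2) mp unfolding S_def by (blast intro: order_trans)
    then have "p' = m" using m(2) p'(2) by blast
    then show "m (- v) \<le> - m v" using p'(3) by simp
    show "- m v \<le> m (- v)" using sublinear_minus_le[OF sub, of "- v"] by simp
  qed
  have "linear m"
  proof (rule linearI)
    have le: "m (x + y) \<le> m x + m y" for x y using sub by (simp add: sublinear_def)
    show "m (x + y) = m x + m y" for x y
      using le[of x y] le[of "- x" "- y"] neg[of x] neg[of y] neg[of "x + y"] by simp
    fix c :: real and x
    consider "0 < c" | "c = 0" | "0 < - c" by linarith
    then show "m (c *\<^sub>R x) = c *\<^sub>R m x"
    proof cases
      case 1
      then show ?thesis by (simp add: sublinear_scale[OF sub])
    next
      case 2
      then show ?thesis using sub by (simp add: sublinear_def)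
    next
      case 3
      have "m (c *\<^sub>R x) = - m ((- c) *\<^sub>R x)" using neg[of "c *\<^sub>R x"] by simp
      then show ?thesis by (simp only: sublinear_scale[OF sub 3]) simp
    qed
  qed
  then show ?thesis using that mp by blast
qed

text \<open>The norm is first lowered along \<open>x\<close>; any linear functional below the result
  satisfies \<open>f (- x) \<le> - norm x\<close>.\<close>

lemma ex_norming_functional:
  fixes x :: "'a::real_normed_vector"
  obtains f :: "'a \<Rightarrow>\<^sub>L real" where "norm f \<le> 1" "f x = norm x"
proof -
  have "sublinear (norm :: 'a \<Rightarrow> real)" by (simp add: sublinear_def norm_triangle_ineq)
  then obtain p where p: "sublinear p" "\<And>y. p y \<le> norm y" "p (- x) \<le> - norm x"
    using sublinear_lower_along[of norm x] by blast
  obtain f where f: "linear f" "\<And>y. f y \<le> p y" using ex_linear_below_sublinear[OF p(1)] by blast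
  have abs: "\<bar>f y\<bar> \<le> norm y" for y
    using f(2)[of y] p(2)[of y] f(2)[of "- y"] p(2)[of "- y"] linear_neg[OF f(1), of y] by simp
  have "bounded_linear f"
    using abs linear_add[OF f(1)] linear_cmul[OF f(1)] by (intro bounded_linear_intro[of _ 1]) auto
  then have B: "blinfun_apply (Blinfun f) = f" by (rule bounded_linear_Blinfun_apply)
  have "norm (Blinfun f) \<le> 1" using abs by (intro norm_blinfun_bound) (auto simp: B)
  moreover have "f x = norm x"
    using f(2)[of "- x"] p(3) linear_neg[OF f(1), of x] abs[of x] by linarith
  ultimately show ?thesis using that[of "Blinfun f"] B by simp
qed

text \<open>By compactness, finitely many evaluations separate \<open>f\<close> from \<open>D\<close>; the separating vector is the
  gradient of their squared distance to \<open>f\<close> at a nearest point of \<open>D\<close>.\<close>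
lemma weak_star_separation:
  fixes D :: "('a::real_normed_vector \<Rightarrow>\<^sub>L real) set"
  assumes D: "compactin weak_star_topology D" "convex D" "D \<noteq> {}" and f: "f \<notin> D"
  obtains x s where "f x < s" "\<And>h. h \<in> D \<Longrightarrow> s \<le> h x"
proof -
  \<comment> \<open>The sets on which evaluation at \<open>a\<close> differs from \<open>f a\<close>
    are open and cover \<open>D\<close>, so finitely many \<open>a\<close> tell \<open>f\<close>
    from all of \<open>D\<close>.\<close>
  have U: "openin weak_star_topology {g. blinfun_apply g a \<noteq> f a}" for a
  proof -
    have "{g. blinfun_apply g a \<noteq> f a} = {g \<in> topspace weak_star_topology. blinfun_apply g a \<in> - {f a}}" by auto
    then show ?thesis
      using openin_continuous_map_preimage[OF continuous_map_weak_star_apply, of "- {f a}" a]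
      by (simp add: open_Compl)
  qed
  have "\<exists>\<F>. finite \<F> \<and> \<F> \<subseteq> range (\<lambda>a. {g. blinfun_apply g a \<noteq> f a}) \<and> D \<subseteq> \<Union> \<F>"
  proof (rule compactinD[OF D(1)])
    show "D \<subseteq> \<Union> (range (\<lambda>a. {g. blinfun_apply g a \<noteq> f a}))"
    proof
      fix g assume "g \<in> D"
      then have "g \<noteq> f" using f by blast
      then show "g \<in> \<Union> (range (\<lambda>a. {g. blinfun_apply g a \<noteq> f a}))" using blinfun_eqI[of g f] by blast
    qed
  qed (use U in auto)
  then obtain \<F> where F: "finite \<F>" "\<F> \<subseteq> range (\<lambda>a. {g. blinfun_apply g a \<noteq> f a})" "D \<subseteq> \<Union> \<F>"
    by blast
  obtain A where "A \<subseteq> UNIV" "finite A" "\<F> = (\<lambda>a. {g. blinfun_apply g a \<noteq> f a}) ` A"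
    using finite_subset_image[OF F(1,2)] by blast
  then have A: "finite A" "D \<subseteq> (\<Union>a\<in>A. {g. blinfun_apply g a \<noteq> f a})"
    using F(3) by simp_all
  define Q where "Q g = (\<Sum>a\<in>A. (blinfun_apply g a - f a) * (blinfun_apply g a - f a))" for g
  have "continuous_map weak_star_topology euclideanreal Q"
    unfolding Q_def using A(1)
    by (intro continuous_map_sum continuous_map_real_mult continuous_map_diff continuous_map_weak_star_apply) auto
  then have "compact (Q ` D)" using image_compactin[OF D(1)] by fastforce
  then obtain h0 where h0: "h0 \<in> D" "\<And>h. h \<in> D \<Longrightarrow> Q h0 \<le> Q h"
    using compact_attains_inf[of "Q ` D"] D(3) by auto
  obtain a0 where "a0 \<in> A" "h0 a0 \<noteq> f a0" using A(2) h0(1) by blast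
  then have "0 < (h0 a0 - f a0) * (h0 a0 - f a0)" by (simp add: zero_less_mult_iff) linarith
  also have "\<dots> \<le> Q h0"
    unfolding Q_def using \<open>a0 \<in> A\<close> A(1) by (intro member_le_sum) auto
  finally have pos: "0 < Q h0" .
  \<comment> \<open>Half the gradient of \<open>Q\<close> at the nearest point \<open>h0\<close>;
    evaluation at \<open>x\<close> exceeds its value at \<open>f\<close> by exactly
    \<open>Q h0\<close> when taken at \<open>h0\<close>.\<close>
  define x where "x = (\<Sum>a\<in>A. (h0 a - f a) *\<^sub>R a)"
  have apply_x: "blinfun_apply g x = (\<Sum>a\<in>A. (h0 a - f a) * g a)" for g
    by (simp add: x_def blinfun.sum_right blinfun.scaleR_right)
  have fx: "h0 x = f x + Q h0"
    by (simp add: apply_x Q_def sum.distrib[symmetric] algebra_simps)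
  have "h0 x \<le> h x" if h: "h \<in> D" for h
  proof (rule ccontr)
    assume "\<not> h0 x \<le> h x"
    define l where "l = h0 x - h x"
    define R where "R = (\<Sum>a\<in>A. (h a - h0 a) * (h a - h0 a))"
    have l: "0 < l" using \<open>\<not> h0 x \<le> h x\<close> by (simp add: l_def)
    have R: "0 \<le> R" unfolding R_def by (intro sum_nonneg) auto
    \<comment> \<open>Moving from \<open>h0\<close> towards \<open>h\<close> by \<open>t\<close>
      changes \<open>Q\<close> by \<open>t * (t * R - 2 * l)\<close>; this \<open>t\<close> makes
      the change negative, against minimality of \<open>h0\<close>.\<close>
    define t where "t = min 1 (l / (R + 1))"
    have t: "0 < t" "t \<le> 1" "t * R < 2 * l"
    proof -
      show "0 < t" "t \<le> 1" using l R by (auto simp: t_def)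
      have "t * R \<le> l / (R + 1) * R" using R by (intro mult_right_mono) (auto simp: t_def)
      also have "\<dots> \<le> l" using l R by (simp add: field_simps)
      finally show "t * R < 2 * l" using l by simp
    qed
    have "(1 - t) *\<^sub>R h0 + t *\<^sub>R h \<in> D" using convexD[OF D(2) h0(1) h, of "1 - t" t] t by simp
    then have "Q h0 \<le> Q ((1 - t) *\<^sub>R h0 + t *\<^sub>R h)" by (rule h0(2))
    also have "\<dots> = Q h0 - 2 * t * l + t * t * R"
      unfolding Q_def l_def R_def apply_x sum_subtractf[symmetric] sum_distrib_left sum.distrib[symmetric]
      by (intro sum.cong refl) (simp only: blinfun.add_left blinfun.scaleR_left real_scaleR_def, simp add: algebra_simps)
    finally have "0 \<le> t * (t * R - 2 * l)" by (simp add: algebra_simps)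
    then show False using t by (simp add: zero_le_mult_iff)
  qed
  then show ?thesis using that[of x "h0 x"] fx pos by simp
qed

section \<open>The norm on the space whose dual unit ball is a prescribed weak* compact convex
  symmetric set\<close>

definition polar_norm :: "('a::real_normed_vector \<Rightarrow>\<^sub>L real) set \<Rightarrow> 'a \<Rightarrow> real" where
  "polar_norm D x = (SUP h\<in>D. \<bar>blinfun_apply h x\<bar>)"

context
  fixes D :: "('a::real_normed_vector \<Rightarrow>\<^sub>L real) set" and \<rho> :: real
  assumes compact_D: "compactin weak_star_topology D" and convex_D: "convex D"
    and uminus_D: "\<And>h. h \<in> D \<Longrightarrow> - h \<in> D"
    and \<rho>: "0 < \<rho>" "cball 0 \<rho> \<subseteq> D" and D_le: "D \<subseteq> cball 0 1"
begin

lemma apply_le_polar_norm: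
  assumes "h \<in> D"
  shows "\<bar>h x\<bar> \<le> polar_norm D x"
proof -
  have "\<bar>g x\<bar> \<le> norm x" if "g \<in> D" for g
    using norm_blinfun[of g x] mult_right_mono[of "norm g" 1 "norm x"] that D_le by fastforce
  then show ?thesis
    unfolding polar_norm_def using assms by (intro cSUP_upper bdd_aboveI2[of _ _ "norm x"]) auto
qed

lemma polar_norm_le:
  assumes "\<And>h. h \<in> D \<Longrightarrow> \<bar>h x\<bar> \<le> r"
  shows "polar_norm D x \<le> r"
proof -
  have "D \<noteq> {}" using \<rho> by force
  then show ?thesis unfolding polar_norm_def using assms by (intro cSUP_least) auto
qed

lemma norm_le_polar_norm: "\<rho> * norm x \<le> polar_norm D x"
proof -
  obtain f :: "'a \<Rightarrow>\<^sub>L real" where f: "norm f \<le> 1" "f x = norm x" by (rule ex_norming_functional)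
  have "norm (\<rho> *\<^sub>R f) \<le> \<rho>" using f(1) \<rho>(1) by (simp add: mult_left_le)
  then have "\<rho> *\<^sub>R f \<in> D" using \<rho>(2) by auto
  then have "\<bar>(\<rho> *\<^sub>R f) x\<bar> \<le> polar_norm D x" by (rule apply_le_polar_norm)
  then show ?thesis using f(2) \<rho>(1) by (simp add: blinfun.scaleR_left)
qed

lemma polar_norm_scale_le: "polar_norm D (a *\<^sub>R x) \<le> \<bar>a\<bar> * polar_norm D x"
  by (rule polar_norm_le) (simp add: blinfun.scaleR_right abs_mult mult_left_mono apply_le_polar_norm)

lemma polar_norm_scale: "polar_norm D (a *\<^sub>R x) = \<bar>a\<bar> * polar_norm D x"
proof (cases "a = 0")
  case True
  then show ?thesis
    using norm_le_polar_norm[of 0] polar_norm_scale_le[of 0 x] by simp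
next
  case False
  have "polar_norm D (inverse a *\<^sub>R (a *\<^sub>R x)) \<le> \<bar>inverse a\<bar> * polar_norm D (a *\<^sub>R x)"
    by (rule polar_norm_scale_le)
  then have "\<bar>a\<bar> * polar_norm D x \<le> polar_norm D (a *\<^sub>R x)"
    using False by (simp add: field_simps)
  then show ?thesis using polar_norm_scale_le[of a x] by simp
qed

lemma equivalent_norm_polar_norm: "equivalent_norm (polar_norm D)"
proof -
  have upper: "polar_norm D x \<le> 1 * norm x" for x
  proof (rule polar_norm_le)
    fix g assume "g \<in> D"
    then show "\<bar>g x\<bar> \<le> 1 * norm x"
      using norm_blinfun[of g x] mult_right_mono[of "norm g" 1 "norm x"] D_le by fastforce
  qed
  have "polar_norm D x = 0 \<longleftrightarrow> x = 0" for x
  proof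
    assume "polar_norm D x = 0"
    then show "x = 0" using norm_le_polar_norm[of x] \<rho>(1) by (simp add: mult_le_0_iff)
  next
    assume "x = 0"
    then show "polar_norm D x = 0" using polar_norm_scale[of 0 x] by simp
  qed
  moreover have "polar_norm D (x + y) \<le> polar_norm D x + polar_norm D y" for x y
  proof (rule polar_norm_le)
    fix h assume "h \<in> D"
    then show "\<bar>h (x + y)\<bar> \<le> polar_norm D x + polar_norm D y"
      using apply_le_polar_norm[of h x] apply_le_polar_norm[of h y] by (simp add: blinfun.add_right)
  qed
  moreover have "\<exists>B>0. \<forall>x. \<rho> * norm x \<le> polar_norm D x \<and> polar_norm D x \<le> B * norm x"
    by (rule exI[of _ 1]) (simp add: norm_le_polar_norm upper[simplified])
  ultimately show ?thesis
    unfolding equivalent_norm_def using polar_norm_scale \<rho>(1) by blast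
qed

lemma apply_le_dual_norm:
  assumes "polar_norm D x \<le> 1"
  shows "\<bar>blinfun_apply f x\<bar> \<le> dual_norm (polar_norm D) f"
proof -
  have "\<bar>f y\<bar> \<le> norm f * (1 / \<rho>)" if "polar_norm D y \<le> 1" for y
  proof -
    have "norm y \<le> 1 / \<rho>" using norm_le_polar_norm[of y] that \<rho>(1) by (simp add: field_simps)
    then have "norm f * norm y \<le> norm f * (1 / \<rho>)" by (intro mult_left_mono) auto
    then show ?thesis using norm_blinfun[of f y] by simp
  qed
  then show ?thesis
    unfolding dual_norm_def using assms by (intro cSUP_upper bdd_aboveI2[of _ _ "norm f * (1 / \<rho>)"]) auto
qed

lemma dual_norm_polar_norm_le:
  assumes "0 < l" "f /\<^sub>R l \<in> D"
  shows "dual_norm (polar_norm D) f \<le> l"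
  unfolding dual_norm_def
proof (rule cSUP_least)
  have "polar_norm D 0 \<le> 1" using polar_norm_scale[of 0 0] by simp
  then show "{x. polar_norm D x \<le> 1} \<noteq> {}" by blast
  fix x assume "x \<in> {x. polar_norm D x \<le> 1}"
  then have "\<bar>(f /\<^sub>R l) x\<bar> \<le> 1" using apply_le_polar_norm[OF assms(2), of x] by simp
  then show "\<bar>f x\<bar> \<le> l" using assms(1) by (simp add: blinfun.scaleR_left abs_mult field_simps)
qed

text \<open>The bipolar half, converse to \<open>dual_norm_polar_norm_le\<close>: a functional
  outside \<open>D\<close> is separated from it by a vector, and symmetry of \<open>D\<close> turns
  the one-sided bound into a bound on the polar norm of that vector.\<close>

lemma scaled_in_of_dual_norm_le:
  assumes l: "0 < l" and f: "dual_norm (polar_norm D) f \<le> l"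
  shows "f /\<^sub>R l \<in> D"
proof (rule ccontr)
  assume "f /\<^sub>R l \<notin> D"
  moreover have "D \<noteq> {}" using \<rho> by force
  ultimately obtain x s where x: "(f /\<^sub>R l) x < s" "\<And>h. h \<in> D \<Longrightarrow> s \<le> h x"
    using weak_star_separation[OF compact_D convex_D] by blast
  have "\<bar>h x\<bar> \<le> - s" if "h \<in> D" for h
    using x(2)[OF that] x(2)[OF uminus_D[OF that]] by (simp add: blinfun.minus_left abs_le_iff)
  then have N: "polar_norm D x \<le> - s" by (rule polar_norm_le)
  \<comment> \<open>The midpoint of the separation gap. It is positive even if the polar norm of
    \<open>x\<close> vanishes, so \<open>x\<close> can be normalised by it.\<close>
  define r where "r = (- s - (f /\<^sub>R l) x) / 2"
  have "0 \<le> polar_norm D x" using norm_le_polar_norm[of x] \<rho>(1) by (smt (verit) norm_ge_zero mult_nonneg_nonneg)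
  then have r: "0 < r" "- s \<le> r" "r < \<bar>(f /\<^sub>R l) x\<bar>" using N x(1) by (auto simp: r_def)
  have "polar_norm D (x /\<^sub>R r) \<le> 1"
    using N r(1,2) by (simp add: polar_norm_scale field_simps)
  then have "\<bar>f (x /\<^sub>R r)\<bar> \<le> l" using apply_le_dual_norm f by (meson order_trans)
  then have "\<bar>(f /\<^sub>R l) x\<bar> \<le> r"
    using r(1) l by (simp add: blinfun.scaleR_left blinfun.scaleR_right abs_mult field_simps)
  then show False using r(3) by simp
qed

lemma dual_norm_le_norm: "dual_norm (polar_norm D) f \<le> norm f / \<rho>"
proof (cases "f = 0")
  case True
  show ?thesis unfolding True dual_norm_def
    using polar_norm_scale[of 0 0] by (intro cSUP_least) (auto intro: exI[of _ 0])
next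
  case False
  have "f /\<^sub>R (norm f / \<rho>) \<in> D" using False \<rho> by (intro subsetD[OF \<rho>(2)]) (simp add: field_simps)
  then show ?thesis using False \<rho>(1) by (intro dual_norm_polar_norm_le) auto
qed

end

section \<open>The renorming\<close>

text \<open>If \<open>f + g n\<close> had dual norm at most \<open>l = 1 + c * \<tau> powr q\<close>
  for infinitely many \<open>n\<close>, then shrinking by \<open>l\<close> would put it in the
  sublevel set \<open>D\<close>. The gain, applied at \<open>u = f /\<^sub>R l\<close>, would make
  \<open>\<phi> u\<close> too small: \<open>f\<close> is only slightly farther out on the same ray,
  yet \<open>\<phi> f\<close> is at least 1/2.\<close>

lemma renorming_of_convex_gauge:
  fixes \<phi> :: "('a::real_normed_vector \<Rightarrow>\<^sub>L real) \<Rightarrow> real"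
  assumes q: "0 \<le> q" and \<kappa>: "0 < \<kappa>" and L: "1 \<le> L"
    and zero: "\<phi> 0 = 0"
    and bounds: "\<And>f. f \<in> cball 0 1 \<Longrightarrow> norm f \<le> \<phi> f \<and> \<phi> f \<le> L"
    and even: "\<And>f. f \<in> cball 0 1 \<Longrightarrow> \<phi> (- f) = \<phi> f"
    and convex: "\<And>f h u v. f \<in> cball 0 1 \<Longrightarrow> h \<in> cball 0 1 \<Longrightarrow> 0 \<le> u \<Longrightarrow> 0 \<le> v \<Longrightarrow> u + v = 1 \<Longrightarrow>
      \<phi> (u *\<^sub>R f + v *\<^sub>R h) \<le> u * \<phi> f + v * \<phi> h"
    and lsc: "\<And>f s. f \<in> cball 0 1 \<Longrightarrow> s < \<phi> f \<Longrightarrow>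
      \<exists>V. openin weak_star_topology V \<and> f \<in> V \<and> (\<forall>h\<in>cball 0 1 \<inter> V. s < \<phi> h)"
    and gain: "\<And>f \<sigma>. f \<in> cball 0 1 \<Longrightarrow> 0 < \<sigma> \<Longrightarrow>
      \<exists>V. openin weak_star_topology V \<and> f \<in> V \<and>
        (\<forall>h\<in>cball 0 1 \<inter> V. \<sigma> \<le> norm (h - f) \<longrightarrow> \<phi> f + \<kappa> * \<sigma> powr q \<le> \<phi> h)"
  obtains N :: "'a \<Rightarrow> real" and c where "equivalent_norm N" "0 < c"
    "\<And>\<tau> (f :: 'a \<Rightarrow>\<^sub>L real) g. 0 < \<tau> \<Longrightarrow> \<tau> \<le> 1 \<Longrightarrow> dual_norm N f = 1 \<Longrightarrow> \<forall>n. dual_norm N (g n) = \<tau> \<Longrightarrow>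
      limitin weak_star_topology g 0 sequentially \<Longrightarrow>
      ereal (1 + c * \<tau> powr q) \<le> liminf (\<lambda>n. ereal (dual_norm N (f + g n)))"
proof -
  define D where "D = {f \<in> cball 0 1. \<phi> f \<le> 1 / 2}"
  \<comment> \<open>By convexity along the segment from 0, shrinking the unit ball by
    \<open>\<rho>\<close> brings \<open>\<phi>\<close> down to
    \<open>\<rho> * L = 1 / 2\<close>.\<close>
  define \<rho> where "\<rho> = 1 / (2 * L)"
  define N where "N = polar_norm D"
  have \<rho>: "0 < \<rho>" "\<rho> \<le> 1" using L by (simp_all add: \<rho>_def)
  have D_half: "norm f \<le> 1 / 2" if "f \<in> D" for f
    using that bounds[of f] by (auto simp: D_def simp del: mem_cball_0)
  have D_sub: "D \<subseteq> cball 0 1" by (auto simp: D_def)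
  have "closedin weak_star_topology D"
    unfolding closedin_def
  proof (intro conjI)
    show "openin weak_star_topology (topspace weak_star_topology - D)"
    proof (subst openin_subopen, intro ballI)
      fix f assume "f \<in> topspace weak_star_topology - D"
      then have f: "f \<notin> D" by simp
      show "\<exists>V. openin weak_star_topology V \<and> f \<in> V \<and> V \<subseteq> topspace weak_star_topology - D"
      proof (cases "f \<in> cball 0 1")
        case True
        then have "1 / 2 < \<phi> f" using f by (simp add: D_def)
        then obtain V where "openin weak_star_topology V" "f \<in> V" "\<forall>h\<in>cball 0 1 \<inter> V. 1 / 2 < \<phi> h"
          using lsc[OF True] by blast
        then show ?thesis by (intro exI[of _ V]) (fastforce simp: D_def not_le[symmetric])
      next
        case False
        then show ?thesis
          using openin_weak_star_norm_greater[of 1 0] by (intro exI[of _ "{h. 1 < norm (h - 0)}"]) (auto simp: D_def)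
      qed
    qed
  qed simp
  then have compact: "compactin weak_star_topology D"
    using compactin_weak_star_cball D_sub by (metis closed_compactin)
  have conv: "convex D"
  proof (rule convexI)
    fix f h and u v :: real assume f: "f \<in> D" and h: "h \<in> D" and uv: "0 \<le> u" "0 \<le> v" "u + v = 1"
    have fh: "f \<in> cball 0 1" "h \<in> cball 0 1" using f h D_sub by auto
    have "\<phi> (u *\<^sub>R f + v *\<^sub>R h) \<le> u * \<phi> f + v * \<phi> h" by (rule convex[OF fh uv])
    also have "\<dots> \<le> 1 / 2" using f h uv by (intro convex_bound_le) (auto simp: D_def)
    finally show "u *\<^sub>R f + v *\<^sub>R h \<in> D"
      using convexD[OF convex_cball fh uv] by (simp add: D_def)
  qed
  have neg: "- f \<in> D" if "f \<in> D" for f using that even by (auto simp: D_def)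
  have ball_D: "cball 0 \<rho> \<subseteq> D"
  proof
    fix f :: "'a \<Rightarrow>\<^sub>L real" assume f: "f \<in> cball 0 \<rho>"
    have "norm (f /\<^sub>R \<rho>) \<le> 1" using f \<rho>(1) by (simp add: field_simps)
    then have h: "f /\<^sub>R \<rho> \<in> cball 0 1" by simp
    have "\<phi> (\<rho> *\<^sub>R (f /\<^sub>R \<rho>) + (1 - \<rho>) *\<^sub>R 0) \<le> \<rho> * \<phi> (f /\<^sub>R \<rho>) + (1 - \<rho>) * \<phi> 0"
      using \<rho> h by (intro convex) auto
    also have "\<dots> \<le> \<rho> * L" using bounds[OF h] \<rho>(1) zero by simp
    also have "\<dots> = 1 / 2" using L by (simp add: \<rho>_def)
    finally have "\<phi> f \<le> 1 / 2" using \<rho>(1) by simp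
    then show "f \<in> D" using f \<rho>(2) by (simp add: D_def)
  qed
  note polar = compact conv neg \<rho>(1) ball_D D_sub
  have le: "dual_norm N f \<le> l" if "0 < l" "f /\<^sub>R l \<in> D" for f l
    unfolding N_def using dual_norm_polar_norm_le[OF polar that] .
  have ge: "f /\<^sub>R l \<in> D" if "0 < l" "dual_norm N f \<le> l" for f l
    using scaled_in_of_dual_norm_le[OF polar, of l f] that unfolding N_def by blast
  have le_norm: "\<rho> * dual_norm N f \<le> norm f" for f
    using dual_norm_le_norm[OF polar, of f] \<rho>(1) unfolding N_def by (simp add: field_simps)
  \<comment> \<open>Doubles of points of \<open>D\<close> remain in the unit ball, where
    \<open>\<phi>\<close> is at most \<open>L\<close>; this bounds the growth of
    \<open>\<phi>\<close> on the way out to them.\<close>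
  have stretch: "\<phi> ((1 - t) *\<^sub>R h + t *\<^sub>R (2 *\<^sub>R f)) \<le> (1 - t) * \<phi> h + t * L"
    if "0 \<le> t" "t \<le> 1" "h \<in> cball 0 1" "f \<in> D" for t h f
  proof -
    have f2: "2 *\<^sub>R f \<in> cball 0 1" using D_half[OF that(4)] by simp
    have "\<phi> ((1 - t) *\<^sub>R h + t *\<^sub>R (2 *\<^sub>R f)) \<le> (1 - t) * \<phi> h + t * \<phi> (2 *\<^sub>R f)"
      using that f2 by (intro convex) auto
    also have "\<dots> \<le> (1 - t) * \<phi> h + t * L"
      using bounds[OF f2] that(1) by (intro add_left_mono mult_left_mono) auto
    finally show ?thesis .
  qed
  \<comment> \<open>If \<open>\<phi> f\<close> were below 1/2, a slightly larger multiple of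
    \<open>f\<close> would still be in \<open>D\<close>, and the dual norm of \<open>f\<close> would
    be less than 1.\<close>
  have unit: "f \<in> D \<and> 1 / 2 \<le> \<phi> f" if f: "dual_norm N f = 1" for f
  proof
    show fD: "f \<in> D" using ge[of 1 f] f by simp
    show "1 / 2 \<le> \<phi> f"
    proof (rule ccontr)
      assume "\<not> 1 / 2 \<le> \<phi> f"
      define s where "s = min 1 ((1 / 2 - \<phi> f) / L)"
      have s: "0 < s" "s \<le> 1" "s * L \<le> 1 / 2 - \<phi> f"
        using \<open>\<not> 1 / 2 \<le> \<phi> f\<close> L by (auto simp: s_def min_def field_simps)
      have fB: "f \<in> cball 0 1" using fD D_sub by blast
      have "(1 - s) *\<^sub>R f + s *\<^sub>R (2 *\<^sub>R f) = (1 + s) *\<^sub>R f"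
        by (simp add: algebra_simps scaleR_2)
      then have "\<phi> ((1 + s) *\<^sub>R f) \<le> (1 - s) * \<phi> f + s * L"
        using stretch[of s f f] s fB fD by simp
      also have "(1 - s) * \<phi> f \<le> \<phi> f"
      proof -
        have "0 \<le> \<phi> f" using bounds[OF fB] norm_ge_zero[of f] by linarith
        then show ?thesis using s by (simp add: mult_left_le_one_le)
      qed
      finally have "\<phi> ((1 + s) *\<^sub>R f) \<le> 1 / 2" using s(3) by linarith
      moreover have "norm ((1 + s) *\<^sub>R f) \<le> 1"
      proof -
        have "(1 + s) * norm f \<le> 2 * (1 / 2)" using s D_half[OF fD] by (intro mult_mono) auto
        then show ?thesis using s(1) by simp
      qed
      ultimately have "f /\<^sub>R (1 / (1 + s)) \<in> D" using s(1) by (simp add: D_def)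
      then have "dual_norm N f \<le> 1 / (1 + s)" using s(1) by (intro le) auto
      then show False using f s(1) by (simp add: field_simps)
    qed
  qed
  \<comment> \<open>A perturbation of dual norm \<open>\<tau>\<close> has norm at least
    \<open>\<rho> * \<tau>\<close>, and division by \<open>l \<le> 2\<close> leaves
    \<open>\<rho> / 2 * \<tau>\<close>.\<close>
  define k where "k = \<kappa> * (\<rho> / 2) powr q"
  \<comment> \<open>Stretching back from \<open>u\<close> to \<open>f\<close> costs at most
    \<open>c * L * \<tau> powr q\<close>, which is kept to half of the gain; the minimum with 1
    ensures \<open>l \<le> 2\<close>.\<close>
  define c where "c = min 1 (k / (2 * L))"
  have k: "0 < k" using \<kappa> \<rho>(1) by (simp add: k_def)
  have c: "0 < c" "c \<le> 1" "c * L \<le> k / 2" using k L by (auto simp: c_def min_def field_simps)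
  show ?thesis
  proof (rule that)
    show "equivalent_norm N" unfolding N_def by (rule equivalent_norm_polar_norm[OF polar])
    show "0 < c" by (rule c(1))
    fix \<tau> :: real and f :: "'a \<Rightarrow>\<^sub>L real" and g :: "nat \<Rightarrow> 'a \<Rightarrow>\<^sub>L real"
    assume \<tau>: "0 < \<tau>" "\<tau> \<le> 1" and f: "dual_norm N f = 1" and g: "\<forall>n. dual_norm N (g n) = \<tau>"
      and lim: "limitin weak_star_topology g 0 sequentially"
    define l where "l = 1 + c * \<tau> powr q"
    have tq: "0 < \<tau> powr q" "\<tau> powr q \<le> 1" using \<tau> q by (simp_all add: powr_le1)
    have l: "1 < l" "l \<le> 2" using c tq by (simp_all add: l_def mult_le_one)
    show "ereal (1 + c * \<tau> powr q) \<le> liminf (\<lambda>n. ereal (dual_norm N (f + g n)))"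
    proof (rule ccontr)
      assume "\<not> ?thesis"
      then obtain y where y: "y < ereal l" "\<not> (\<forall>\<^sub>F n in sequentially. y < ereal (dual_norm N (f + g n)))"
        unfolding le_Liminf_iff l_def by blast
      then have freq: "\<exists>\<^sub>F n in sequentially. dual_norm N (f + g n) \<le> l"
        unfolding not_eventually
        by (elim frequently_elim1) (metis ereal_less_eq(3) le_less_trans less_imp_le not_le)
      \<comment> \<open>The gain is local, so its centre must not depend on \<open>n\<close>;
        \<open>f /\<^sub>R l\<close> is such a centre and differs from the shrunken sum by a weak*
        null sequence.\<close>
      define u where "u = f /\<^sub>R l"
      have fD: "f \<in> D" and half: "1 / 2 \<le> \<phi> f" using unit[OF f] by auto
      have "norm u \<le> norm f" using l(1) by (simp add: u_def field_simps mult_le_cancel_right1)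
      then have uB: "u \<in> cball 0 1" using D_half[OF fD] by simp
      define \<sigma> where "\<sigma> = \<rho> / 2 * \<tau>"
      have \<sigma>: "0 < \<sigma>" using \<rho>(1) \<tau>(1) by (simp add: \<sigma>_def)
      obtain V where V: "openin weak_star_topology V" "u \<in> V"
          "\<And>h. h \<in> cball 0 1 \<inter> V \<Longrightarrow> \<sigma> \<le> norm (h - u) \<Longrightarrow> \<phi> u + \<kappa> * \<sigma> powr q \<le> \<phi> h"
        using gain[OF uB \<sigma>] by blast
      obtain A e where A: "finite A" "0 < e" "weak_star_nbhd A e u \<subseteq> V"
        using weak_star_nbhd_subset_open[OF V(1,2)] .
      have "\<forall>\<^sub>F n in sequentially. g n \<in> weak_star_nbhd A e 0"
        by (rule limitin_weak_star_nbhd[OF lim A(1,2)])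
      then have "\<exists>\<^sub>F n in sequentially. dual_norm N (f + g n) \<le> l \<and> g n \<in> weak_star_nbhd A e 0"
        by (rule frequently_eventually_frequently[OF freq])
      then obtain n where n: "dual_norm N (f + g n) \<le> l" "g n \<in> weak_star_nbhd A e 0"
        using frequently_ex by blast
      define h where "h = (f + g n) /\<^sub>R l"
      have hu: "h - u = g n /\<^sub>R l" by (simp add: h_def u_def scaleR_add_right)
      have hD: "h \<in> D" unfolding h_def using ge[of l "f + g n"] n(1) l(1) by simp
      have "\<bar>h a - u a\<bar> < e" if "a \<in> A" for a
      proof -
        have "h a - u a = g n a / l"
          using arg_cong[OF hu, of "\<lambda>w. blinfun_apply w a"]
          by (simp add: blinfun.diff_left blinfun.scaleR_left divide_inverse mult.commute)
        moreover have "\<bar>g n a\<bar> / l \<le> \<bar>g n a\<bar>" using l(1) by (simp add: divide_le_eq mult_le_cancel_left1)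
        moreover have "\<bar>g n a\<bar> < e" using n(2) that by (simp add: weak_star_nbhd_def)
        ultimately show ?thesis using l(1) by (simp add: abs_divide)
      qed
      then have "h \<in> V" using A(3) by (auto simp: weak_star_nbhd_def)
      moreover have "\<sigma> \<le> norm (h - u)"
      proof -
        have "\<rho> * \<tau> \<le> norm (g n)" using le_norm[of "g n"] g by simp
        then have "\<rho> * \<tau> / 2 \<le> norm (g n) / l" using l \<rho>(1) \<tau>(1) by (intro frac_le) auto
        moreover have "norm (h - u) = norm (g n) / l"
          using l(1) by (simp add: hu divide_inverse_commute)
        ultimately show ?thesis by (simp add: \<sigma>_def)
      qed
      moreover have "h \<in> cball 0 1" using hD D_sub by (rule subsetD[rotated])
      ultimately have "\<phi> u + \<kappa> * \<sigma> powr q \<le> \<phi> h" using V(3)[of h] by simp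
      moreover have "\<phi> h \<le> 1 / 2" using hD by (simp add: D_def)
      moreover have "\<kappa> * \<sigma> powr q = k * \<tau> powr q"
        unfolding k_def \<sigma>_def by (subst powr_mult) (use \<rho>(1) \<tau>(1) in auto)
      ultimately have \<phi>u: "\<phi> u \<le> 1 / 2 - k * \<tau> powr q" by linarith
      \<comment> \<open>The weight that solves \<open>(1 - t) / l + 2 * t = 1\<close>, so that
        \<open>f\<close> is the convex combination of \<open>u\<close> and
        \<open>2 *\<^sub>R f\<close> with this weight.\<close>
      define t where "t = (l - 1) / (2 * l - 1)"
      have "t \<le> (l - 1) / 1" unfolding t_def using l by (intro divide_left_mono) auto
      then have t: "0 \<le> t" "t \<le> l - 1" "t \<le> 1" using l by (auto simp: t_def field_simps)
      have "(1 - t) / l + t * 2 = 1" using l by (simp add: t_def field_simps)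
      then have "(1 - t) *\<^sub>R u + t *\<^sub>R (2 *\<^sub>R f) = f"
        unfolding u_def by (simp add: divide_inverse flip: scaleR_add_left)
      then have "\<phi> f \<le> (1 - t) * \<phi> u + t * L" using stretch[OF t(1,3) uB fD] by simp
      also have "\<dots> \<le> \<phi> u + (l - 1) * L"
      proof (intro add_mono mult_right_mono)
        have "0 \<le> \<phi> u" using bounds[OF uB] norm_ge_zero[of u] by linarith
        then show "(1 - t) * \<phi> u \<le> \<phi> u" using t by (simp add: mult_left_le_one_le)
      qed (use t L in auto)
      also have "(l - 1) * L \<le> k / 2 * \<tau> powr q"
        using mult_right_mono[OF c(3), of "\<tau> powr q"] tq(1) by (simp add: l_def mult_ac)
      finally have "\<phi> f \<le> 1 / 2 - k / 2 * \<tau> powr q" using \<phi>u by linarith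
      moreover have "0 < k / 2 * \<tau> powr q" using k tq(1) by simp
      ultimately show False using half by linarith
    qed
  qed
qed

theorem theorem4p8:
  fixes q :: real
  assumes "separable_space (euclidean :: 'a::banach topology)"
    and "szlenk_index TYPE('a) = omega0"
    and "q > szlenk_power_type TYPE('a)"
  shows "\<exists>N :: 'a \<Rightarrow> real. equivalent_norm N \<and>
    (\<exists>c>0. \<forall>\<tau> (f :: 'a \<Rightarrow>\<^sub>L real) (g :: nat \<Rightarrow> 'a \<Rightarrow>\<^sub>L real).
      0 < \<tau> \<longrightarrow> \<tau> \<le> 1 \<longrightarrow>
      dual_norm N f = 1 \<longrightarrow> (\<forall>n. dual_norm N (g n) = \<tau>) \<longrightarrow>
      limitin weak_star_topology g 0 sequentially \<longrightarrow>
      liminf (\<lambda>n. ereal (dual_norm N (f + g n))) \<ge> ereal (1 + c * \<tau> powr q))"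
proof -
  have q: "1 \<le> q" using szlenk_power_type_ge_1[OF assms(2)] assms(3) by simp
  obtain F :: "('a \<Rightarrow>\<^sub>L real) \<Rightarrow> real" and M c where c: "0 < c"
      and F: "\<And>f. f \<in> cball 0 1 \<Longrightarrow> 0 \<le> F f \<and> F f \<le> M" "\<And>f. F (- f) = F f"
        "\<And>f \<delta>. f \<in> cball 0 1 \<Longrightarrow> 0 < \<delta> \<Longrightarrow> \<exists>A e. finite A \<and> 0 < e \<and>
          (\<forall>h\<in>cball 0 1 \<inter> weak_star_nbhd A e f. F h + c * norm (h - f) powr q \<le> F f + \<delta>)"
    by (rule ex_rank_function[OF assms(2,3)], rule that)
  obtain G :: "('a \<Rightarrow>\<^sub>L real) \<Rightarrow> real" where G:
    "\<And>f. f \<in> cball 0 1 \<Longrightarrow> 0 \<le> G f \<and> G f \<le> M"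
    "\<And>f. f \<in> cball 0 1 \<Longrightarrow> G (- f) = G f"
    "\<And>f h u v. f \<in> cball 0 1 \<Longrightarrow> h \<in> cball 0 1 \<Longrightarrow> 0 \<le> u \<Longrightarrow> 0 \<le> v \<Longrightarrow> u + v = 1 \<Longrightarrow>
      u * G f + v * G h \<le> G (u *\<^sub>R f + v *\<^sub>R h)"
    "\<And>f s. f \<in> cball 0 1 \<Longrightarrow> G f < s \<Longrightarrow>
      \<exists>V. openin weak_star_topology V \<and> f \<in> V \<and> (\<forall>h\<in>cball 0 1 \<inter> V. G h < s)"
    "\<And>f \<tau> \<delta>. f \<in> cball 0 1 \<Longrightarrow> 0 < \<tau> \<Longrightarrow> 0 < \<delta> \<Longrightarrow>
      \<exists>V. openin weak_star_topology V \<and> f \<in> V \<and>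
        (\<forall>h\<in>cball 0 1 \<inter> V. \<tau> \<le> norm (h - f) \<longrightarrow> G h + c * (\<tau> / 8) powr q \<le> G f + \<delta>)"
    by (rule ex_concave_envelope[OF q c], rule F(1), assumption, rule F(2), rule F(3), assumption,
        assumption, rule that)
  define \<phi> where "\<phi> f = norm f + (G 0 - G f)" for f
  \<comment> \<open>Half of the drop constant of \<open>G\<close>: a quarter of the drop is lost to
    the semicontinuity of the norm and a quarter to the error in the drop.\<close>
  define \<kappa> where "\<kappa> = c * (1 / 8) powr q / 2"
  have \<kappa>: "0 < \<kappa>" using c by (simp add: \<kappa>_def)
  have norm_lsc: "openin weak_star_topology {h :: 'a \<Rightarrow>\<^sub>L real. r < norm h}" for r
    using openin_weak_star_norm_greater[of r 0] by simp
  \<comment> \<open>The point 0 is the midpoint of \<open>f\<close> and \<open>- f\<close>, so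
    concavity and evenness make it a maximum of \<open>G\<close>; this is why \<open>\<phi>\<close>
    dominates the norm.\<close>
  have G0: "G f \<le> G 0" if "f \<in> cball 0 1" for f
    using G(3)[of f "- f" "1/2" "1/2"] G(2)[OF that] that by simp
  obtain N :: "'a \<Rightarrow> real" and c' where N: "equivalent_norm N" "0 < c'"
    "\<And>\<tau> (f :: 'a \<Rightarrow>\<^sub>L real) g. 0 < \<tau> \<Longrightarrow> \<tau> \<le> 1 \<Longrightarrow> dual_norm N f = 1 \<Longrightarrow> \<forall>n. dual_norm N (g n) = \<tau> \<Longrightarrow>
      limitin weak_star_topology g 0 sequentially \<Longrightarrow>
      ereal (1 + c' * \<tau> powr q) \<le> liminf (\<lambda>n. ereal (dual_norm N (f + g n)))"
  proof (rule renorming_of_convex_gauge[of q \<kappa> "M + 1" \<phi>])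
    show "0 \<le> q" "0 < \<kappa>" using q \<kappa> by auto
    show "1 \<le> M + 1" using F(1)[of 0] by simp
    show "\<phi> 0 = 0" by (simp add: \<phi>_def)
    fix f :: "'a \<Rightarrow>\<^sub>L real" assume f: "f \<in> cball 0 1"
    show "norm f \<le> \<phi> f \<and> \<phi> f \<le> M + 1" using f G(1)[OF f] G(1)[of 0] G0[OF f] by (simp add: \<phi>_def)
    show "\<phi> (- f) = \<phi> f" using G(2)[OF f] by (simp add: \<phi>_def)
    show "\<phi> (u *\<^sub>R f + v *\<^sub>R h) \<le> u * \<phi> f + v * \<phi> h"
      if "h \<in> cball 0 1" and uv: "0 \<le> u" "0 \<le> v" "u + v = 1" for h u v
    proof -
      have "norm (u *\<^sub>R f + v *\<^sub>R h) \<le> u * norm f + v * norm h"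
        using norm_triangle_ineq[of "u *\<^sub>R f" "v *\<^sub>R h"] uv by simp
      moreover have "u * G f + v * G h \<le> G (u *\<^sub>R f + v *\<^sub>R h)" by (rule G(3)[OF f that])
      moreover have "u * G 0 + v * G 0 = G 0" using uv(3) by (metis distrib_right mult_1)
      ultimately show ?thesis by (simp add: \<phi>_def algebra_simps)
    qed
    show "\<exists>V. openin weak_star_topology V \<and> f \<in> V \<and> (\<forall>h\<in>cball 0 1 \<inter> V. s < \<phi> h)" if "s < \<phi> f" for s
    proof -
      define d where "d = (\<phi> f - s) / 2"
      have d: "0 < d" using that by (simp add: d_def)
      then obtain V where V: "openin weak_star_topology V" "f \<in> V" "\<forall>h\<in>cball 0 1 \<inter> V. G h < G f + d"
        using G(4)[OF f, of "G f + d"] by auto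
      have "s < \<phi> h" if "h \<in> cball 0 1 \<inter> (V \<inter> {h. norm f - d < norm h})" for h
        using V(3)[rule_format, of h] that by (auto simp: \<phi>_def d_def field_simps)
      moreover have "openin weak_star_topology (V \<inter> {h. norm f - d < norm h})"
        using V(1) norm_lsc by blast
      ultimately show ?thesis using V(2) d by (intro exI[of _ "V \<inter> {h. norm f - d < norm h}"]) auto
    qed
    show "\<exists>V. openin weak_star_topology V \<and> f \<in> V \<and>
        (\<forall>h\<in>cball 0 1 \<inter> V. \<sigma> \<le> norm (h - f) \<longrightarrow> \<phi> f + \<kappa> * \<sigma> powr q \<le> \<phi> h)" if \<sigma>: "0 < \<sigma>" for \<sigma>
    proof -
      define d where "d = \<kappa> * \<sigma> powr q / 2"
      have d: "0 < d" using \<kappa> \<sigma> by (simp add: d_def)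
      have 4: "c * (\<sigma> / 8) powr q = 4 * d"
        using powr_mult[of \<sigma> "1/8" q] \<sigma> by (simp add: d_def \<kappa>_def)
      obtain V where V: "openin weak_star_topology V" "f \<in> V"
          "\<forall>h\<in>cball 0 1 \<inter> V. \<sigma> \<le> norm (h - f) \<longrightarrow> G h + c * (\<sigma> / 8) powr q \<le> G f + d"
        using G(5)[OF f \<sigma> d] by blast
      have "\<phi> f + \<kappa> * \<sigma> powr q \<le> \<phi> h"
        if h: "h \<in> cball 0 1 \<inter> (V \<inter> {h. norm f - d < norm h})" "\<sigma> \<le> norm (h - f)" for h
      proof -
        have "G h + 4 * d \<le> G f + d" using V(3) h unfolding 4 by blast
        moreover have "norm f - d < norm h" using h(1) by simp
        moreover have "\<kappa> * \<sigma> powr q = 2 * d" by (simp add: d_def)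
        ultimately show ?thesis by (simp add: \<phi>_def)
      qed
      moreover have "openin weak_star_topology (V \<inter> {h. norm f - d < norm h})"
        using V(1) norm_lsc by blast
      ultimately show ?thesis using V(2) d by (intro exI[of _ "V \<inter> {h. norm f - d < norm h}"]) auto
    qed
  qed blast
  then show ?thesis by blast
qed

end
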